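(* Let $k\in\mathbb{N}$, $N+1=2k$, and let $q\in\mathcal{Q}^{odd}$. Then: (i) $\det d_qh\neq0$ (meaning that $h$ is differentiable at $q$ with nonzero Jacobian determinant) if and only if $q\notin\mathcal{S}=\{q\in\mathcal{Q}^{odd}:\det d_q\Phi(q)=0\}$. (ii) If $q\notin\mathcal{S}$, then $h_n(q)>0$ for all $n=1,\dots,k$, i.e. all gaps $(\lambda_n^-(q),\lambda_n^+(q))$ are open (nonempty). (iii) If $\hat q_n\neq0$ for all $n=1,\dots,k$, then there exists $\tau=\tau(q)>0$ such that for every $s\in(0,\tau)$ the potential $p=sq$ satisfies $p\notin\mathcal{S}$ and $\#\mathrm{Iso}(p)=2^k$.
   Context: Fix $k\in\mathbb{N}$ and $N+1=2k$. Let $\mathcal{Q}^{odd}=\{q=(q_1,\dots,q_{N+1})\in\mathbb{R}^{N+1}: q_{N+2-n}=-q_n,\ n=1,\dots,N\}$, with the standard scalar product of $\mathbb{R}^{N+1}$; its elements are parametrized by $q_1,\dots,q_k$, and $d_q$ denotes the derivative with respect to $q_1,\dots,q_k$. Extend $q$ to an $(N+1)$-periodic sequence on $\mathbb{Z}$ and consider the operator $(Ly)_n=y_{n-1}+y_{n+1}+q_ny_n$ on $\ell^2(\mathbb{Z})$. Its spectrum $\sigma(q)$ consists of $N+1$ intervals $[\lambda_n^+,\lambda_{n+1}^-]$, $n=0,\dots,N$, with $\lambda_0^+<\lambda_1^-\le\lambda_1^+<\dots<\lambda_N^-\le\lambda_N^+<\lambda_{N+1}^-$. The gaps are $(\lambda_n^-,\lambda_n^+)$,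 $n=1,\dots,N$. Let $\varphi_n(\lambda,q),\vartheta_n(\lambda,q)$ be the solutions of $y_{n-1}+y_{n+1}+q_ny_n=\lambda y_n$, $n\in\mathbb{Z}$, with $\varphi_0=\vartheta_1=0$, $\varphi_1=\vartheta_0=1$, and let $\Delta(\lambda,q)=\varphi_{N+2}(\lambda,q)+\vartheta_{N+1}(\lambda,q)$ be the Lyapunov function. Then $\sigma(q)=\{\lambda\in\mathbb{R}:|\Delta(\lambda,q)|\le2\}$. For each $n=1,\dots,N$ there is a unique $\lambda_n=\lambda_n(q)\in[\lambda_n^-,\lambda_n^+]$ with $\partial_\lambda\Delta(\lambda_n,q)=0$; it satisfies $(-1)^{N+1-n}\Delta(\lambda_n,q)\ge2$. The number $h_n=h_n(q)\ge0$ is defined by $\Delta(\lambda_n,q)=2(-1)^{N+1-n}\cosh h_n$, and the mapping $h:\mathcal{Q}^{odd}\to\mathbb{R}^k$ is $h(q)=\{h_n(q)\}_{n=1}^k$. For $q\in\mathcal{Q}^{odd}$ the polynomial $\Delta(\cdot,q)$ is even in $\lambda$, and the mapping $\Phi:\mathcal{Q}^{odd}\to\mathbb{R}^k$, $\Phi(q)=\{\phi_{2n-1}(q)\}_{n=1}^k$, is defined by $\Delta(\lambda,q)=\lambda^{N+1}+\phi_1(q)\lambda^{N-1}+\phi_3(q)\lambda^{N-3}+\dots+\phi_N(q)$. The isospectral set is $\mathrm{Iso}(q)=\{p\in\mathcal{Q}^{odd}:\sigma(p)=\sigma(q)\}$, and $\#A$ denotes the number of elements of $A$. An orthonormal basis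 of $\mathcal{Q}^{odd}$ is $\hat e_m=\frac{2^{-\delta_{k,m}/2}}{\sqrt k}\left\{\sin\frac{(2n-1)m\pi}{2k}\right\}_{n=1}^{N+1}$, $m=1,\dots,k$ ($\delta_{k,m}$ the Kronecker symbol), and the coordinates $\hat q_m$ are defined by $q=\sum_{m=1}^k\hat q_m\hat e_m$. *)

theory Defs
  imports "HOL-Analysis.Analysis" "HOL-Computational_Algebra.Polynomial"
begin

subsection \<open>The spectrum of an operator on \<open>l\<^sup>2\<close> of the integers\<close>

definition l2Z :: "(int \<Rightarrow> complex) set" where
  "l2Z = {y. (\<lambda>n. (cmod (y n))\<^sup>2) summable_on UNIV}"

definition l2Z_norm :: "(int \<Rightarrow> complex) \<Rightarrow> real" where
  "l2Z_norm y = sqrt (\<Sum>\<^sub>\<infinity>n. (cmod (y n))\<^sup>2)"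

definition resolvent_set :: "((int \<Rightarrow> complex) \<Rightarrow> int \<Rightarrow> complex) \<Rightarrow> complex set" where
  "resolvent_set T = {z.
     bij_betw (\<lambda>y n. T y n - z * y n) l2Z l2Z \<and>
     (\<exists>C. \<forall>y\<in>l2Z. l2Z_norm y \<le> C * l2Z_norm (\<lambda>n. T y n - z * y n))}"

definition op_spectrum :: "((int \<Rightarrow> complex) \<Rightarrow> int \<Rightarrow> complex) \<Rightarrow> complex set" where
  "op_spectrum T = - resolvent_set T"


subsection \<open>Odd periodic potentials and the Lyapunov function\<close>

text \<open>
  Throughout, the period is \<open>N + 1 = 2 * k\<close>.  A vector of \<open>\<real>\<^bsup>2k\<^esup>\<close> with entries numbered from 1
  is identified with its \<open>2k\<close>-periodic extension to the integers.
\<close>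

definition Qodd :: "nat \<Rightarrow> (int \<Rightarrow> real) set" where
  "Qodd k = {q. (\<forall>n. q (n + 2 * int k) = q n) \<and>
                (\<forall>n\<in>{1..2 * int k - 1}. q (2 * int k + 1 - n) = - q n)}"

definition schroedinger :: "(int \<Rightarrow> real) \<Rightarrow> (int \<Rightarrow> complex) \<Rightarrow> int \<Rightarrow> complex" where
  "schroedinger q y n = y (n - 1) + y (n + 1) + complex_of_real (q n) * y n"

definition spec :: "(int \<Rightarrow> real) \<Rightarrow> complex set" where
  "spec q = op_spectrum (schroedinger q)"

text \<open>
  The solution for \<open>n \<ge> 0\<close> of \<open>y\<^bsub>n-1\<^esub> + y\<^bsub>n+1\<^esub> + q\<^bsub>n\<^esub> y\<^bsub>n\<^esub> = \<lambda> y\<^bsub>n\<^esub>\<close> with initial values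
  \<open>y\<^bsub>0\<^esub> = a\<close> and \<open>y\<^bsub>1\<^esub> = b\<close>, as a polynomial in \<open>\<lambda>\<close>.
\<close>

fun solution :: "(int \<Rightarrow> real) \<Rightarrow> real \<Rightarrow> real \<Rightarrow> nat \<Rightarrow> real poly" where
  "solution q a b 0 = [:a:]"
| "solution q a b (Suc 0) = [:b:]"
| "solution q a b (Suc (Suc n)) =
     [:- q (int (Suc n)), 1:] * solution q a b (Suc n) - solution q a b n"

definition lyapunov :: "nat \<Rightarrow> (int \<Rightarrow> real) \<Rightarrow> real poly" where
  "lyapunov k q = solution q 0 1 (2 * k + 1) + solution q 1 0 (2 * k)"

definition Iso :: "nat \<Rightarrow> (int \<Rightarrow> real) \<Rightarrow> (int \<Rightarrow> real) set" where
  "Iso k q = {p \<in> Qodd k. spec p = spec q}"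


subsection \<open>Band edges and gap heights\<close>

text \<open>
  \<open>lm n\<close> and \<open>lp n\<close> are \<open>\<lambda>\<^sub>n\<^sup>-\<close> (\<open>1 \<le> n \<le> 2k\<close>) and \<open>\<lambda>\<^sub>n\<^sup>+\<close> (\<open>0 \<le> n < 2k\<close>).
  The spectrum as a set does not see where two touching bands are to be separated; the last
  conjunct, that every possibly degenerate closed gap contains exactly one critical point of the
  Lyapunov function, puts closed gaps at the interior critical points where the Lyapunov function
  is \<open>2\<close> or \<open>-2\<close> and makes the edges unique.
\<close>

definition band_edges :: "nat \<Rightarrow> (int \<Rightarrow> real) \<Rightarrow> (nat \<Rightarrow> real) \<Rightarrow> (nat \<Rightarrow> real) \<Rightarrow> bool" where
  "band_edges k q lm lp \<longleftrightarrow>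
     (\<forall>n\<in>{0..2 * k - 1}. lp n < lm (n + 1)) \<and>
     (\<forall>n\<in>{1..2 * k - 1}. lm n \<le> lp n) \<and>
     spec q = complex_of_real ` (\<Union>n\<in>{0..2 * k - 1}. {lp n..lm (n + 1)}) \<and>
     (\<forall>n\<in>{1..2 * k - 1}. \<exists>!x. x \<in> {lm n..lp n} \<and> poly (pderiv (lyapunov k q)) x = 0)"

definition lambda_minus :: "nat \<Rightarrow> (int \<Rightarrow> real) \<Rightarrow> nat \<Rightarrow> real" where
  "lambda_minus k q n = (THE x. \<exists>lm lp. band_edges k q lm lp \<and> x = lm n)"

definition lambda_plus :: "nat \<Rightarrow> (int \<Rightarrow> real) \<Rightarrow> nat \<Rightarrow> real" where
  "lambda_plus k q n = (THE x. \<exists>lm lp. band_edges k q lm lp \<and> x = lp n)"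

definition lambda_crit :: "nat \<Rightarrow> (int \<Rightarrow> real) \<Rightarrow> nat \<Rightarrow> real" where
  "lambda_crit k q n =
     (THE x. x \<in> {lambda_minus k q n..lambda_plus k q n} \<and> poly (pderiv (lyapunov k q)) x = 0)"

definition gap_height :: "nat \<Rightarrow> (int \<Rightarrow> real) \<Rightarrow> nat \<Rightarrow> real" where
  "gap_height k q n =
     (THE t. 0 \<le> t \<and> poly (lyapunov k q) (lambda_crit k q n) = 2 * (- 1) ^ (2 * k - n) * cosh t)"


subsection \<open>The mappings \<open>h\<close> and \<open>\<Phi>\<close> and their Jacobians\<close>

text \<open>
  \<open>\<real>\<^sup>k\<close> is rendered as \<open>real ^ 'k\<close> with \<open>'k\<close> a finite linearly ordered type of \<open>k\<close> elements;
  \<open>idx\<close> is the order isomorphism from \<open>'k\<close> onto \<open>{1..k}\<close>.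
\<close>

definition idx :: "'k::{finite,linorder} \<Rightarrow> nat" where
  "idx i = card {..i}"

definition coords :: "(int \<Rightarrow> real) \<Rightarrow> real ^ 'k::{finite,linorder}" where
  "coords q = (\<chi> i. q (int (idx i)))"

definition of_coords :: "real ^ 'k::{finite,linorder} \<Rightarrow> int \<Rightarrow> real" where
  "of_coords x n =
     (let k = int CARD('k); r = (n - 1) mod (2 * k) + 1 in
      if r \<le> k then x $ inv idx (nat r) else - x $ inv idx (nat (2 * k + 1 - r)))"

lemma idx_less: "i < j \<Longrightarrow> idx i < idx j"
  unfolding idx_def by (rule psubset_card_mono) auto

lemma inj_idx: "inj idx"
  by (rule linorder_injI) (use idx_less in fastforce)

lemma idx_bounds: "1 \<le> idx i" "idx (i :: 'k::{finite,linorder}) \<le> CARD('k)"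
proof -
  have "card {i} \<le> card {..i}"
    by (rule card_mono) auto
  then show "1 \<le> idx i"
    by (simp add: idx_def)
  show "idx i \<le> CARD('k)"
    unfolding idx_def by (rule card_mono) auto
qed

lemma bij_betw_idx: "bij_betw (idx :: 'k::{finite,linorder} \<Rightarrow> nat) UNIV {1..CARD('k)}"
proof -
  have "range (idx :: 'k \<Rightarrow> nat) = {1..CARD('k)}"
  proof (rule card_subset_eq)
    show "range (idx :: 'k \<Rightarrow> nat) \<subseteq> {1..CARD('k)}"
      using idx_bounds by auto
    show "card (range (idx :: 'k \<Rightarrow> nat)) = card {1..CARD('k)}"
      using card_image[OF inj_idx] by simp
  qed simp
  then show ?thesis
    using inj_idx by (simp add: bij_betw_def)
qed

lemma idx_inv:
  assumes "1 \<le> n" "n \<le> CARD('k)"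
  shows "idx (inv idx n :: 'k::{finite,linorder}) = n"
proof -
  have "n \<in> range (idx :: 'k \<Rightarrow> nat)"
    using assms bij_betw_idx[where 'k = 'k] by (simp add: bij_betw_def)
  then show ?thesis
    by (rule f_inv_into_f)
qed

lemma of_coords_in_Qodd: "of_coords (x :: real ^ 'k::{finite,linorder}) \<in> Qodd CARD('k)"
proof -
  have "of_coords x (n + 2 * int CARD('k)) = of_coords x n" for n
  proof -
    have "(n + 2 * int CARD('k) - 1) mod (2 * int CARD('k)) = (n - 1) mod (2 * int CARD('k))"
      using mod_add_self2[of "n - 1" "2 * int CARD('k)"] by (simp add: algebra_simps)
    then show ?thesis
      by (simp add: of_coords_def)
  qed
  moreover have "of_coords x (2 * int CARD('k) + 1 - n) = - of_coords x n"
    if "n \<in> {1..2 * int CARD('k) - 1}" for n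
  proof -
    have "(2 * int CARD('k) + 1 - n - 1) mod (2 * int CARD('k)) = 2 * int CARD('k) - n"
      using mod_pos_pos_trivial[of "2 * int CARD('k) - n" "2 * int CARD('k)"] that
      by (simp add: algebra_simps)
    moreover have "(n - 1) mod (2 * int CARD('k)) = n - 1"
      by (intro mod_pos_pos_trivial) (use that in auto)
    ultimately show ?thesis
      by (simp add: of_coords_def Let_def diff_add_eq)
  qed
  ultimately show ?thesis
    by (simp add: Qodd_def)
qed

lemma coords_of_coords: "coords (of_coords x) = x"
proof -
  have "of_coords x (int (idx i)) = x $ i" for i
  proof -
    have "(int (idx i) - 1) mod (2 * int CARD('a)) = int (idx i) - 1"
      using idx_bounds[of i] by (intro mod_pos_pos_trivial) linarith+
    then show ?thesis
      using idx_bounds[of i] by (simp add: of_coords_def Let_def inv_f_f[OF inj_idx])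
  qed
  then show ?thesis
    by (simp add: coords_def vec_eq_iff)
qed

lemma of_coords_coords:
  assumes "q \<in> Qodd CARD('k)"
  shows "of_coords (coords q :: real ^ 'k::{finite,linorder}) = q"
proof
  fix n
  define k where "k = int CARD('k)"
  have k: "k > 0"
    by (simp add: k_def)
  define r where "r = (n - 1) mod (2 * k) + 1"
  have r: "1 \<le> r" "r \<le> 2 * k"
    using pos_mod_bound[of "2 * k" "n - 1"] pos_mod_sign[of "2 * k" "n - 1"] k
    unfolding r_def by linarith+
  have per: "q (j + 2 * k) = q j" for j
    using assms by (simp add: Qodd_def k_def)
  have per_nat: "q (j + 2 * k * int m) = q j" for j m
    by (induction m) (use per[of "j + 2 * k * int m" for m] in \<open>simp_all add: algebra_simps\<close>)
  have per_int: "q (j + 2 * k * m) = q j" for j m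
  proof (cases "m \<ge> 0")
    case True
    then show ?thesis
      using per_nat[of j "nat m"] by simp
  next
    case False
    then show ?thesis
      using per_nat[of "j + 2 * k * m" "nat (- m)"] by simp
  qed
  have "n = r + 2 * k * ((n - 1) div (2 * k))"
    unfolding r_def using mult_div_mod_eq[of "2 * k" "n - 1"] by linarith
  then have qn: "q n = q r"
    using per_int[of r "(n - 1) div (2 * k)"] by simp
  define c where "c = (coords q :: real ^ 'k::{finite,linorder})"
  have eq: "c $ inv idx (nat j) = q j" if "1 \<le> j" "j \<le> k" for j
    using that idx_inv[of "nat j", where 'k = 'k] by (simp add: c_def coords_def k_def nat_le_iff)
  have of_coords: "of_coords c n =
      (if r \<le> k then c $ inv idx (nat r)
       else - c $ inv idx (nat (2 * k + 1 - r)))"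
    by (simp add: of_coords_def Let_def r_def k_def)
  show "of_coords (coords q :: real ^ 'k::{finite,linorder}) n = q n"
  proof (cases "r \<le> k")
    case True
    then show ?thesis
      using eq[of r] r qn of_coords by (simp add: c_def)
  next
    case False
    have "\<forall>j\<in>{1..2 * k - 1}. q (2 * k + 1 - j) = - q j"
      using assms by (simp add: Qodd_def k_def)
    moreover have "2 * k + 1 - r \<in> {1..2 * k - 1}"
      using r False k by simp
    ultimately have "q (2 * k + 1 - (2 * k + 1 - r)) = - q (2 * k + 1 - r)"
      by blast
    then show ?thesis
      using False eq[of "2 * k + 1 - r"] r qn of_coords by (simp add: c_def)
  qed
qed

definition h_map :: "(int \<Rightarrow> real) \<Rightarrow> real ^ 'k::{finite,linorder}" where
  "h_map q = (\<chi> i. gap_height CARD('k) q (idx i))"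

definition Phi_map :: "(int \<Rightarrow> real) \<Rightarrow> real ^ 'k::{finite,linorder}" where
  "Phi_map q = (\<chi> i. coeff (lyapunov CARD('k) q) (2 * CARD('k) - 2 * idx i))"

definition q_differentiable ::
  "((int \<Rightarrow> real) \<Rightarrow> real ^ 'k::{finite,linorder}) \<Rightarrow> (int \<Rightarrow> real) \<Rightarrow> bool" where
  "q_differentiable F q \<longleftrightarrow> (\<lambda>x :: real ^ 'k::{finite,linorder}. F (of_coords x)) differentiable at (coords q)"

definition q_jacobian ::
  "((int \<Rightarrow> real) \<Rightarrow> real ^ 'k::{finite,linorder}) \<Rightarrow> (int \<Rightarrow> real) \<Rightarrow>
   real ^ 'k::{finite,linorder} ^ 'k::{finite,linorder}" where
  "q_jacobian F q =
     matrix (frechet_derivative (\<lambda>x :: real ^ 'k::{finite,linorder}. F (of_coords x)) (at (coords q)))"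

definition singular_set :: "'k::{finite,linorder} itself \<Rightarrow> (int \<Rightarrow> real) set" where
  "singular_set _ =
     {q \<in> Qodd CARD('k). det (q_jacobian (Phi_map :: _ \<Rightarrow> real ^ 'k::{finite,linorder}) q) = 0}"


subsection \<open>The orthonormal basis of the space of odd potentials\<close>

definition e_hat :: "nat \<Rightarrow> nat \<Rightarrow> int \<Rightarrow> real" where
  "e_hat k m n = 2 powr (- (if m = k then 1 else 0) / 2) / sqrt (real k) *
     sin (of_int (2 * n - 1) * real m * pi / (2 * real k))"

definition q_hat :: "nat \<Rightarrow> (int \<Rightarrow> real) \<Rightarrow> nat \<Rightarrow> real" where
  "q_hat k q = (THE c. (\<forall>m. m \<notin> {1..k} \<longrightarrow> c m = 0) \<and>
     (\<forall>n\<in>{1..2 * int k}. q n = (\<Sum>m=1..k. c m * e_hat k m n)))"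

end

theory Submission
  imports Defs
begin

text \<open>
  Write \<open>N + 1 = 2k\<close> for the period and \<open>\<Delta>\<close> for the Lyapunov polynomial of an odd potential \<open>q\<close>.

  Parts (i) and (ii) rest on the envelope principle.  The extremal value \<open>F\<^sub>n = (-1)\<^bsup>N+1-n\<^esup> \<Delta>(\<lambda>\<^sub>n(q), q)\<close>
  in the \<open>n\<close>-th gap is a differentiable function of \<open>q\<close> with derivative \<open>\<plusminus>\<Sum>\<^sub>j \<lambda>\<^sub>n\<^bsup>2k-2j\<^esup> d\<phi>\<^bsub>2j-1\<^esub>\<close>, because moving
  the critical point \<open>\<lambda>\<^sub>n\<close> changes the value only in higher order (\<open>gap_value_has_derivative\<close>).  Since \<open>\<Delta>\<close>
  is even, \<open>\<lambda>\<^sub>1 < \<dots> < \<lambda>\<^sub>k = 0\<close> have distinct squares, and the coefficients form an invertible Vandermonde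
  matrix.  Always \<open>F\<^sub>n \<ge> 2\<close>.  If \<open>F\<^sub>n = 2\<close>, then \<open>F\<^sub>n\<close> is minimal, its derivative is zero, and so is a
  combination of the \<open>d\<phi>\<^bsub>2j-1\<^esub>\<close> in which the last coefficient is 1; hence \<open>\<Phi>\<close> is singular at \<open>q\<close>
  (\<open>open_gaps_of_regular\<close>).  If all \<open>F\<^sub>n > 2\<close>, then \<open>h\<^sub>n = arcosh (F\<^sub>n / 2)\<close> is differentiable and the
  Jacobians of \<open>h\<close> and \<open>\<Phi>\<close> differ by an invertible factor (\<open>h_map_has_derivative\<close>).  Finally, where some
  \<open>h\<^sub>n\<close> with \<open>n \<le> k\<close> vanishes, it is minimal, so \<open>h\<close> cannot have an invertible derivative there.

  Part (iii) is a perturbation argument.  At the points \<open>2 cos (m\<pi>/2k)\<close>, \<open>1 \<le> m \<le> k\<close>, the Lyapunov polynomial of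
  \<open>s q\<close> equals \<open>2 (-1)\<^sup>m + s\<^sup>2 \<alpha>\<^sub>m d\<^sub>m\<^sup>2 + s\<^sup>3 R\<^sub>m(s, q)\<close> with \<open>\<alpha>\<^sub>m \<noteq> 0\<close>, a polynomial \<open>R\<^sub>m\<close>, and the sine
  coefficients \<open>d\<^sub>m\<close> of \<open>q\<close>, which are positive multiples of the coordinates of \<open>q\<close> in the orthonormal basis
  (\<open>lyapunov_small_expansion\<close>).  These \<open>k\<close> values determine \<open>\<Phi>\<close>.  In sine coordinates \<open>y\<close>, scaled by \<open>s\<close>,
  isospectrality to \<open>s q\<close> thus becomes a small perturbation of the system \<open>y\<^sub>m\<^sup>2 = d\<^sub>m\<^sup>2\<close>.  For each of the
  \<open>2\<^sup>k\<close> sign patterns Brouwer's theorem gives a solution and a Lipschitz estimate shows that there is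
  only one (\<open>solution_exists\<close>, \<open>solution_unique\<close>).  No solution escapes, because the sum of the squares of
  the potential is an isospectral invariant.  The same estimate bounds the increments of \<open>\<Phi>\<close> at \<open>s q\<close> from below
  by those of the potential, so the Jacobian of \<open>\<Phi>\<close> does not vanish at \<open>s q\<close>.

  All this speaks about \<open>\<Delta>\<close>, whereas band edges and isospectral sets are defined by the spectrum as a set.
  Bloch solutions, and Green functions built from them, show that the spectrum is \<open>{\<lambda>. \<bar>\<Delta>(\<lambda>)\<bar> \<le> 2}\<close>
  (\<open>periodic_spectrum\<close>); interlacing of the roots of \<open>\<phi>\<^sub>n\<close> shows that \<open>\<Delta>\<close> oscillates as often as its degree
  permits, which identifies gaps and critical points (\<open>gap_invariants\<close>); and by Chebyshev's argument on
  extremal polynomials the spectrum determines \<open>\<Delta>\<close> (\<open>monic_eq_of_bands_eq\<close>).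
\<close>


declare solution.simps(3) [simp del]

section \<open>Oscillation of the Lyapunov polynomial\<close>

lemma chain_less:
  fixes c :: "nat \<Rightarrow> real"
  assumes "\<And>i. a \<le> i \<Longrightarrow> i < b \<Longrightarrow> c i < c (Suc i)" "a \<le> i" "i < j" "j \<le> b"
  shows "c i < c j"
  using assms(3,4)
proof (induction j)
  case (Suc j)
  then show ?case
    using assms(1)[of j] assms(1)[of i] assms(2) by (cases "i = j") auto
qed simp

lemma chain_inj_on:
  fixes c :: "nat \<Rightarrow> real"
  assumes "\<And>i. a \<le> i \<Longrightarrow> i < b \<Longrightarrow> c i < c (Suc i)"
  shows "inj_on c {a..b}"
proof (rule linorder_inj_onI)
  fix i j assume "i < j" "i \<in> {a..b}" "j \<in> {a..b}"
  then show "c i \<noteq> c j"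
    using chain_less[of a b c i j, OF assms] by auto
qed auto

lemma prod_sign:
  fixes m :: "nat \<Rightarrow> real"
  assumes "i \<le> d" "\<And>j. 1 \<le> j \<Longrightarrow> j \<le> i \<Longrightarrow> m j < x" "\<And>j. i < j \<Longrightarrow> j \<le> d \<Longrightarrow> x < m j"
  shows "(-1) ^ (d - i) * (\<Prod>j\<in>{1..d}. x - m j) > 0"
proof -
  have split: "{1..d} = {1..i} \<union> {i<..d}"
    using assms(1) by auto
  have "(\<Prod>j\<in>{1..d}. x - m j) = (\<Prod>j\<in>{1..i}. x - m j) * (\<Prod>j\<in>{i<..d}. - (m j - x))"
    unfolding split by (subst prod.union_disjoint) auto
  also have "(\<Prod>j\<in>{i<..d}. - (m j - x)) = (-1) ^ (d - i) * (\<Prod>j\<in>{i<..d}. m j - x)"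
    by (subst prod_uminus) simp
  finally have "(-1) ^ (d - i) * (\<Prod>j\<in>{1..d}. x - m j) =
      (\<Prod>j\<in>{1..i}. x - m j) * (\<Prod>j\<in>{i<..d}. m j - x)"
    by simp
  also have "\<dots> > 0"
    by (intro mult_pos_pos prod_pos) (use assms in auto)
  finally show ?thesis .
qed

lemma poly_eq_prod_roots:
  fixes P :: "real poly"
  assumes "degree P = d" "inj_on m {1..d}" "\<And>j. j \<in> {1..d} \<Longrightarrow> poly P (m j) = 0"
  shows "poly P x = lead_coeff P * (\<Prod>j\<in>{1..d}. x - m j)"
proof -
  define R where "R = smult (lead_coeff P) (\<Prod>j\<in>{1..d}. [:- m j, 1:])"
  have x_eq: "(\<Prod>j\<in>{1..d}. poly [:- m j, 1:] x) = (\<Prod>j\<in>{1..d}. x - m j)"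
    by (rule prod.cong) auto
  have deg: "degree (\<Prod>j\<in>{1..d}. [:- m j, 1:]) = d"
    by (subst degree_prod_eq_sum_degree) auto
  have lc: "lead_coeff (\<Prod>j\<in>{1..d}. [:- m j, 1:]) = 1"
    by (subst lead_coeff_prod) simp
  have "P = R"
  proof (rule poly_eqI_degree_lead_coeff[where n = d and A = "m ` {1..d}"])
    show "coeff P d = coeff R d"
      using lc unfolding R_def coeff_smult deg assms(1) by simp
    show "poly P z = poly R z" if "z \<in> m ` {1..d}" for z
    proof -
      from that obtain i where "i \<in> {1..d}" "z = m i"
        by blast
      then have "(\<Prod>j\<in>{1..d}. poly [:- m j, 1:] z) = 0"
        by (intro prod_zero) (auto intro!: bexI[of _ i])
      then show ?thesis
        using assms(3)[OF \<open>i \<in> _\<close>] \<open>z = m i\<close> unfolding R_def poly_smult poly_prod by simp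
    qed
  qed (use assms deg in \<open>auto simp: R_def card_image\<close>)
  then have "poly P x = poly R x"
    by simp
  then show ?thesis
    using x_eq by (simp only: R_def poly_smult poly_prod)
qed

definition monic_of_degree :: "nat \<Rightarrow> real poly \<Rightarrow> bool" where
  "monic_of_degree n P \<longleftrightarrow> degree P = n \<and> coeff P n = 1"

lemma monic_add_lower:
  assumes "monic_of_degree n P" "\<And>i. i \<ge> n \<Longrightarrow> coeff Q i = 0"
  shows "monic_of_degree n (P + Q)"
proof -
  have "coeff (P + Q) n = 1"
    using assms by (simp add: monic_of_degree_def)
  moreover have "degree (P + Q) = n"
  proof (rule antisym)
    show "degree (P + Q) \<le> n"
      by (rule degree_le) (use assms in \<open>auto simp: monic_of_degree_def coeff_eq_0\<close>)
    show "n \<le> degree (P + Q)"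
      by (rule le_degree) (use calculation in simp)
  qed
  ultimately show ?thesis
    by (simp add: monic_of_degree_def)
qed

lemma monic_linear_mult:
  assumes "monic_of_degree n P"
  shows "monic_of_degree (Suc n) ([:- a, 1:] * P)"
proof -
  have "P \<noteq> 0"
    using assms by (auto simp: monic_of_degree_def)
  then have "degree ([:- a, 1:] * P) = Suc n"
    using assms by (subst degree_mult_eq) (auto simp: monic_of_degree_def)
  then show ?thesis
    using assms lead_coeff_mult[of "[:- a, 1:]" P] by (simp add: monic_of_degree_def)
qed

lemma monic_phi: "monic_of_degree n (solution q 0 1 (Suc n))"
proof (induction n rule: induct_nat_012)
  case (ge2 n)
  have "monic_of_degree (Suc (Suc n)) ([:- q (int (Suc (Suc n))), 1:] * solution q 0 1 (Suc (Suc n)) + (- solution q 0 1 (Suc n)))"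
    using ge2 by (intro monic_add_lower monic_linear_mult) (auto simp: monic_of_degree_def coeff_eq_0)
  then show ?case
    by (simp add: solution.simps(3))
qed (auto simp: monic_of_degree_def solution.simps(3)[of _ _ _ 0])

text \<open>
  From site 1 on, the solution with initial values \<open>1, 0\<close> takes the values \<open>0, -1\<close>, so it is the negative
  of the solution with initial values \<open>0, 1\<close> of the equation shifted by one site.  Degrees and
  coefficients of \<open>\<theta>\<close> can therefore be read off from those of \<open>\<phi>\<close>.
\<close>

lemma theta_eq_shifted_phi: "solution q 1 0 (Suc n) = - solution (\<lambda>i. q (i + 1)) 0 1 n"
proof (induction n rule: induct_nat_012)
  case (ge2 n)
  have "solution q 1 0 (Suc (Suc (Suc n))) =
      [:- q (int (Suc (Suc n))), 1:] * solution q 1 0 (Suc (Suc n)) - solution q 1 0 (Suc n)"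
    by (rule solution.simps(3))
  also have "\<dots> = - ([:- q (int (Suc n) + 1), 1:] * solution (\<lambda>i. q (i + 1)) 0 1 (Suc n)
      - solution (\<lambda>i. q (i + 1)) 0 1 n)"
    unfolding ge2 by (simp add: algebra_simps)
  finally show ?case
    by (simp only: solution.simps(3))
qed (auto simp: solution.simps(3)[of _ _ _ 0])

lemma monic_lyapunov:
  assumes "k \<ge> 1"
  shows "monic_of_degree (2 * k) (lyapunov k q)"
proof -
  obtain m where m: "2 * k = Suc (Suc m)"
    by (rule that[of "2 * k - 2"]) (use assms in simp)
  have "coeff (solution q 1 0 (2 * k)) i = 0" if "i \<ge> 2 * k" for i
    using monic_phi[of m "\<lambda>i. q (i + 1)"] that m
    by (simp add: theta_eq_shifted_phi monic_of_degree_def coeff_eq_0)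
  then show ?thesis
    unfolding lyapunov_def Suc_eq_plus1[symmetric] by (intro monic_add_lower monic_phi)
qed

lemma wronskian_phi_theta:
  "poly (solution q 0 1 (Suc n)) x * poly (solution q 1 0 n) x
   - poly (solution q 0 1 n) x * poly (solution q 1 0 (Suc n)) x = 1"
  by (induction n) (auto simp: algebra_simps solution.simps(3))

lemma monic_sign_left:
  assumes "monic_of_degree n P"
  shows "\<exists>b. \<forall>x\<le>b. (-1) ^ n * poly P x > 0" 
proof -
  have "coeff (P \<circ>\<^sub>p [:0, -1:]) i = (-1) ^ i * coeff P i" for i
    by (rule coeff_pcompose_linear)
  moreover have "degree (P \<circ>\<^sub>p [:0, -1:]) = n"
    using assms by (simp add: degree_pcompose monic_of_degree_def)
  ultimately have "lead_coeff (smult ((-1) ^ n) (P \<circ>\<^sub>p [:0, -1:])) = 1"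
    using assms by (simp add: monic_of_degree_def flip: power_mult_distrib)
  then obtain b where "\<forall>x\<ge>b. poly (smult ((-1) ^ n) (P \<circ>\<^sub>p [:0, -1:])) x \<ge> 1"
    using poly_pinfty_gt_lc by (metis zero_less_one)
  then have b: "(-1) ^ n * poly P (- x) \<ge> 1" if "x \<ge> b" for x
    using that by (auto simp: poly_pcompose)
  have "(-1) ^ n * poly P x > 0" if "x \<le> - b" for x
    using b[of "- x"] that by simp
  then show ?thesis
    by blast
qed

text \<open>
  Sturm's argument.  If \<open>\<phi>\<^bsub>n+2\<^esub>\<close> alternates in sign along the roots of \<open>\<phi>\<^bsub>n+1\<^esub>\<close>, the intermediate value
  theorem together with the behaviour at \<open>\<plusminus>\<infinity>\<close> yields \<open>n + 1\<close> roots of \<open>\<phi>\<^bsub>n+2\<^esub>\<close> separating the old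
  ones.  At these the recursion gives \<open>\<phi>\<^bsub>n+3\<^esub> = - \<phi>\<^bsub>n+1\<^esub>\<close>, and the signs of \<open>\<phi>\<^bsub>n+1\<^esub>\<close> there are known from
  its factorization into linear factors.
\<close>

lemma phi_interlacing:
  "\<exists>m. (\<forall>i. 1 \<le> i \<and> i < n \<longrightarrow> m i < m (Suc i)) \<and>
       (\<forall>i\<in>{1..n}. poly (solution q 0 1 (Suc n)) (m i) = 0 \<and>
            (-1) ^ (Suc n - i) * poly (solution q 0 1 (Suc (Suc n))) (m i) > 0)"
proof (induction n)
  case 0
  show ?case by simp
next
  case (Suc n)
  define f where "f = (\<lambda>j. solution q 0 1 j)"
  obtain m where m: "\<And>i. 1 \<le> i \<Longrightarrow> i < n \<Longrightarrow> m i < m (Suc i)"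
    "\<And>i. i \<in> {1..n} \<Longrightarrow> poly (f (Suc n)) (m i) = 0"
    "\<And>i. i \<in> {1..n} \<Longrightarrow> (-1) ^ (Suc n - i) * poly (f (Suc (Suc n))) (m i) > 0"
    using Suc unfolding f_def by metis
  have mono: "monic_of_degree j (f (Suc j))" for j
    unfolding f_def by (rule monic_phi)
  obtain b where b: "\<And>x. x \<le> b \<Longrightarrow> (-1) ^ Suc n * poly (f (Suc (Suc n))) x > 0"
    using monic_sign_left[OF mono[of "Suc n"]] by auto
  have "lead_coeff (f (Suc (Suc n))) = 1"
    using mono[of "Suc n"] by (simp add: monic_of_degree_def)
  then obtain B where B: "\<And>x. x \<ge> B \<Longrightarrow> poly (f (Suc (Suc n))) x > 0"
    using poly_pinfty_gt_lc[of "f (Suc (Suc n))"] by force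
  have m_less: "m i < m j" if "1 \<le> i" "i < j" "j \<le> n" for i j
    using chain_less[of 1 n m i j] m(1) that by simp
  \<comment> \<open>The old roots, framed by one point on either side at which the sign is that at infinity.\<close>
  define y where "y i = (if i = 0 then min b (m 1 - 1) else if i \<le> n then m i
      else max (max B b + 1) (max (m 1 + 1) (m n + 1)))" for i
  have y_less: "y i < y (Suc i)" if "i \<le> n" for i
    using that m_less[of i "Suc i"] by (auto simp: y_def not_le less_Suc_eq_le)
  have y_sign: "(-1) ^ (Suc n - i) * poly (f (Suc (Suc n))) (y i) > 0" if "i \<le> Suc n" for i
    using that b[of "y 0"] B[of "y (Suc n)"] m(3)[of i] by (auto simp: y_def not_le)
  have "\<exists>z. y (i - 1) < z \<and> z < y i \<and> poly (f (Suc (Suc n))) z = 0" if "i \<in> {1..Suc n}" for i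
  proof -
    have "(-1) ^ (Suc n - (i - 1)) = - ((-1) ^ (Suc n - i) :: real)"
    proof -
      have "Suc n - (i - 1) = Suc (Suc n - i)"
        using that by auto
      then show ?thesis
        by simp
    qed
    moreover have "(-1) ^ (Suc n - i) * poly (f (Suc (Suc n))) (y i) > 0"
      "(-1) ^ (Suc n - (i - 1)) * poly (f (Suc (Suc n))) (y (i - 1)) > 0"
      using y_sign[of i] y_sign[of "i - 1"] that by auto
    ultimately have "poly (f (Suc (Suc n))) (y (i - 1)) * poly (f (Suc (Suc n))) (y i) < 0"
      by (cases "even (Suc n - i)") (auto simp: mult_less_0_iff)
    then show ?thesis
      using poly_IVT[of "y (i - 1)" "y i"] y_less[of "i - 1"] that by auto
  qed
  then obtain z where z: "\<And>i. i \<in> {1..Suc n} \<Longrightarrow> y (i - 1) < z i \<and> z i < y i \<and> poly (f (Suc (Suc n))) (z i) = 0"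
    by metis
  have inj: "inj_on m {1..n}"
    using chain_inj_on[of 1 n m] m(1) by simp
  show ?case
  proof (intro exI[of _ z] conjI allI impI ballI)
    fix i assume "1 \<le> i \<and> i < Suc n"
    then show "z i < z (Suc i)"
      using z[of i] z[of "Suc i"] by simp
  next
    fix i assume i: "i \<in> {1..Suc n}"
    then show "poly (solution q 0 1 (Suc (Suc n))) (z i) = 0"
      using z by (simp add: f_def)
    have "(-1) ^ (n - (i - 1)) * (\<Prod>j\<in>{1..n}. z i - m j) > 0"
    proof (rule prod_sign)
      fix j assume j: "1 \<le> j" "j \<le> i - 1"
      then have "m j \<le> y (i - 1)"
        using i m_less[of j "i - 1"] by (cases "j = i - 1") (auto simp: y_def)
      then show "m j < z i"
        using z[OF i] by simp
    next
      fix j assume j: "i - 1 < j" "j \<le> n"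
      then have "i \<le> j"
        using i by auto
      then have "y i \<le> m j"
        using i j m_less[of i j] by (cases "i = j") (auto simp: y_def)
      then show "z i < m j"
        using z[OF i] by simp
    qed (use i in auto)
    also have "(\<Prod>j\<in>{1..n}. z i - m j) = poly (f (Suc n)) (z i)"
      using poly_eq_prod_roots[of "f (Suc n)" n m "z i"] inj m(2) mono[of n]
      by (simp add: monic_of_degree_def)
    finally have "(-1) ^ (Suc n - i) * poly (f (Suc n)) (z i) > 0"
      using i by (cases i) auto
    moreover have "poly (f (Suc (Suc (Suc n)))) (z i) = - poly (f (Suc n)) (z i)"
      using z[OF i] by (simp add: f_def solution.simps(3)[of _ _ _ "Suc n"])
    moreover have "(-1) ^ (Suc (Suc n) - i) = - ((-1) ^ (Suc n - i) :: real)"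
      using i by (auto simp: Suc_diff_le)
    ultimately show "(-1) ^ (Suc (Suc n) - i) * poly (solution q 0 1 (Suc (Suc (Suc n)))) (z i) > 0"
      by (simp add: f_def)
  qed
qed

lemma real_add_inverse_ge_2:
  assumes "(x::real) > 0" "x * y = 1"
  shows "x + y \<ge> 2"
proof -
  have "(x - 1)\<^sup>2 \<ge> 0" by simp
  then have "x * (x + y) \<ge> x * 2"
    using assms by (simp add: power2_eq_square algebra_simps)
  then show ?thesis
    using assms by simp
qed

definition alternates :: "real poly \<Rightarrow> nat \<Rightarrow> (nat \<Rightarrow> real) \<Rightarrow> bool" where
  "alternates P n x \<longleftrightarrow> (\<forall>i<n. x i < x (Suc i)) \<and> (\<forall>i\<le>n. 2 \<le> (-1) ^ (n - i) * poly P (x i))"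

lemma monic_large_values:
  assumes "monic_of_degree n P" "n \<ge> 1"
  shows "\<exists>x\<ge>B. poly P x \<ge> 2" "\<exists>x\<le>B. (-1) ^ n * poly P x \<ge> 2"
proof -
  have "monic_of_degree n (P + [:-2:])" "monic_of_degree n (P + [:- ((-1) ^ n * 2):])"
    by (intro monic_add_lower assms; use assms in \<open>auto simp: coeff_pCons split: nat.splits\<close>)+
  then obtain b where b: "\<And>x. x \<le> b \<Longrightarrow> (-1) ^ n * poly (P + [:- ((-1) ^ n * 2):]) x > 0"
    and "lead_coeff (P + [:-2:]) = 1"
    using monic_sign_left[of n "P + [:- ((-1) ^ n * 2):]"] unfolding monic_of_degree_def by metis
  then obtain B' where B': "\<And>x. x \<ge> B' \<Longrightarrow> poly (P + [:-2:]) x \<ge> 1"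
    using poly_pinfty_gt_lc[of "P + [:-2:]"] by force
  have "poly P (max B B') \<ge> 2"
    using B'[of "max B B'"] by simp
  then show "\<exists>x\<ge>B. poly P x \<ge> 2"
    by (intro exI[of _ "max B B'"]) auto
  have "(-1) ^ n * poly P (min B b) \<ge> 2"
    using b[of "min B b"] by (simp add: algebra_simps flip: power_mult_distrib power_add mult_2_right)
  then show "\<exists>x\<le>B. (-1) ^ n * poly P x \<ge> 2"
    by (intro exI[of _ "min B b"]) auto
qed

text \<open>
  The inner points are the roots \<open>\<mu>\<close> of \<open>\<phi>\<^bsub>2k\<^esub>\<close>.  There the monodromy matrix is triangular with determinant
  1, so \<open>\<Delta>(\<mu>) = \<phi>\<^bsub>2k+1\<^esub>(\<mu>) + 1 / \<phi>\<^bsub>2k+1\<^esub>(\<mu>)\<close> has absolute value at least 2 and the sign of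
  \<open>\<phi>\<^bsub>2k+1\<^esub>(\<mu>)\<close>, which alternates by interlacing.
\<close>

lemma lyapunov_alternates:
  assumes "k \<ge> 1"
  shows "\<exists>x. alternates (lyapunov k q) (2 * k) x"
proof -
  define n where "n = 2 * k - 1"
  have n: "2 * k = Suc n" "n \<ge> 1"
    using assms by (auto simp: n_def)
  obtain m where m: "\<And>i. 1 \<le> i \<Longrightarrow> i < n \<Longrightarrow> m i < m (Suc i)"
    "\<And>i. i \<in> {1..n} \<Longrightarrow> poly (solution q 0 1 (Suc n)) (m i) = 0"
    "\<And>i. i \<in> {1..n} \<Longrightarrow> (-1) ^ (Suc n - i) * poly (solution q 0 1 (Suc (Suc n))) (m i) > 0"
    using phi_interlacing[of n q] by metis
  define D where "D = lyapunov k q"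
  have D: "poly D x = poly (solution q 0 1 (Suc (Suc n))) x + poly (solution q 1 0 (Suc n)) x" for x
    unfolding D_def lyapunov_def n(1) by simp
  have D_m: "(-1) ^ (Suc n - i) * poly D (m i) \<ge> 2" if i: "i \<in> {1..n}" for i
  proof -
    define s :: real where "s = (-1) ^ (Suc n - i)"
    have "s * s = 1"
      by (simp add: s_def flip: power_mult_distrib)
    have "s * poly (solution q 0 1 (Suc (Suc n))) (m i) + s * poly (solution q 1 0 (Suc n)) (m i) \<ge> 2"
    proof (rule real_add_inverse_ge_2)
      show "s * poly (solution q 0 1 (Suc (Suc n))) (m i) > 0"
        using m(3)[OF i] by (simp add: s_def)
      show "s * poly (solution q 0 1 (Suc (Suc n))) (m i) * (s * poly (solution q 1 0 (Suc n)) (m i)) = 1"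
        using wronskian_phi_theta[of q "Suc n" "m i"] m(2)[OF i] \<open>s * s = 1\<close> by algebra
    qed
    then show ?thesis
      unfolding D s_def[symmetric] by (simp add: algebra_simps)
  qed
  have mon: "monic_of_degree (Suc n) D"
    using monic_lyapunov[OF assms] n by (simp add: D_def)
  obtain a where a: "a \<le> m 1 - 1" "(-1) ^ Suc n * poly D a \<ge> 2"
    using monic_large_values(2)[OF mon] by auto
  obtain b where b: "b \<ge> m n + 1" "poly D b \<ge> 2"
    using monic_large_values(1)[OF mon] by auto
  define y where "y = (\<lambda>i. if i = 0 then a else if i \<le> n then m i else b)"
  have "y i < y (Suc i)" if "i < Suc n" for i
  proof -
    from that consider "i = 0" | "i = n" | "1 \<le> i" "i < n"
      by linarith
    then show ?thesis
      using a(1) b(1) n(2) m(1)[of i] by cases (auto simp: y_def)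
  qed
  moreover have "2 \<le> (-1) ^ (Suc n - i) * poly D (y i)" if "i \<le> Suc n" for i
  proof -
    from that consider "i = 0" | "i = Suc n" | "1 \<le> i" "i \<le> n"
      by linarith
    then show ?thesis
      using a(2) b(2) D_m[of i] by cases (simp_all add: y_def)
  qed
  ultimately have "alternates D (Suc n) y"
    by (simp add: alternates_def)
  then show ?thesis
    unfolding n(1) D_def by blast
qed

text \<open>
  A ladder records the whole oscillation of a polynomial of degree \<open>n\<close>: the points \<open>c 1, \<dots>, c (n - 1)\<close> are
  all its critical points.  The two outer points \<open>c 0\<close> and \<open>c n\<close> only bound the region in which the
  polynomial can take values between \<open>-2\<close> and \<open>2\<close>; they are not determined by it.
\<close>

definition ladder :: "real poly \<Rightarrow> nat \<Rightarrow> (nat \<Rightarrow> real) \<Rightarrow> bool" where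
  "ladder P n c \<longleftrightarrow> alternates P n c \<and> 
     (\<forall>x. poly (pderiv P) x = real n * (\<Prod>j\<in>{1..n - 1}. x - c j))"

lemma alternates_less:
  assumes "alternates P n c" "i < j" "j \<le> n"
  shows "c i < c j"
  using assms by (intro chain_less[of 0 n c i j]) (auto simp: alternates_def)

lemma minus_one_power_diff_Suc:
  assumes "i < n"
  shows "(-1) ^ (n - i) = - ((-1) ^ (n - Suc i) :: real)"
proof -
  have "n - i = Suc (n - Suc i)"
    using assms by simp
  then show ?thesis
    by simp
qed

text \<open>
  Alternation forces a root in each of the \<open>n\<close> intervals between consecutive points.  Between two
  consecutive roots the polynomial has constant sign, and the maximum of its absolute value is
  attained at a critical point, where it is at least as large as at the alternation point in between.
  This accounts for all \<open>n - 1\<close> roots of the derivative.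
\<close>

lemma exists_ladder:
  assumes "monic_of_degree n P" "n \<ge> 1" "alternates P n x"
  shows "\<exists>c. ladder P n c"
proof -
  have x: "\<And>i. i < n \<Longrightarrow> x i < x (Suc i)" "\<And>i. i \<le> n \<Longrightarrow> 2 \<le> (-1) ^ (n - i) * poly P (x i)"
    using assms(3) by (auto simp: alternates_def)
  have "\<exists>z. x i < z \<and> z < x (Suc i) \<and> poly P z = 0" if "i < n" for i
  proof -
    have "poly P (x i) * poly P (x (Suc i)) < 0"
      using x(2)[of i] x(2)[of "Suc i"] that minus_one_power_diff_Suc[OF that]
      by (cases "even (n - Suc i)") (auto simp: mult_less_0_iff)
    then show ?thesis
      using poly_IVT x(1)[OF that] by blast
  qed
  then obtain z where z: "\<And>i. i < n \<Longrightarrow> x i < z i \<and> z i < x (Suc i) \<and> poly P (z i) = 0"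
    by metis
  have z_less: "z i < z j" if "i < j" "j < n" for i j
  proof -
    have "x (Suc i) \<le> x j"
      using alternates_less[OF assms(3), of "Suc i" j] that by (cases "Suc i = j") auto
    then show ?thesis
      using z[of i] z[of j] that by auto
  qed
  have P_z: "poly P y = (\<Prod>j\<in>{1..n}. y - z (j - 1))" for y
  proof -
    have "inj_on (\<lambda>j. z (j - 1)) {1..n}"
    proof (rule linorder_inj_onI)
      fix i j assume "i < j" "i \<in> {1..n}" "j \<in> {1..n}"
      then have "i - 1 < j - 1" "j - 1 < n"
        by auto
      then show "z (i - 1) \<noteq> z (j - 1)"
        using z_less[of "i - 1" "j - 1"] by simp
    qed auto
    moreover have "poly P (z (j - 1)) = 0" if "j \<in> {1..n}" for j
      using z[of "j - 1"] that by auto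
    ultimately have "poly P y = lead_coeff P * (\<Prod>j\<in>{1..n}. y - z (j - 1))"
      using assms(1) by (intro poly_eq_prod_roots) (auto simp: monic_of_degree_def)
    then show ?thesis
      using assms(1) by (simp add: monic_of_degree_def)
  qed
  have sgn: "(-1) ^ (n - i) * poly P y > 0" if "1 \<le> i" "i < n" "z (i - 1) < y" "y < z i" for i y
    unfolding P_z
  proof (rule prod_sign)
    fix j assume j: "1 \<le> j" "j \<le> i"
    have "z (j - 1) \<le> z (i - 1)"
    proof (cases "j = i")
      case False
      then have "j - 1 < i - 1" "i - 1 < n"
        using j that by auto
      then show ?thesis
        using z_less by (simp add: less_imp_le)
    qed simp
    then show "z (j - 1) < y"
      using that by simp
  next
    fix j assume j: "i < j" "j \<le> n"
    have "z i \<le> z (j - 1)"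
    proof (cases "j - 1 = i")
      case False
      then have "i < j - 1" "j - 1 < n"
        using j that by auto
      then show ?thesis
        using z_less by (simp add: less_imp_le)
    qed simp
    then show "y < z (j - 1)"
      using that by simp
  qed (use that in simp)
  have "\<exists>c. z (i - 1) < c \<and> c < z i \<and> poly (pderiv P) c = 0 \<and> 2 \<le> (-1) ^ (n - i) * poly P c"
    if i: "1 \<le> i" "i < n" for i
  proof -
    define f where "f y = (-1) ^ (n - i) * poly P y" for y
    have zi: "z (i - 1) < x i" "x i < z i"
      using z[of "i - 1"] z[of i] i by auto
    have "continuous_on {z (i - 1)..z i} f"
      unfolding f_def by (intro continuous_intros)
    then obtain c where c: "c \<in> {z (i - 1)..z i}" "\<And>y. y \<in> {z (i - 1)..z i} \<Longrightarrow> f y \<le> f c"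
      using continuous_attains_sup[of "{z (i - 1)..z i}" f] zi by auto
    have "2 \<le> f c"
      using c(2)[of "x i"] zi x(2)[of i] i by (auto simp: f_def)
    have "f (z (i - 1)) = 0" "f (z i) = 0"
      using z[of "i - 1"] z[of i] i by (auto simp: f_def)
    then have "c \<noteq> z (i - 1)" "c \<noteq> z i"
      using \<open>2 \<le> f c\<close> by auto
    then have c': "z (i - 1) < c" "c < z i"
      using c(1) by auto
    have "(f has_real_derivative (-1) ^ (n - i) * poly (pderiv P) c) (at c)"
      unfolding f_def by (auto intro!: derivative_eq_intros poly_DERIV)
    moreover have "\<forall>y. \<bar>c - y\<bar> < min (c - z (i - 1)) (z i - c) \<longrightarrow> f y \<le> f c"
      by (intro allI impI c(2)) auto
    ultimately have "(-1) ^ (n - i) * poly (pderiv P) c = 0"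
      using c' by (intro DERIV_local_max[of f _ c "min (c - z (i - 1)) (z i - c)"]) auto
    then show ?thesis
      using c' \<open>2 \<le> f c\<close> by (auto simp: f_def)
  qed
  then obtain d where d: "\<And>i. 1 \<le> i \<Longrightarrow> i < n \<Longrightarrow> z (i - 1) < d i \<and> d i < z i \<and> poly (pderiv P) (d i) = 0 \<and>
      2 \<le> (-1) ^ (n - i) * poly P (d i)"
    by metis
  \<comment> \<open>The outermost points are taken over from the given alternation.\<close>
  define c where "c i = (if i = 0 \<or> i = n then x i else d i)" for i
  have c_less: "c i < c (Suc i)" if "i < n" for i
  proof -
    have "c i < z i"
      using z[of i] d[of i] that by (auto simp: c_def)
    also have "z i < c (Suc i)"
      using z[of i] d[of "Suc i"] that by (auto simp: c_def)
    finally show ?thesis .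
  qed
  have alt: "alternates P n c"
    unfolding alternates_def using c_less x(2) d by (auto simp: c_def)
  have "poly (pderiv P) y = real n * (\<Prod>j\<in>{1..n - 1}. y - c j)" for y
  proof -
    have "lead_coeff (pderiv P) = real n" "degree (pderiv P) = n - 1"
      using assms(1,2) by (auto simp: monic_of_degree_def degree_pderiv coeff_pderiv)
    moreover have "inj_on c {1..n - 1}"
      by (rule chain_inj_on) (use c_less in simp)
    moreover have "poly (pderiv P) (c j) = 0" if "j \<in> {1..n - 1}" for j
      using d[of j] that by (auto simp: c_def)
    ultimately show ?thesis
      using poly_eq_prod_roots[of "pderiv P" "n - 1" c y] by simp
  qed
  then show ?thesis
    using alt by (auto simp: ladder_def)
qed

lemma ladder_less: "ladder P n c \<Longrightarrow> i < j \<Longrightarrow> j \<le> n \<Longrightarrow> c i < c j"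
  using alternates_less by (auto simp: ladder_def)

lemma ladder_le: "ladder P n c \<Longrightarrow> i \<le> j \<Longrightarrow> j \<le> n \<Longrightarrow> c i \<le> c j"
  using ladder_less[of P n c i j] by (cases "i = j") auto

lemma ladder_value: "ladder P n c \<Longrightarrow> i \<le> n \<Longrightarrow> 2 \<le> (-1) ^ (n - i) * poly P (c i)"
  by (auto simp: ladder_def alternates_def)

lemma ladder_critical_iff:
  assumes "ladder P n c" "n \<ge> 1"
  shows "poly (pderiv P) x = 0 \<longleftrightarrow> x \<in> c ` {1..n - 1}"
  using assms by (auto simp: ladder_def)

lemma ladder_pderiv_sign:
  assumes "ladder P n c" "i < n"
    "\<And>j. 1 \<le> j \<Longrightarrow> j \<le> i \<Longrightarrow> c j < x" "\<And>j. i < j \<Longrightarrow> j < n \<Longrightarrow> x < c j"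
  shows "(-1) ^ (n - Suc i) * poly (pderiv P) x > 0"
proof -
  have "(-1) ^ (n - 1 - i) * (\<Prod>j\<in>{1..n - 1}. x - c j) > 0"
    by (rule prod_sign) (use assms in auto)
  then have "real n * ((-1) ^ (n - 1 - i) * (\<Prod>j\<in>{1..n - 1}. x - c j)) > 0"
    using assms(2) by simp
  then show ?thesis
    using assms(1) by (simp add: ladder_def mult_ac)
qed

lemma ladder_strict_mono:
  assumes "ladder P n c" "i < n" "x < y"
    "\<And>j. 1 \<le> j \<Longrightarrow> j \<le> i \<Longrightarrow> c j \<le> x" "\<And>j. i < j \<Longrightarrow> j < n \<Longrightarrow> y \<le> c j"
  shows "(-1) ^ (n - Suc i) * poly P x < (-1) ^ (n - Suc i) * poly P y"
proof -
  obtain w where w: "x < w" "w < y" "poly P y - poly P x = (y - x) * poly (pderiv P) w"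
    using poly_MVT[OF assms(3)] by blast
  have "(-1) ^ (n - Suc i) * poly (pderiv P) w > 0"
    by (rule ladder_pderiv_sign[OF assms(1,2)]) (use w assms(4,5) in force)+
  then have "(y - x) * ((-1) ^ (n - Suc i) * poly (pderiv P) w) > 0"
    using assms(3) by simp
  then have "(-1) ^ (n - Suc i) * (poly P y - poly P x) > 0"
    using w(3) by (simp add: mult_ac)
  then show ?thesis
    by (simp add: algebra_simps)
qed

lemma ladder_max:
  assumes "ladder P n c" "1 \<le> i" "i < n"
    "\<And>j. 1 \<le> j \<Longrightarrow> j < i \<Longrightarrow> c j \<le> x" "\<And>j. i < j \<Longrightarrow> j < n \<Longrightarrow> x \<le> c j"
  shows "(-1) ^ (n - i) * poly P x \<le> (-1) ^ (n - i) * poly P (c i)"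
proof -
  consider "x < c i" | "x = c i" | "c i < x" by linarith
  then show ?thesis
  proof cases
    case 1
    have "(-1) ^ (n - Suc (i - 1)) * poly P x < (-1) ^ (n - Suc (i - 1)) * poly P (c i)"
      by (rule ladder_strict_mono[OF assms(1) _ 1]) (use assms ladder_le[OF assms(1)] in auto)
    then show ?thesis
      using assms(2) by simp
  next
    case 3
    have "(-1) ^ (n - Suc i) * poly P (c i) < (-1) ^ (n - Suc i) * poly P x"
      by (rule ladder_strict_mono[OF assms(1) _ 3]) (use assms ladder_le[OF assms(1)] in auto)
    then show ?thesis
      using minus_one_power_diff_Suc[OF assms(3)] by simp
  qed simp
qed

text \<open>
  This recognizes any increasing sequence of roots of the derivative, however it was obtained, as the
  sequence of critical points: a strictly increasing map of \<open>{1..m}\<close> to itself is the identity.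
\<close>

lemma strict_chain_unique:
  fixes y c :: "nat \<Rightarrow> real"
  assumes y: "\<And>i. 1 \<le> i \<Longrightarrow> i < m \<Longrightarrow> y i < y (Suc i)"
    and c: "\<And>i. 1 \<le> i \<Longrightarrow> i < m \<Longrightarrow> c i < c (Suc i)"
    and sub: "\<And>i. i \<in> {1..m} \<Longrightarrow> y i \<in> c ` {1..m}" and i: "i \<in> {1..m}"
  shows "y i = c i"
proof -
  have c_less: "c i < c j" if "1 \<le> i" "i < j" "j \<le> m" for i j
    using chain_less[of 1 m c i j] c that by simp
  obtain f where f: "\<And>i. i \<in> {1..m} \<Longrightarrow> f i \<in> {1..m} \<and> y i = c (f i)"
  proof -
    have "\<forall>i\<in>{1..m}. \<exists>j. j \<in> {1..m} \<and> y i = c j"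
      using sub by blast
    then show ?thesis
      using that by (metis (no_types))
  qed
  have f_less: "f i < f (Suc i)" if "1 \<le> i" "i < m" for i
  proof (rule ccontr)
    assume "\<not> f i < f (Suc i)"
    then have "c (f (Suc i)) \<le> c (f i)"
      using c_less[of "f (Suc i)" "f i"] f[of i] f[of "Suc i"] that by (cases "f i = f (Suc i)") auto
    then show False
      using y[OF that] f[of i] f[of "Suc i"] that by auto
  qed
  have "i \<le> f i" if "1 \<le> i" "i \<le> m" for i
    using that
  proof (induction i)
    case (Suc i)
    then show ?case
      using f_less[of i] f[of "Suc i"] by (cases "i = 0") auto
  qed simp
  moreover have "1 \<le> i \<longrightarrow> f i \<le> i" if "i \<le> m" for i
    using that
  proof (induction rule: inc_induct)
    case base
    then show ?case
      using f[of m] by auto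
  next
    case (step j)
    then show ?case
      using f_less[of j] by (metis Suc_leD le_SucI less_Suc_eq_le not_less_eq order.strict_trans2)
  qed
  ultimately have "f i = i"
    using i by force
  then show ?thesis
    using f[OF i] by simp
qed

section \<open>Band edges, critical points and gap heights\<close>

definition bands :: "real poly \<Rightarrow> real set" where
  "bands P = {x. \<bar>poly P x\<bar> \<le> 2}"

lemma minus_one_power_square: "(-1) ^ m * ((-1) ^ m * x) = (x::real)"
  by (simp flip: mult.assoc power_mult_distrib)

lemma abs_minus_one_power_mult: "\<bar>(-1) ^ m * x\<bar> = \<bar>x::real\<bar>"
  by (simp add: abs_mult power_abs)

text \<open>
  Between two consecutive points the polynomial is strictly monotone and crosses both levels \<open>-2\<close> and
  \<open>2\<close>, so it takes values in \<open>[-2, 2]\<close> exactly on one interval, a band.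
\<close>

lemma ladder_edges:
  assumes "ladder P n c"
  obtains lm lp where
    "\<And>i. i < n \<Longrightarrow> c i \<le> lp i \<and> lp i < lm (Suc i) \<and> lm (Suc i) \<le> c (Suc i)"
    "\<And>i. i < n \<Longrightarrow> (-1) ^ (n - Suc i) * poly P (lm (Suc i)) = 2"
    "\<And>i. i < n \<Longrightarrow> (-1) ^ (n - Suc i) * poly P (lp i) = - 2"
    "\<And>i x. i < n \<Longrightarrow> c i \<le> x \<Longrightarrow> x \<le> c (Suc i) \<Longrightarrow> x \<in> bands P \<longleftrightarrow> lp i \<le> x \<and> x \<le> lm (Suc i)"
proof -
  define g where "g i x = (-1) ^ (n - Suc i) * poly P x" for i x
  have g_less: "g i x < g i y" if "i < n" "c i \<le> x" "x < y" "y \<le> c (Suc i)" for i x y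
    unfolding g_def
  proof (rule ladder_strict_mono[OF assms that(1,3)])
    show "c j \<le> x" if "1 \<le> j" "j \<le> i" for j
      using ladder_le[OF assms that(2)] \<open>i < n\<close> \<open>c i \<le> x\<close> by auto
    show "y \<le> c j" if "i < j" "j < n" for j
      using ladder_le[OF assms, of "Suc i" j] that \<open>y \<le> c (Suc i)\<close> by auto
  qed
  have ends: "g i (c i) \<le> - 2" "2 \<le> g i (c (Suc i))" "c i < c (Suc i)" if "i < n" for i
  proof -
    show "2 \<le> g i (c (Suc i))"
      using ladder_value[OF assms, of "Suc i"] that by (simp add: g_def)
    show "g i (c i) \<le> - 2"
      using ladder_value[OF assms, of i] that minus_one_power_diff_Suc[OF that] by (simp add: g_def)
    show "c i < c (Suc i)"
      using ladder_less[OF assms] that by auto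
  qed
  have "\<exists>a b. c i \<le> a \<and> a \<le> c (Suc i) \<and> g i a = - 2 \<and> c i \<le> b \<and> b \<le> c (Suc i) \<and> g i b = 2"
    if "i < n" for i
  proof -
    have "continuous_on {c i..c (Suc i)} (g i)"
      unfolding g_def by (intro continuous_intros)
    then show ?thesis
      using IVT'[of "g i" "c i" "- 2" "c (Suc i)"] IVT'[of "g i" "c i" 2 "c (Suc i)"] ends[OF that]
      by fastforce
  qed
  then obtain a b where ab: "\<And>i. i < n \<Longrightarrow> c i \<le> a i \<and> a i \<le> c (Suc i) \<and> g i (a i) = - 2 \<and>
      c i \<le> b i \<and> b i \<le> c (Suc i) \<and> g i (b i) = 2"
    by metis
  have g_le: "g i x \<le> g i y \<longleftrightarrow> x \<le> y"
    if "i < n" "c i \<le> x" "x \<le> c (Suc i)" "c i \<le> y" "y \<le> c (Suc i)" for i x y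
    using g_less[OF that(1), of x y] g_less[OF that(1), of y x] that by (cases x y rule: linorder_cases) auto
  have abs_g: "\<bar>poly P x\<bar> = \<bar>g i x\<bar>" for i x
    by (simp add: g_def abs_minus_one_power_mult)
  show ?thesis
  proof (rule that[of a "\<lambda>i. b (i - 1)"])
    fix i assume i: "i < n"
    show "c i \<le> a i \<and> a i < b (Suc i - 1) \<and> b (Suc i - 1) \<le> c (Suc i)"
      using ab[OF i] g_le[OF i, of "b i" "a i"] by auto
    show "(-1) ^ (n - Suc i) * poly P (b (Suc i - 1)) = 2" "(-1) ^ (n - Suc i) * poly P (a i) = - 2"
      using ab[OF i] by (auto simp: g_def)
    fix x assume x: "c i \<le> x" "x \<le> c (Suc i)"
    show "x \<in> bands P \<longleftrightarrow> a i \<le> x \<and> x \<le> b (Suc i - 1)"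
      using ab[OF i] g_le[OF i, of "a i" x] g_le[OF i, of x "b i"] x abs_g[of x i]
      by (auto simp: bands_def)
  qed
qed

lemma ladder_outside:
  assumes "ladder P n c" "n \<ge> 1" "x < c 0 \<or> c n < x"
  shows "x \<notin> bands P"
  using assms(3)
proof
  assume "x < c 0"
  have "(-1) ^ (n - Suc 0) * poly P x < (-1) ^ (n - Suc 0) * poly P (c 0)"
    by (rule ladder_strict_mono[OF assms(1)]) (use assms(2) \<open>x < c 0\<close> ladder_le[OF assms(1)] in auto)
  moreover have "2 \<le> (-1) ^ (n - 0) * poly P (c 0)"
    using ladder_value[OF assms(1), of 0] by simp
  ultimately have "(-1) ^ n * poly P x > 2"
    using minus_one_power_diff_Suc[of 0 n] assms(2) by simp
  then show ?thesis
    using abs_minus_one_power_mult[of n "poly P x"] by (auto simp: bands_def)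
next
  assume "c n < x"
  have "(-1) ^ (n - Suc (n - 1)) * poly P (c n) < (-1) ^ (n - Suc (n - 1)) * poly P x"
  proof (rule ladder_strict_mono[OF assms(1)])
    show "c j \<le> c n" if "1 \<le> j" "j \<le> n - 1" for j
      using ladder_le[OF assms(1), of j n] that by simp
  qed (use assms(2) \<open>c n < x\<close> in auto)
  then show ?thesis
    using ladder_value[OF assms(1), of n] assms(2) by (auto simp: bands_def)
qed

lemma chain_interval_cover:
  fixes c :: "nat \<Rightarrow> real"
  assumes "c 0 \<le> x" "x \<le> c n" "n \<ge> 1"
  shows "\<exists>i<n. c i \<le> x \<and> x \<le> c (Suc i)"
  using assms(3,2)
proof (induction n rule: dec_induct)
  case base
  then show ?case using assms(1) by auto
next
  case (step n)
  then show ?case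
    by (cases "x \<le> c n") (auto intro: less_SucI)
qed

lemma ladder_bands_eq:
  assumes "ladder P n c" "n \<ge> 1"
    and "\<And>i. i < n \<Longrightarrow> c i \<le> lp i \<and> lp i < lm (Suc i) \<and> lm (Suc i) \<le> c (Suc i)"
    and "\<And>i x. i < n \<Longrightarrow> c i \<le> x \<Longrightarrow> x \<le> c (Suc i) \<Longrightarrow> x \<in> bands P \<longleftrightarrow> lp i \<le> x \<and> x \<le> lm (Suc i)"
  shows "bands P = (\<Union>i\<in>{0..n - 1}. {lp i..lm (i + 1)})"
proof (intro equalityI subsetI)
  fix x assume x: "x \<in> bands P"
  then have "c 0 \<le> x" "x \<le> c n"
    using ladder_outside[OF assms(1,2), of x] by (meson not_less)+
  then obtain i where "i < n" "c i \<le> x" "x \<le> c (Suc i)"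
    using chain_interval_cover assms(2) by blast
  then show "x \<in> (\<Union>i\<in>{0..n - 1}. {lp i..lm (i + 1)})"
    using assms(4) x by (auto intro!: bexI[of _ i])
next
  fix x assume "x \<in> (\<Union>i\<in>{0..n - 1}. {lp i..lm (i + 1)})"
  then obtain i where i: "i \<le> n - 1" "lp i \<le> x" "x \<le> lm (Suc i)"
    by auto
  then have "i < n"
    using assms(2) by auto
  then show "x \<in> bands P"
    using assms(3)[of i] assms(4)[of i x] i by auto
qed

lemma band_edges_exist:
  assumes "ladder (lyapunov k q) (2 * k) c" "k \<ge> 1" "spec q = complex_of_real ` bands (lyapunov k q)"
  shows "\<exists>lm lp. band_edges k q lm lp"
proof -
  define P where "P = lyapunov k q"
  define n where "n = 2 * k"
  have l: "ladder P n c" and n: "n \<ge> 1"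
    using assms by (auto simp: P_def n_def)
  obtain lm lp where e:
    "\<And>i. i < n \<Longrightarrow> c i \<le> lp i \<and> lp i < lm (Suc i) \<and> lm (Suc i) \<le> c (Suc i)"
    "\<And>i x. i < n \<Longrightarrow> c i \<le> x \<Longrightarrow> x \<le> c (Suc i) \<Longrightarrow> x \<in> bands P \<longleftrightarrow> lp i \<le> x \<and> x \<le> lm (Suc i)"
    using ladder_edges[OF l] by metis
  have c_in: "c i \<in> {lm i..lp i}" if "i \<in> {1..n - 1}" for i
    using e(1)[of i] e(1)[of "i - 1"] that by auto
  have uniq: "x = c i" if i: "i \<in> {1..n - 1}" "x \<in> {lm i..lp i}" "poly (pderiv P) x = 0" for i x
  proof -
    obtain j where j: "j \<in> {1..n - 1}" "x = c j"
      using i(3) ladder_critical_iff[OF l n] by auto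
    have "c (i - 1) < x" "x < c (Suc i)"
    proof -
      have "i - 1 < n" "i < n" "Suc (i - 1) = i"
        using i(1) by auto
      then show "c (i - 1) < x" "x < c (Suc i)"
        using e(1)[of "i - 1"] e(1)[of i] i(2) by auto
    qed
    then have "i - 1 < j" "j < Suc i"
      using ladder_le[OF l, of j "i - 1"] ladder_le[OF l, of "Suc i" j] i(1) j by (force simp: not_less)+
    then have "i = j"
      by simp
    then show ?thesis
      using j by simp
  qed
  have "band_edges k q lm lp"
    unfolding band_edges_def assms(3) P_def[symmetric] n_def[symmetric]
  proof (intro conjI ballI)
    show "complex_of_real ` bands P = complex_of_real ` (\<Union>i\<in>{0..n - 1}. {lp i..lm (i + 1)})"
      using ladder_bands_eq[OF l n e] by simp
    show "\<exists>!x. x \<in> {lm i..lp i} \<and> poly (pderiv P) x = 0" if i: "i \<in> {1..n - 1}" for i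
      using c_in[OF i] uniq[OF i] ladder_critical_iff[OF l n] i by blast
    show "lp i < lm (i + 1)" if "i \<in> {0..n - 1}" for i
    proof -
      have "i < n"
        using that n by auto
      then show ?thesis
        using e(1) by simp
    qed
    show "lm i \<le> lp i" if "i \<in> {1..n - 1}" for i
      using c_in[OF that] by simp
  qed
  then show ?thesis
    by blast
qed

text \<open>
  The bands determine an increasing list of critical points in the gaps, which must be \<open>c\<close>.  If the
  signed value at an edge of gap \<open>i\<close> were less than 2, the critical point would be another point of the
  gap, and by continuity the polynomial would take values in \<open>[-2, 2]\<close> strictly inside the gap.
\<close>

lemma band_edges_unique:
  assumes l: "ladder (lyapunov k q) (2 * k) c" and k: "k \<ge> 1"
    and spec: "spec q = complex_of_real ` bands (lyapunov k q)"
    and be: "band_edges k q lm lp" and i: "i \<in> {1..2 * k - 1}"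
  shows "c i \<in> {lm i..lp i}" "c (i - 1) < lm i" "(-1) ^ (2 * k - i) * poly (lyapunov k q) (lm i) = 2"
    and "lp i < c (Suc i)" "(-1) ^ (2 * k - i) * poly (lyapunov k q) (lp i) = 2"
proof -
  define P where "P = lyapunov k q"
  define n where "n = 2 * k"
  have L: "ladder P n c" and n: "n \<ge> 2"
    using l k by (auto simp: P_def n_def)
  note P_def[symmetric, simp] n_def[symmetric, simp]
  have i': "1 \<le> i" "i < n"
    using i k by auto
  have be': "\<forall>j\<in>{0..n - 1}. lp j < lm (j + 1)" "\<forall>j\<in>{1..n - 1}. lm j \<le> lp j"
    "\<forall>j\<in>{1..n - 1}. \<exists>!x. x \<in> {lm j..lp j} \<and> poly (pderiv P) x = 0"
    using be unfolding band_edges_def by simp_all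
  have e: "lp j < lm (Suc j)" if "j < n" for j
    using be'(1) that by (simp add: Ball_def)
  have e': "lm j \<le> lp j" if "1 \<le> j" "j < n" for j
    using be'(2) that by (simp add: Ball_def)
  have crit: "\<exists>x. x \<in> {lm j..lp j} \<and> poly (pderiv P) x = 0" if "1 \<le> j" "j < n" for j
  proof -
    have "j \<in> {1..n - 1}"
      using that by auto
    then show ?thesis
      using be'(3) by blast
  qed
  have "complex_of_real ` bands P = complex_of_real ` (\<Union>i\<in>{0..n - 1}. {lp i..lm (i + 1)})"
    using be spec by (simp add: band_edges_def)
  then have bands: "bands P = (\<Union>i\<in>{0..n - 1}. {lp i..lm (i + 1)})"
    by (simp add: inj_image_eq_iff[OF inj_of_real])
  obtain y where y: "\<And>j. 1 \<le> j \<Longrightarrow> j < n \<Longrightarrow> y j \<in> {lm j..lp j} \<and> poly (pderiv P) (y j) = 0"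
    using crit by metis
  have y_c: "y j = c j" if "j \<in> {1..n - 1}" for j
  proof (rule strict_chain_unique[of "n - 1" y c])
    show "y j < y (Suc j)" if "1 \<le> j" "j < n - 1" for j
    proof -
      have "j < n" "Suc j < n"
        using that by auto
      then show ?thesis
        using y[of j] y[of "Suc j"] e[of j] that(1) by simp
    qed
    show "c j < c (Suc j)" if "1 \<le> j" "j < n - 1" for j
      using ladder_less[OF L] that by auto
    show "y j \<in> c ` {1..n - 1}" if "j \<in> {1..n - 1}" for j
    proof -
      have "1 \<le> j" "j < n"
        using that by auto
      then show ?thesis
        using y[of j] ladder_critical_iff[OF L, of "y j"] n by auto
    qed
  qed (rule that)
  have c_in: "c j \<in> {lm j..lp j}" if "1 \<le> j" "j < n" for j
    using y[OF that] y_c[of j] that by auto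
  then show c_i: "c i \<in> {lm i..lp i}"
    using i' by blast
  have in_bands: "lp j \<in> bands P" "lm (Suc j) \<in> bands P" if "j < n" for j
    using e[OF that] that unfolding bands by (auto intro!: bexI[of _ j])
  show "c (i - 1) < lm i"
  proof -
    have "c (i - 1) \<le> lp (i - 1)"
    proof (cases "i = 1")
      case True
      then show ?thesis
        using ladder_outside[OF L, of "lp 0"] in_bands(1)[of 0] n by force
    next
      case False
      then show ?thesis
        using c_in[of "i - 1"] i' by auto
    qed
    also have "\<dots> < lm i"
      using e[of "i - 1"] i' by simp
    finally show ?thesis .
  qed
  show "lp i < c (Suc i)"
  proof -
    have "lp i < lm (Suc i)"
      using e[of i] i' by simp
    also have "\<dots> \<le> c (Suc i)"
    proof (cases "Suc i = n")
      case True
      then show ?thesis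
        using ladder_outside[OF L, of "lm n"] in_bands(2)[of i] n by force
    next
      case False
      then show ?thesis
        using c_in[of "Suc i"] i' by auto
    qed
    finally show ?thesis .
  qed
  have lp_le: "lp i \<le> lp j" if "i \<le> j" "j < n" for j
    using that
  proof (induction j rule: dec_induct)
    case (step j)
    then show ?case
      using e[of j] e'[of "Suc j"] by fastforce
  qed simp
  have lm_le: "lm j \<le> lm i" if "j \<le> i" "1 \<le> j" for j
    using that
  proof (induction j rule: inc_induct)
    case (step j)
    then show ?case
      using e[of j] e'[of j] i' by fastforce
  qed simp
  have gap: "x \<notin> bands P" if "lm i < x" "x < lp i" for x
  proof
    assume "x \<in> bands P"
    then obtain j where "j \<in> {0..n - 1}" and j: "lp j \<le> x" "x \<le> lm (Suc j)"
      unfolding bands by auto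
    then have "j < n"
      using n by auto
    show False
    proof (cases "i \<le> j")
      case True
      then show ?thesis
        using lp_le[of j] j that \<open>j < n\<close> by auto
    next
      case False
      then show ?thesis
        using lm_le[of "Suc j"] j that by auto
    qed
  qed
  define g where "g x = (-1) ^ (n - i) * poly P x" for x
  have g_bands: "x \<in> bands P \<longleftrightarrow> \<bar>g x\<bar> \<le> 2" for x
    by (simp add: bands_def g_def abs_minus_one_power_mult)
  have cont: "continuous_on A g" for A
    unfolding g_def by (intro continuous_intros)
  have g_c: "2 \<le> g (c i)"
    using ladder_value[OF L, of i] i' by (simp add: g_def)
  have g_lm: "\<bar>g (lm i)\<bar> \<le> 2" and g_lp: "\<bar>g (lp i)\<bar> \<le> 2"
    using in_bands(2)[of "i - 1"] in_bands(1)[of i] i' by (auto simp: g_bands)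
  have "g (lm i) = 2"
  proof (rule ccontr)
    assume "g (lm i) \<noteq> 2"
    then have *: "g (lm i) < 2"
      using g_lm by simp
    then obtain x where x: "lm i \<le> x" "x \<le> c i" "g x = (g (lm i) + 2) / 2"
      using IVT'[of g "lm i" "(g (lm i) + 2) / 2" "c i"] c_i g_c cont by auto
    then have "lm i \<noteq> x" "x \<noteq> c i"
      using * g_c by auto
    then have "x \<notin> bands P"
      using x c_i by (intro gap) auto
    then show False
      using x(3) g_lm * by (auto simp: g_bands)
  qed
  then show "(-1) ^ (2 * k - i) * poly (lyapunov k q) (lm i) = 2"
    by (simp add: g_def)
  have "g (lp i) = 2"
  proof (rule ccontr)
    assume "g (lp i) \<noteq> 2"
    then have *: "g (lp i) < 2"
      using g_lp by simp
    then obtain x where x: "c i \<le> x" "x \<le> lp i" "g x = (g (lp i) + 2) / 2"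
      using IVT2'[of g "lp i" "(g (lp i) + 2) / 2" "c i"] c_i g_c cont by auto
    then have "x \<noteq> lp i" "x \<noteq> c i"
      using * g_c by auto
    then have "x \<notin> bands P"
      using x c_i by (intro gap) auto
    then show False
      using x(3) g_lp * by (auto simp: g_bands)
  qed
  then show "(-1) ^ (2 * k - i) * poly (lyapunov k q) (lp i) = 2"
    by (simp add: g_def)
qed

text \<open>
  The polynomial is strictly monotone between \<open>c (i - 1)\<close> and \<open>c i\<close> and between \<open>c i\<close> and \<open>c (i + 1)\<close>, so
  the condition that its signed value is 2 at the edges of the gap around \<open>c i\<close> fixes them.  This makes the definite descriptions of the
  edges, of the critical point and of the gap height meaningful.
\<close>

lemma gap_invariants:
  assumes l: "ladder (lyapunov k q) (2 * k) c" and k: "k \<ge> 1"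
    and spec: "spec q = complex_of_real ` bands (lyapunov k q)" and i: "i \<in> {1..2 * k - 1}"
  shows lambda_crit_eq: "lambda_crit k q i = c i"
    and gap_height_eq: "gap_height k q i = arcosh ((-1) ^ (2 * k - i) * poly (lyapunov k q) (c i) / 2)"
    and gap_open: "(-1) ^ (2 * k - i) * poly (lyapunov k q) (c i) > 2 \<Longrightarrow> lambda_minus k q i < lambda_plus k q i"
proof -
  define P where "P = lyapunov k q"
  define n where "n = 2 * k"
  have L: "ladder P n c" and n: "n \<ge> 2"
    using l k by (auto simp: P_def n_def)
  note P_def[symmetric, simp] n_def[symmetric, simp]
  have i': "1 \<le> i" "i < n"
    using i k by auto
  obtain lm lp where be: "band_edges k q lm lp"
    using band_edges_exist[OF l k spec] by blast
  note u = band_edges_unique[OF l k spec _ i, simplified]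
  have lm_eq: "lm' i = lm i" if "band_edges k q lm' lp'" for lm' lp'
  proof (rule ccontr)
    have *: False if "a < b" "c (i - 1) < a" "b \<le> c i" "(-1) ^ (n - i) * poly P a = 2" "(-1) ^ (n - i) * poly P b = 2" for a b
    proof -
      have "(-1) ^ (n - Suc (i - 1)) * poly P a < (-1) ^ (n - Suc (i - 1)) * poly P b"
      proof (rule ladder_strict_mono[OF L _ that(1)])
        show "c j \<le> a" if "1 \<le> j" "j \<le> i - 1" for j
        proof -
          have "c j \<le> c (i - 1)"
            by (rule ladder_le[OF L]) (use i' that in auto)
          then show ?thesis
            using \<open>c (i - 1) < a\<close> by simp
        qed
        show "b \<le> c j" if "i - 1 < j" "j < n" for j
        proof -
          have "c i \<le> c j"
            by (rule ladder_le[OF L]) (use i' that in auto)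
          then show ?thesis
            using \<open>b \<le> c i\<close> by simp
        qed
      qed (use i' in simp)
      then show False
        using that i' by simp
    qed
    assume "lm' i \<noteq> lm i"
    then consider "lm' i < lm i" | "lm i < lm' i"
      by linarith
    then show False
      using *[of "lm' i" "lm i"] *[of "lm i" "lm' i"] u[OF that] u[OF be] by cases auto
  qed
  have lp_eq: "lp' i = lp i" if "band_edges k q lm' lp'" for lm' lp'
  proof (rule ccontr)
    have *: False if "a < b" "c i \<le> a" "b < c (Suc i)" "(-1) ^ (n - i) * poly P a = 2" "(-1) ^ (n - i) * poly P b = 2" for a b
    proof -
      have "(-1) ^ (n - Suc i) * poly P a < (-1) ^ (n - Suc i) * poly P b"
      proof (rule ladder_strict_mono[OF L _ that(1)])
        show "c j \<le> a" if "1 \<le> j" "j \<le> i" for j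
          using ladder_le[OF L, of j i] i' that \<open>c i \<le> a\<close> by simp
        show "b \<le> c j" if "i < j" "j < n" for j
          using ladder_le[OF L, of "Suc i" j] i' that \<open>b < c (Suc i)\<close> by simp
      qed (use i' in simp)
      then show False
        using that minus_one_power_diff_Suc[OF i'(2)] by simp
    qed
    assume "lp' i \<noteq> lp i"
    then consider "lp' i < lp i" | "lp i < lp' i"
      by linarith
    then show False
      using *[of "lp' i" "lp i"] *[of "lp i" "lp' i"] u[OF that] u[OF be] by cases auto
  qed
  have minus: "lambda_minus k q i = lm i"
    unfolding lambda_minus_def by (rule the_equality) (use be lm_eq in blast)+
  have plus: "lambda_plus k q i = lp i"
    unfolding lambda_plus_def by (rule the_equality) (use be lp_eq in blast)+
  have "\<exists>!x. x \<in> {lm i..lp i} \<and> poly (pderiv P) x = 0"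
    using be i by (auto simp: band_edges_def)
  moreover have "c i \<in> {lm i..lp i} \<and> poly (pderiv P) (c i) = 0"
    using u(1)[OF be] ladder_critical_iff[OF L, of "c i"] i' n by auto
  ultimately show crit: "lambda_crit k q i = c i"
    unfolding lambda_crit_def minus plus P_def[symmetric] by (rule the1_equality)
  define v where "v = (-1) ^ (n - i) * poly P (c i)"
  have v: "v \<ge> 2"
    using ladder_value[OF L, of i] i' by (simp add: v_def)
  have P_v: "poly P (c i) = (-1) ^ (n - i) * v"
    by (simp add: v_def minus_one_power_square)
  have "gap_height k q i = arcosh (v / 2)"
    unfolding gap_height_def crit P_def[symmetric] n_def[symmetric] P_v
  proof (rule the_equality)
    show "0 \<le> arcosh (v / 2) \<and> (- 1) ^ (n - i) * v = 2 * (- 1) ^ (n - i) * cosh (arcosh (v / 2))"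
      using v by simp
    fix t assume t: "0 \<le> t \<and> (- 1) ^ (n - i) * v = 2 * (- 1) ^ (n - i) * cosh t"
    then have "(-1) ^ (n - i) * ((- 1) ^ (n - i) * v) = (-1) ^ (n - i) * ((- 1) ^ (n - i) * (2 * cosh t))"
      by (simp add: mult_ac)
    then have "v / 2 = cosh t"
      by (simp only: minus_one_power_square)
    then show "t = arcosh (v / 2)"
      using t arcosh_cosh_real[of t] by simp
  qed
  then show "gap_height k q i = arcosh ((-1) ^ (2 * k - i) * poly (lyapunov k q) (c i) / 2)"
    by (simp add: v_def)
  show "lambda_minus k q i < lambda_plus k q i" if "(-1) ^ (2 * k - i) * poly (lyapunov k q) (c i) > 2"
  proof -
    have "lm i \<noteq> lp i"
    proof
      assume "lm i = lp i"
      then have "c i = lm i"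
        using u(1)[OF be] by simp
      then show False
        using that u(3)[OF be] by simp
    qed
    then show ?thesis
      using u(1)[OF be] minus plus by simp
  qed
qed

section \<open>The spectrum of a periodic operator\<close>

lemma int_periodic_induct:
  fixes N :: int
  assumes "N > 0" "\<And>n. P (n + N) \<longleftrightarrow> P n" "\<And>r. a \<le> r \<Longrightarrow> r < a + N \<Longrightarrow> P r"
  shows "P n"
proof -
  have up: "P (r + N * int t) \<longleftrightarrow> P r" for r t
    by (induction t) (use assms(2)[of "r + N * int t" for t] in \<open>simp_all add: algebra_simps\<close>)
  have shift: "P (r + N * t) \<longleftrightarrow> P r" for r t
  proof (cases "t \<ge> 0")
    case True
    then show ?thesis
      using up[of r "nat t"] by simp
  next
    case False
    then show ?thesis
      using up[of "r + N * t" "nat (- t)"] by simp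
  qed
  have "n = (a + (n - a) mod N) + N * ((n - a) div N)"
    by simp
  moreover have "P (a + (n - a) mod N)"
    using assms(1) by (intro assms(3)) auto
  ultimately show ?thesis
    using shift by metis
qed

lemma int_periodic_bounded:
  fixes w :: "int \<Rightarrow> real" and N :: int
  assumes "N > 0" "\<And>n. w (n + N) = w n"
  shows "\<exists>B. \<forall>n. \<bar>w n\<bar> \<le> B"
proof (intro exI allI)
  fix n
  show "\<bar>w n\<bar> \<le> (\<Sum>r\<in>{0..<N}. \<bar>w r\<bar>)"
  proof (rule int_periodic_induct[where a = 0 and N = N and n = n])
    show "\<bar>w r\<bar> \<le> (\<Sum>r\<in>{0..<N}. \<bar>w r\<bar>)" if "0 \<le> r" "r < 0 + N" for r
      using that by (intro member_le_sum) auto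
  qed (use assms in auto)
qed

text \<open>
  The numerical solution at a complex spectral parameter, needed because the spectrum is a set of
  complex numbers.
\<close>

fun csolution :: "(int \<Rightarrow> real) \<Rightarrow> complex \<Rightarrow> complex \<Rightarrow> complex \<Rightarrow> nat \<Rightarrow> complex" where
  "csolution q z a b 0 = a"
| "csolution q z a b (Suc 0) = b"
| "csolution q z a b (Suc (Suc n)) =
     (z - of_real (q (int (Suc n)))) * csolution q z a b (Suc n) - csolution q z a b n"

lemma csolution_of_real:
  "csolution q (of_real x) (of_real a) (of_real b) n = of_real (poly (solution q a b n) x)"
  by (induction q "complex_of_real x" "complex_of_real a" "complex_of_real b" n rule: csolution.induct)
    (auto simp: solution.simps(3) algebra_simps)

lemma csolution_linear:
  "csolution q z a b n = a * csolution q z 1 0 n + b * csolution q z 0 1 n"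
  by (induction q z a b n rule: csolution.induct) (auto simp: algebra_simps)

lemma csolution_wronskian:
  "csolution q z 0 1 (Suc n) * csolution q z 1 0 n - csolution q z 0 1 n * csolution q z 1 0 (Suc n) = 1"
  by (induction n) (auto simp: algebra_simps)

text \<open>
  The Lyapunov function at complex arguments: the trace of the monodromy matrix over one period.
\<close>

definition discriminant :: "nat \<Rightarrow> (int \<Rightarrow> real) \<Rightarrow> complex \<Rightarrow> complex" where
  "discriminant N q z = csolution q z 0 1 (N + 1) + csolution q z 1 0 N"

lemma discriminant_of_real:
  "discriminant (2 * k) q (of_real x) = of_real (poly (lyapunov k q) x)"
  using csolution_of_real[of q x 0 1] csolution_of_real[of q x 1 0]
  by (simp add: discriminant_def lyapunov_def del: csolution.simps)

text \<open>
  The determinant of \<open>A - r\<close> is zero, so its rows are proportional, and a nonzero vector annihilated by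
  a nonzero row is an eigenvector.
\<close>

lemma eigenvector_2x2:
  fixes a b c d r :: complex
  assumes "r\<^sup>2 - (a + d) * r + (a * d - b * c) = 0"
  shows "\<exists>x y. (x \<noteq> 0 \<or> y \<noteq> 0) \<and> a * x + b * y = r * x \<and> c * x + d * y = r * y"
proof -
  consider "b \<noteq> 0 \<or> r - a \<noteq> 0" | "c \<noteq> 0 \<or> r - d \<noteq> 0" | "b = 0" "c = 0" "r = a" "r = d"
    by auto
  then show ?thesis
  proof cases
    case 1
    have "c * b + d * (r - a) = r * (r - a)"
      using assms by (simp add: power2_eq_square algebra_simps)
    then show ?thesis
      using 1 by (intro exI[of _ b] exI[of _ "r - a"]) (auto simp: algebra_simps)
  next
    case 2
    have "a * (r - d) + b * c = r * (r - d)"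
      using assms by (simp add: power2_eq_square algebra_simps)
    then show ?thesis
      using 2 by (intro exI[of _ "r - d"] exI[of _ c]) (auto simp: algebra_simps)
  next
    case 3
    then show ?thesis
      by (intro exI[of _ 1] exI[of _ 0]) auto
  qed
qed

definition bloch :: "nat \<Rightarrow> (int \<Rightarrow> real) \<Rightarrow> complex \<Rightarrow> complex \<Rightarrow> (int \<Rightarrow> complex) \<Rightarrow> bool" where
  "bloch N q z r u \<longleftrightarrow> (\<forall>n. u (n - 1) + u (n + 1) + of_real (q n) * u n = z * u n) \<and>
     (\<forall>n. u (n + int N) = r * u n) \<and> (u 0 \<noteq> 0 \<or> u 1 \<noteq> 0)"

text \<open>
  An eigenvector of the monodromy matrix gives a solution on one period whose quasi-periodic
  continuation satisfies the equation across the ends of the period.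
\<close>

lemma exists_bloch:
  assumes N: "N \<ge> 2" and q: "\<And>n. q (n + int N) = q n" and r: "r \<noteq> 0" "r\<^sup>2 - discriminant N q z * r + 1 = 0"
  shows "\<exists>u. bloch N q z r u"
proof -
  define A where "A = csolution q z 1 0 N"
  define B where "B = csolution q z 0 1 N"
  define C where "C = csolution q z 1 0 (Suc N)"
  define D where "D = csolution q z 0 1 (Suc N)"
  have "r\<^sup>2 - (A + D) * r + (A * D - B * C) = 0"
  proof -
    have "discriminant N q z = A + D"
      by (simp add: discriminant_def A_def D_def del: csolution.simps)
    moreover have "A * D - B * C = 1"
      using csolution_wronskian[of q z N] by (simp add: A_def B_def C_def D_def mult.commute del: csolution.simps)
    ultimately show ?thesis
      using r(2) by simp
  qed
  then obtain x y where xy: "x \<noteq> 0 \<or> y \<noteq> 0" "A * x + B * y = r * x" "C * x + D * y = r * y"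
    using eigenvector_2x2 by blast
  define v where "v = csolution q z x y"
  have v: "v 0 = x" "v 1 = y" "v N = r * x" "v (Suc N) = r * y"
  proof -
    have "v N = A * x + B * y" "v (Suc N) = C * x + D * y"
      using csolution_linear[of q z x y N] csolution_linear[of q z x y "Suc N"]
      by (simp_all add: v_def A_def B_def C_def D_def mult.commute del: csolution.simps)
    then show "v 0 = x" "v 1 = y" "v N = r * x" "v (Suc N) = r * y"
      using xy by (simp_all add: v_def)
  qed
  have v_eq: "v n + v (Suc (Suc n)) + of_real (q (int (Suc n))) * v (Suc n) = z * v (Suc n)" for n
    by (simp add: v_def algebra_simps)
  define u where "u n = r powi (n div int N) * v (nat (n mod int N))" for n
  have u_shift: "u (n + int N) = r * u n" for n
    using N r(1) by (simp add: u_def power_int_add)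
  have u_v: "u (int j) = v j" if "j \<le> Suc N" for j
  proof -
    consider "j < N" | "j = N" | "j = Suc N"
      using \<open>j \<le> Suc N\<close> by linarith
    then show ?thesis
    proof cases
      case 1
      then show ?thesis by (simp add: u_def)
    next
      case 2
      then show ?thesis using N v u_shift[of 0] by (simp add: u_def)
    next
      case 3
      then show ?thesis using N v u_shift[of 1] by (simp add: u_def add.commute)
    qed
  qed
  have "u (n - 1) + u (n + 1) + of_real (q n) * u n = z * u n" for n
  proof (rule int_periodic_induct[where a = 1 and N = "int N" and n = n])
    fix n
    have "u (n + int N - 1) = r * u (n - 1)" "u (n + int N + 1) = r * u (n + 1)"
      using u_shift[of "n - 1"] u_shift[of "n + 1"] by (simp_all add: algebra_simps)
    then have "u (n + int N - 1) + u (n + int N + 1) + of_real (q (n + int N)) * u (n + int N) - z * u (n + int N)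
      = r * (u (n - 1) + u (n + 1) + of_real (q n) * u n - z * u n)"
      using q u_shift by (simp add: algebra_simps)
    then show "u (n + int N - 1) + u (n + int N + 1) + of_real (q (n + int N)) * u (n + int N) = z * u (n + int N)
      \<longleftrightarrow> u (n - 1) + u (n + 1) + of_real (q n) * u n = z * u n"
      using r(1) by (metis mult_eq_0_iff right_minus_eq)
  next
    fix n assume "1 \<le> n" "n < 1 + int N"
    then obtain j where j: "n = int (Suc j)" "j < N"
      by (intro that[of "nat (n - 1)"]) auto
    then show "u (n - 1) + u (n + 1) + of_real (q n) * u n = z * u n"
      using v_eq[of j] u_v[of j] u_v[of "Suc j"] u_v[of "Suc (Suc j)"] by (simp add: add.commute)
  qed (use N in simp)
  moreover have "u 0 \<noteq> 0 \<or> u 1 \<noteq> 0"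
    using u_v[of 0] u_v[of 1] v xy(1) by auto
  ultimately show ?thesis
    using u_shift by (auto simp: bloch_def)
qed

text \<open>
  Multiply the equation by the conjugate of the solution and sum over one period.  For a multiplier of
  modulus 1 the two hopping terms are conjugate to each other, so the left-hand side is real.
\<close>

lemma bloch_unit_multiplier_real:
  assumes "bloch N q z r u" "N \<ge> 2" "cmod r = 1"
  shows "z \<in> \<real>"
proof -
  have eq: "u (n - 1) + u (n + 1) + of_real (q n) * u n = z * u n" and shift: "u (n + int N) = r * u n" for n
    using assms(1) by (auto simp: bloch_def)
  define a where "a i = u (int i - 1) * cnj (u (int i))" for i :: nat
  have "a (Suc N) = (r * cnj r) * a 1"
    using shift[of 0] shift[of 1] by (simp add: a_def add.commute)
  then have "a (Suc N) = a 1"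
    using assms(3) by (simp add: complex_norm_square[symmetric])
  then have "(\<Sum>i=1..N. a (Suc i)) - (\<Sum>i=1..N. a i) = 0"
    using sum_Suc_diff[of 1 N a] assms(2) by (simp add: sum_subtractf)
  then have a_sum: "(\<Sum>i=1..N. a (Suc i)) = (\<Sum>i=1..N. a i)"
    by simp
  define S where "S = (\<Sum>i=1..N. (cmod (u (int i)))\<^sup>2)"
  have "z * of_real S = (\<Sum>i=1..N. z * u (int i) * cnj (u (int i)))"
    unfolding S_def by (simp only: of_real_sum complex_norm_square sum_distrib_left mult.assoc)
  also have "\<dots> = (\<Sum>i=1..N. a i + cnj (a (Suc i)) + of_real (q (int i) * (cmod (u (int i)))\<^sup>2))"
    unfolding of_real_mult complex_norm_square
    by (intro sum.cong refl) (simp add: eq[symmetric] a_def algebra_simps)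
  also have "\<dots> = (\<Sum>i=1..N. a i) + cnj (\<Sum>i=1..N. a i) + of_real (\<Sum>i=1..N. q (int i) * (cmod (u (int i)))\<^sup>2)"
    using arg_cong[OF a_sum, of cnj] by (simp add: sum.distrib)
  finally have "Im (z * of_real S) = 0"
    by (simp only: plus_complex.sel cnj.sel Im_complex_of_real)
  moreover have "S > 0"
  proof -
    have "u (int N) \<noteq> 0 \<or> u 1 \<noteq> 0"
      using assms shift[of 0] by (auto simp: bloch_def)
    then obtain i where "i \<in> {1..N}" "u (int i) \<noteq> 0"
      using assms(2) that[of N] that[of 1] by auto
    then show ?thesis
      unfolding S_def by (intro sum_pos2[of _ i]) auto
  qed
  ultimately show ?thesis
    by (simp add: complex_is_Real_iff)
qed

lemma cmod_one_discriminant: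
  assumes "r\<^sup>2 - d * r + 1 = 0" "cmod r = 1"
  shows "\<exists>x. d = of_real x \<and> \<bar>x\<bar> \<le> 2"
proof -
  have "r \<noteq> 0"
    using assms(2) by auto
  then have "d = r + inverse r"
    using assms(1) by (simp add: field_simps power2_eq_square)
  also have "inverse r = cnj r"
    using assms(2) \<open>r \<noteq> 0\<close> complex_norm_square[of r] by (simp add: field_simps)
  finally have "d = of_real (2 * Re r)"
    using complex_add_cnj by simp
  then show ?thesis
    using abs_Re_le_cmod[of r] assms(2) by (intro exI[of _ "2 * Re r"]) auto
qed

text \<open>
  The two roots of \<open>r\<^sup>2 - d r + 1\<close> are inverse to each other, so one of them lies in the closed unit disc.
\<close>

lemma exists_multipliers:
  "\<exists>r. r \<noteq> 0 \<and> cmod r \<le> 1 \<and> r\<^sup>2 - d * r + 1 = 0 \<and> (inverse r)\<^sup>2 - d * inverse r + 1 = (0::complex)"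
proof -
  define s where "s = (d + csqrt (d\<^sup>2 - 4)) / 2"
  have s: "s\<^sup>2 - d * s + 1 = 0"
  proof -
    have "4 * (s\<^sup>2 - d * s + 1) = (csqrt (d\<^sup>2 - 4))\<^sup>2 - (d\<^sup>2 - 4)"
      unfolding s_def by (simp only: power2_eq_square) (simp add: field_simps)
    then have "4 * (s\<^sup>2 - d * s + 1) = 0"
      by (simp only: power2_csqrt) simp
    then show ?thesis
      by (simp only: mult_eq_0_iff) simp
  qed
  then have "s \<noteq> 0"
    by auto
  then have inv: "(inverse s)\<^sup>2 - d * inverse s + 1 = 0"
    using s by (simp add: field_simps power2_eq_square)
  show ?thesis
  proof (cases "cmod s \<le> 1")
    case True
    then show ?thesis using s inv \<open>s \<noteq> 0\<close> by blast
  next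
    case False
    then have "cmod (inverse s) \<le> 1"
      by (simp add: norm_inverse inverse_le_1_iff)
    then show ?thesis using s inv \<open>s \<noteq> 0\<close> by (intro exI[of _ "inverse s"]) auto
  qed
qed

lemma discriminant_interval_multiplier:
  assumes "r\<^sup>2 - of_real x * r + 1 = 0" "\<bar>x\<bar> \<le> 2" "cmod r \<le> 1"
  shows "cmod r = 1"
proof -
  have "r = of_real (x / 2) + \<i> * of_real (sqrt (1 - (x / 2)\<^sup>2)) \<or> r = of_real (x / 2) - \<i> * of_real (sqrt (1 - (x / 2)\<^sup>2))"
  proof -
    have "(x / 2)\<^sup>2 \<le> 1"
      using assms(2) by (simp add: abs_square_le_1)
    then have "(of_real (sqrt (1 - (x / 2)\<^sup>2)) :: complex)\<^sup>2 = 1 - (of_real x / 2)\<^sup>2"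
      by (simp add: power_divide flip: of_real_power)
    moreover define X Y where "X = complex_of_real (x / 2)" and "Y = \<i> * complex_of_real (sqrt (1 - (x / 2)\<^sup>2))"
    ultimately have "X\<^sup>2 - Y\<^sup>2 = 1"
      by (simp only: X_def Y_def) (simp add: power_mult_distrib power_divide)
    moreover have "r\<^sup>2 - 2 * X * r + 1 = 0"
      using assms(1) by (simp add: X_def)
    ultimately have "(r - (X + Y)) * (r - (X - Y)) = 0"
      by algebra
    then show ?thesis
      by (simp add: X_def Y_def)
  qed
  moreover have "(x / 2)\<^sup>2 \<le> 1"
    using assms(2) by (simp add: abs_square_le_1)
  ultimately show ?thesis
    by (auto simp: cmod_def)
qed

lemma l2Z_finite_support:
  assumes "finite A" "\<And>n. n \<notin> A \<Longrightarrow> y n = 0"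
  shows "y \<in> l2Z" "(l2Z_norm y)\<^sup>2 = (\<Sum>n\<in>A. (cmod (y n))\<^sup>2)"
proof -
  have "((\<lambda>n. (cmod (y n))\<^sup>2) has_sum (\<Sum>n\<in>A. (cmod (y n))\<^sup>2)) UNIV"
    by (rule has_sum_finite_neutralI[OF assms(1)]) (use assms(2) in auto)
  then show "y \<in> l2Z" "(l2Z_norm y)\<^sup>2 = (\<Sum>n\<in>A. (cmod (y n))\<^sup>2)"
    by (auto simp: l2Z_def l2Z_norm_def summable_on_def infsumI sum_nonneg)
qed

text \<open>
  A Bloch solution with multiplier of modulus 1 is bounded but not square-summable.  Cut off after \<open>M\<close>
  periods it has squared norm of order \<open>M\<close>, while \<open>(L - z)\<close> maps it to a sequence supported on four sites with
  entries bounded independently of \<open>M\<close>.  So \<open>L - z\<close> has no bounded inverse.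
\<close>

lemma unit_multiplier_in_spectrum:
  assumes "bloch N q z r u" "N \<ge> 2" "cmod r = 1" "\<And>n. q (n + int N) = q n"
  shows "z \<in> spec q"
  unfolding spec_def op_spectrum_def
proof (rule ComplI)
  define T where "T y n = schroedinger q y n - z * y n" for y n
  assume "z \<in> resolvent_set (schroedinger q)"
  then obtain C where C: "\<And>y. y \<in> l2Z \<Longrightarrow> l2Z_norm y \<le> C * l2Z_norm (T y)"
    unfolding resolvent_set_def T_def by blast
  have eq: "u (n - 1) + u (n + 1) + of_real (q n) * u n = z * u n" and shift: "u (n + int N) = r * u n" for n
    using assms(1) by (auto simp: bloch_def)
  have "\<exists>B. \<forall>n. \<bar>cmod (u n)\<bar> \<le> B" "\<exists>Q. \<forall>n. \<bar>q n\<bar> \<le> Q"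
    using assms shift by (intro int_periodic_bounded[of "int N"]; simp add: norm_mult)+
  then obtain B Q where B: "\<And>n. cmod (u n) \<le> B" and Q: "\<And>n. \<bar>q n\<bar> \<le> Q"
    by auto
  have "B \<ge> 0" "Q \<ge> 0"
    using B[of 0] Q[of 0] norm_ge_zero[of "u 0"] by linarith+
  define D where "D = B + B + Q * B + cmod z * B"
  obtain n0 where n0: "n0 \<in> {0, 1}" "u n0 \<noteq> 0"
    using assms(1) by (auto simp: bloch_def)
  define \<delta> where "\<delta> = (cmod (u n0))\<^sup>2"
  have "\<delta> > 0"
    using n0 by (simp add: \<delta>_def)
  obtain M :: nat where M: "C\<^sup>2 * (4 * D\<^sup>2) / \<delta> < real M"
    using reals_Archimedean2 by blast
  \<comment> \<open>The Bloch solution is cut off to \<open>M\<close> periods; \<open>M\<close> is chosen to beat the supposed bound \<open>C\<close>.\<close>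
  define K where "K = int M * int N"
  have "K \<ge> 0"
    by (simp add: K_def)
  define y where "y n = (if 0 \<le> n \<and> n < K then u n else 0)" for n
  have y: "y \<in> l2Z" "(l2Z_norm y)\<^sup>2 = (\<Sum>n\<in>{0..<K}. (cmod (y n))\<^sup>2)"
  proof -
    have "y n = 0" if "n \<notin> {0..<K}" for n
      using that by (auto simp: y_def)
    then show "y \<in> l2Z" "(l2Z_norm y)\<^sup>2 = (\<Sum>n\<in>{0..<K}. (cmod (y n))\<^sup>2)"
      using l2Z_finite_support[of "{0..<K}" y] by blast+
  qed
  have cmod_y: "cmod (y n) \<le> B" for n
    using B[of n] \<open>B \<ge> 0\<close> by (simp add: y_def)
  have norm_y: "real M * \<delta> \<le> (l2Z_norm y)\<^sup>2"
  proof -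
    have inj: "inj_on (\<lambda>j. n0 + int j * int N) {..<M}"
      using assms(2) by (auto simp: inj_on_def)
    have in_range: "0 \<le> n0 + int j * int N \<and> n0 + int j * int N < K" if "j < M" for j
    proof -
      have "(j + 1) * N \<le> M * N"
        using that by (intro mult_right_mono) auto
      then have "int j * int N + int N \<le> K"
        unfolding K_def by (simp flip: of_nat_mult of_nat_add add: add.commute)
      moreover have "0 \<le> int j * int N" "int N \<ge> 2"
        using assms(2) by auto
      moreover have "0 \<le> n0" "n0 \<le> 1"
        using n0(1) by auto
      ultimately show ?thesis
        by linarith
    qed
    have cmod_u: "cmod (u (n0 + int j * int N)) = cmod (u n0)" for j
      by (induction j) (use shift[of "n0 + int j * int N" for j] assms(3) in \<open>simp_all add: algebra_simps norm_mult\<close>)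
    have "real M * \<delta> = (\<Sum>j<M. (cmod (y (n0 + int j * int N)))\<^sup>2)"
      using in_range cmod_u by (simp add: y_def \<delta>_def)
    also have "\<dots> = (\<Sum>n\<in>(\<lambda>j. n0 + int j * int N) ` {..<M}. (cmod (y n))\<^sup>2)"
      by (simp add: sum.reindex[OF inj])
    also have "\<dots> \<le> (\<Sum>n\<in>{0..<K}. (cmod (y n))\<^sup>2)"
      using in_range by (intro sum_mono2) auto
    finally show ?thesis
      using y(2) by simp
  qed
  \<comment> \<open>Only the sites next to the two cuts contribute.\<close>
  define A where "A = {-1, 0, K - 1, K}"
  have T0: "T y n = 0" if "n \<notin> A" for n
  proof -
    consider "n < -1" | "n > K" | "0 < n" "n < K - 1"
      using \<open>n \<notin> A\<close> unfolding A_def by fastforce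
    then show ?thesis
      using eq[of n] \<open>K \<ge> 0\<close> by cases (auto simp: T_def schroedinger_def y_def)
  qed
  have "cmod (T y n) \<le> D" for n
  proof -
    have "cmod (T y n) \<le> cmod (y (n - 1)) + cmod (y (n + 1)) + \<bar>q n\<bar> * cmod (y n) + cmod z * cmod (y n)"
      unfolding T_def schroedinger_def
      by (intro norm_triangle_le_diff norm_triangle_mono add_mono) (auto simp: norm_mult)
    also have "\<dots> \<le> D"
      unfolding D_def using cmod_y Q \<open>B \<ge> 0\<close> \<open>Q \<ge> 0\<close> by (intro add_mono mult_mono) auto
    finally show ?thesis .
  qed
  then have "(\<Sum>n\<in>A. (cmod (T y n))\<^sup>2) \<le> (\<Sum>n\<in>A. D\<^sup>2)"
    by (intro sum_mono power_mono) auto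
  also have "\<dots> \<le> 4 * D\<^sup>2"
  proof -
    have "card A \<le> 4"
      unfolding A_def using card_length[of "[-1, 0, K - 1, K]"] by simp
    then show ?thesis
      by (simp add: mult_right_mono)
  qed
  finally have "(l2Z_norm (T y))\<^sup>2 \<le> 4 * D\<^sup>2"
    using l2Z_finite_support(2)[of A "T y"] T0 by (simp add: A_def)
  have "0 \<le> l2Z_norm y"
    by (simp add: l2Z_norm_def infsum_nonneg)
  then have "(l2Z_norm y)\<^sup>2 \<le> (C * l2Z_norm (T y))\<^sup>2"
    using C[OF y(1)] by (intro power_mono)
  also have "\<dots> \<le> C\<^sup>2 * (4 * D\<^sup>2)"
    using \<open>(l2Z_norm (T y))\<^sup>2 \<le> 4 * D\<^sup>2\<close> by (simp add: power_mult_distrib mult_left_mono)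
  finally have "real M * \<delta> \<le> C\<^sup>2 * (4 * D\<^sup>2)"
    using norm_y by simp
  then show False
    using M \<open>\<delta> > 0\<close> by (simp add: field_simps)
qed

lemma geometric_int_bounded:
  fixes r :: real
  assumes "0 \<le> r" "r < 1" "finite F"
  shows "(\<Sum>j\<in>F. r ^ nat \<bar>j\<bar>) \<le> 2 / (1 - r)"
proof -
  have geo: "(\<Sum>j\<in>A. r ^ j) \<le> 1 / (1 - r)" if "finite A" for A
  proof -
    have "(\<Sum>j\<in>A. r ^ j) \<le> (\<Sum>j. r ^ j)"
      by (rule sum_le_suminf) (use assms that in \<open>auto simp: summable_geometric\<close>)
    then show ?thesis
      using assms by (simp add: suminf_geometric)
  qed
  have split: "F = (F \<inter> {0..}) \<union> (F \<inter> {..<0})"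
    by auto
  have "(\<Sum>j\<in>F. r ^ nat \<bar>j\<bar>) = (\<Sum>j\<in>F \<inter> {0..}. r ^ nat \<bar>j\<bar>) + (\<Sum>j\<in>F \<inter> {..<0}. r ^ nat \<bar>j\<bar>)"
    using assms(3) by (subst split, intro sum.union_disjoint) auto
  also have "(\<Sum>j\<in>F \<inter> {0..}. r ^ nat \<bar>j\<bar>) = (\<Sum>j\<in>(\<lambda>j. nat \<bar>j\<bar>) ` (F \<inter> {0..}). r ^ j)"
    by (subst sum.reindex) (auto simp: inj_on_def)
  also have "(\<Sum>j\<in>F \<inter> {..<0}. r ^ nat \<bar>j\<bar>) = (\<Sum>j\<in>(\<lambda>j. nat \<bar>j\<bar>) ` (F \<inter> {..<0}). r ^ j)"
    by (subst sum.reindex) (auto simp: inj_on_def)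
  finally show ?thesis
    using geo[of "(\<lambda>j. nat \<bar>j\<bar>) ` (F \<inter> {0..})"] geo[of "(\<lambda>j. nat \<bar>j\<bar>) ` (F \<inter> {..<0})"] assms(3) by simp
qed

lemma l2Z_sum_le:
  assumes "f \<in> l2Z" "finite A"
  shows "(\<Sum>n\<in>A. (cmod (f n))\<^sup>2) \<le> (l2Z_norm f)\<^sup>2"
  using finite_sum_le_infsum[of "\<lambda>n. (cmod (f n))\<^sup>2" UNIV A] assms
  by (auto simp: l2Z_def l2Z_norm_def infsum_nonneg)

lemma l2Z_norm_nonneg: "0 \<le> l2Z_norm f"
  by (simp add: l2Z_norm_def infsum_nonneg)

lemma l2Z_I:
  assumes "\<And>A. finite A \<Longrightarrow> (\<Sum>n\<in>A. (cmod (f n))\<^sup>2) \<le> B\<^sup>2" "B \<ge> 0"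
  shows "f \<in> l2Z" "l2Z_norm f \<le> B"
proof -
  have s: "(\<lambda>n. (cmod (f n))\<^sup>2) summable_on UNIV"
    using assms(1) by (intro nonneg_bdd_above_summable_on) (auto simp: bdd_above_def)
  then show "f \<in> l2Z"
    by (simp add: l2Z_def)
  have "(\<Sum>\<^sub>\<infinity>n. (cmod (f n))\<^sup>2) \<le> B\<^sup>2"
    using s assms(1) by (intro infsum_le_finite_sums) auto
  then show "l2Z_norm f \<le> B"
    using assms(2) by (simp add: l2Z_norm_def real_le_lsqrt)
qed

lemma l2Z_bounded: "f \<in> l2Z \<Longrightarrow> cmod (f n) \<le> l2Z_norm f"
  using l2Z_sum_le[of f "{n}"] l2Z_norm_nonneg[of f] power2_le_imp_le[of "cmod (f n)" "l2Z_norm f"]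
  by simp

text \<open>
  The form of the Cauchy-Schwarz inequality behind Schur's test for kernels.
\<close>

lemma weighted_Cauchy_Schwarz:
  fixes w a :: "'a \<Rightarrow> real"
  assumes "\<And>j. j \<in> J \<Longrightarrow> 0 \<le> w j"
  shows "(\<Sum>j\<in>J. w j * a j)\<^sup>2 \<le> (\<Sum>j\<in>J. w j) * (\<Sum>j\<in>J. w j * (a j)\<^sup>2)"
proof -
  have "(\<Sum>j\<in>J. w j * a j) = (\<Sum>j\<in>J. sqrt (w j) * (sqrt (w j) * a j))"
    using assms by (intro sum.cong) (auto simp: mult.assoc[symmetric] simp del: mult.assoc)
  then have "(\<Sum>j\<in>J. w j * a j)\<^sup>2 \<le> (\<Sum>j\<in>J. (sqrt (w j))\<^sup>2) * (\<Sum>j\<in>J. (sqrt (w j) * a j)\<^sup>2)"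
    using Cauchy_Schwarz_ineq_sum[of "\<lambda>j. sqrt (w j)" "\<lambda>j. sqrt (w j) * a j" J] by simp
  also have "(\<Sum>j\<in>J. (sqrt (w j))\<^sup>2) = (\<Sum>j\<in>J. w j)"
    using assms by (intro sum.cong) auto
  also have "(\<Sum>j\<in>J. (sqrt (w j) * a j)\<^sup>2) = (\<Sum>j\<in>J. w j * (a j)\<^sup>2)"
    using assms by (intro sum.cong) (auto simp: power_mult_distrib)
  finally show ?thesis .
qed

locale exponential_kernel =
  fixes G :: "int \<Rightarrow> int \<Rightarrow> complex" and C r :: real
  assumes bound: "\<And>n m. cmod (G n m) \<le> C * r ^ nat \<bar>n - m\<bar>" and r: "0 < r" "r < 1" and C: "C \<ge> 0"
begin

lemma weight_sum_le:
  assumes "finite A"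
  shows "(\<Sum>n\<in>A. r ^ nat \<bar>n - m\<bar>) \<le> 2 / (1 - r)"
proof -
  have "(\<Sum>n\<in>A. r ^ nat \<bar>n - m\<bar>) = (\<Sum>j\<in>(\<lambda>n. n - m) ` A. r ^ nat \<bar>j\<bar>)"
    by (subst sum.reindex) (auto simp: inj_on_def)
  also have "\<dots> \<le> 2 / (1 - r)"
    using r assms by (intro geometric_int_bounded) auto
  finally show ?thesis .
qed

lemma weight_sum_le': "finite A \<Longrightarrow> (\<Sum>m\<in>A. r ^ nat \<bar>n - m\<bar>) \<le> 2 / (1 - r)"
  using weight_sum_le[of A n] by (simp add: abs_minus_commute)

lemma kernel_summable:
  assumes "f \<in> l2Z"
  shows "(\<lambda>m. G n m * f m) summable_on UNIV"
proof -
  have "(\<lambda>m. norm (G n m * f m)) summable_on UNIV"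
  proof (rule nonneg_bdd_above_summable_on)
    show "bdd_above (sum (\<lambda>m. norm (G n m * f m)) ` {F. F \<subseteq> UNIV \<and> finite F})"
    proof (rule bdd_aboveI2)
      fix F :: "int set" assume "F \<in> {F. F \<subseteq> UNIV \<and> finite F}"
      then have F: "finite F" by simp
      have "(\<Sum>m\<in>F. norm (G n m * f m)) \<le> (\<Sum>m\<in>F. C * r ^ nat \<bar>n - m\<bar> * l2Z_norm f)"
        unfolding norm_mult using bound l2Z_bounded[OF assms] C r
        by (intro sum_mono mult_mono) auto
      also have "\<dots> = C * l2Z_norm f * (\<Sum>m\<in>F. r ^ nat \<bar>n - m\<bar>)"
        by (simp add: sum_distrib_left mult_ac)
      also have "\<dots> \<le> C * l2Z_norm f * (2 / (1 - r))"
        using weight_sum_le'[OF F] C l2Z_norm_nonneg by (intro mult_left_mono) auto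
      finally show "(\<Sum>m\<in>F. norm (G n m * f m)) \<le> C * l2Z_norm f * (2 / (1 - r))" .
    qed
  qed auto
  then show ?thesis
    by (rule abs_summable_summable)
qed

text \<open>
  Schur's test for finite sections of the kernel, with a bound that does not depend on the section.
\<close>

lemma kernel_finite_bound:
  assumes f: "f \<in> l2Z" and A: "finite A" and J: "finite J"
  shows "(\<Sum>n\<in>A. (cmod (\<Sum>m\<in>J. G n m * f m))\<^sup>2) \<le> (C * (2 / (1 - r)) * l2Z_norm f)\<^sup>2"
proof -
  define S where "S = 2 / (1 - r)"
  define w where "w n m = r ^ nat \<bar>n - m\<bar>" for n m
  have S: "S \<ge> 0" and w: "w n m \<ge> 0" for n m
    using r by (auto simp: S_def w_def)
  have "(cmod (\<Sum>m\<in>J. G n m * f m))\<^sup>2 \<le> C\<^sup>2 * (S * (\<Sum>m\<in>J. w n m * (cmod (f m))\<^sup>2))" for n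
  proof -
    have "cmod (\<Sum>m\<in>J. G n m * f m) \<le> (\<Sum>m\<in>J. C * w n m * cmod (f m))"
      using bound by (intro sum_norm_le) (auto simp: norm_mult w_def intro!: mult_right_mono)
    also have "\<dots> = C * (\<Sum>m\<in>J. w n m * cmod (f m))"
      by (simp add: sum_distrib_left mult.assoc)
    finally have "(cmod (\<Sum>m\<in>J. G n m * f m))\<^sup>2 \<le> (C * (\<Sum>m\<in>J. w n m * cmod (f m)))\<^sup>2"
      by (intro power_mono) auto
    also have "\<dots> = C\<^sup>2 * (\<Sum>m\<in>J. w n m * cmod (f m))\<^sup>2"
      by (simp add: power_mult_distrib)
    also have "\<dots> \<le> C\<^sup>2 * ((\<Sum>m\<in>J. w n m) * (\<Sum>m\<in>J. w n m * (cmod (f m))\<^sup>2))"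
      using w by (intro mult_left_mono weighted_Cauchy_Schwarz) auto
    also have "\<dots> \<le> C\<^sup>2 * (S * (\<Sum>m\<in>J. w n m * (cmod (f m))\<^sup>2))"
      using weight_sum_le'[OF J, of n] w
      by (intro mult_left_mono mult_right_mono sum_nonneg) (auto simp: S_def w_def)
    finally show ?thesis .
  qed
  then have "(\<Sum>n\<in>A. (cmod (\<Sum>m\<in>J. G n m * f m))\<^sup>2) \<le> (\<Sum>n\<in>A. C\<^sup>2 * (S * (\<Sum>m\<in>J. w n m * (cmod (f m))\<^sup>2)))"
    by (rule sum_mono)
  also have "\<dots> = C\<^sup>2 * S * (\<Sum>n\<in>A. \<Sum>m\<in>J. w n m * (cmod (f m))\<^sup>2)"
    by (simp add: sum_distrib_left mult.assoc)
  also have "(\<Sum>n\<in>A. \<Sum>m\<in>J. w n m * (cmod (f m))\<^sup>2) = (\<Sum>m\<in>J. (\<Sum>n\<in>A. w n m) * (cmod (f m))\<^sup>2)"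
    by (subst sum.swap) (simp add: sum_distrib_right)
  also have "C\<^sup>2 * S * \<dots> \<le> C\<^sup>2 * S * (\<Sum>m\<in>J. S * (cmod (f m))\<^sup>2)"
    using weight_sum_le[OF A] S by (intro mult_left_mono sum_mono mult_right_mono) (auto simp: S_def w_def)
  also have "\<dots> = C\<^sup>2 * S * S * (\<Sum>m\<in>J. (cmod (f m))\<^sup>2)"
    by (simp add: sum_distrib_left mult.assoc)
  also have "\<dots> \<le> C\<^sup>2 * S * S * (l2Z_norm f)\<^sup>2"
    using l2Z_sum_le[OF f J] S by (intro mult_left_mono) auto
  also have "\<dots> = (C * (2 / (1 - r)) * l2Z_norm f)\<^sup>2"
    by (simp add: S_def[symmetric] power2_eq_square)
  finally show ?thesis .
qed

definition apply_kernel :: "(int \<Rightarrow> complex) \<Rightarrow> int \<Rightarrow> complex" where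
  "apply_kernel f n = (\<Sum>\<^sub>\<infinity>m. G n m * f m)"

lemma apply_kernel_l2Z:
  assumes "f \<in> l2Z"
  shows "apply_kernel f \<in> l2Z" "l2Z_norm (apply_kernel f) \<le> C * (2 / (1 - r)) * l2Z_norm f"
proof -
  have fin: "(\<Sum>n\<in>A. (cmod (apply_kernel f n))\<^sup>2) \<le> (C * (2 / (1 - r)) * l2Z_norm f)\<^sup>2" if A: "finite A" for A
  proof (rule tendsto_upperbound)
    have "((\<lambda>J. \<Sum>m\<in>J. G n m * f m) \<longlongrightarrow> apply_kernel f n) (finite_subsets_at_top UNIV)" for n
      using has_sum_infsum[OF kernel_summable[OF assms, of n]] by (simp add: has_sum_def apply_kernel_def)
    then show "((\<lambda>J. \<Sum>n\<in>A. (cmod (\<Sum>m\<in>J. G n m * f m))\<^sup>2) \<longlongrightarrow> (\<Sum>n\<in>A. (cmod (apply_kernel f n))\<^sup>2)) (finite_subsets_at_top UNIV)"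
      by (intro tendsto_intros)
    show "\<forall>\<^sub>F J in finite_subsets_at_top UNIV. (\<Sum>n\<in>A. (cmod (\<Sum>m\<in>J. G n m * f m))\<^sup>2) \<le> (C * (2 / (1 - r)) * l2Z_norm f)\<^sup>2"
      using kernel_finite_bound[OF assms A] by (auto intro!: eventually_finite_subsets_at_top_weakI)
  qed simp
  have nonneg: "C * (2 / (1 - r)) * l2Z_norm f \<ge> 0"
    using r C l2Z_norm_nonneg[of f] by simp
  show "apply_kernel f \<in> l2Z" "l2Z_norm (apply_kernel f) \<le> C * (2 / (1 - r)) * l2Z_norm f"
    using l2Z_I[OF fin nonneg] by simp_all
qed

end

lemma l2Z_add: 
  assumes "f \<in> l2Z" "g \<in> l2Z"
  shows "(\<lambda>n. f n + g n) \<in> l2Z"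
proof -
  have "(\<lambda>n. 2 * (cmod (f n))\<^sup>2 + 2 * (cmod (g n))\<^sup>2) summable_on UNIV"
    using assms by (intro summable_on_add summable_on_cmult_right) (auto simp: l2Z_def)
  moreover have "(cmod (f n + g n))\<^sup>2 \<le> 2 * (cmod (f n))\<^sup>2 + 2 * (cmod (g n))\<^sup>2" for n
  proof -
    have "(cmod (f n + g n))\<^sup>2 \<le> (cmod (f n) + cmod (g n))\<^sup>2"
      by (intro power_mono norm_triangle_ineq) auto
    also have "\<dots> \<le> 2 * (cmod (f n))\<^sup>2 + 2 * (cmod (g n))\<^sup>2"
      using sum_squares_bound[of "cmod (f n)" "cmod (g n)"] by (simp add: power2_sum)
    finally show ?thesis .
  qed
  ultimately show ?thesis
    unfolding l2Z_def mem_Collect_eq by (rule summable_on_comparison_test) auto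
qed

lemma l2Z_mult_bounded:
  assumes "f \<in> l2Z" "\<And>n. cmod (a n) \<le> B"
  shows "(\<lambda>n. a n * f n) \<in> l2Z"
proof -
  have "(\<lambda>n. B\<^sup>2 * (cmod (f n))\<^sup>2) summable_on UNIV"
    using assms(1) by (intro summable_on_cmult_right) (auto simp: l2Z_def)
  moreover have "(cmod (a n * f n))\<^sup>2 \<le> B\<^sup>2 * (cmod (f n))\<^sup>2" for n
    unfolding norm_mult power_mult_distrib using assms(2) by (intro mult_right_mono power_mono) auto
  ultimately show ?thesis
    unfolding l2Z_def mem_Collect_eq by (rule summable_on_comparison_test) auto
qed

lemma bij_int_shift: "bij (\<lambda>n::int. n + c)"
  by (rule bij_betw_byWitness[where f' = "\<lambda>n. n - c"]) auto

lemma l2Z_shift: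
  assumes "f \<in> l2Z"
  shows "(\<lambda>n. f (n + c)) \<in> l2Z"
  using assms summable_on_reindex_bij_betw[OF bij_int_shift[of c], of "\<lambda>n. (cmod (f n))\<^sup>2"]
  by (simp add: l2Z_def)

text \<open>
  Divided by \<open>\<rho>\<^sup>n\<close>, the absolute value of a Bloch solution is periodic.
\<close>

lemma bloch_exponential_bound:
  assumes "bloch N q z r u" "N > 0" "\<rho> > 0" "\<rho> ^ N = cmod r"
  shows "\<exists>B. \<forall>n. cmod (u n) \<le> B * \<rho> powi n"
proof -
  have "\<exists>B. \<forall>n. \<bar>cmod (u n) * \<rho> powi (- n)\<bar> \<le> B"
  proof (rule int_periodic_bounded[of "int N"])
    show "cmod (u (n + int N)) * \<rho> powi (- (n + int N)) = cmod (u n) * \<rho> powi (- n)" for n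
    proof -
      have "\<rho> powi (- (n + int N)) = \<rho> powi (- n) / \<rho> ^ N"
        using assms(3) by (simp add: power_int_diff[of \<rho> "- n" "int N"] power_int_add power_int_minus field_simps)
      moreover have "cmod (u (n + int N)) = \<rho> ^ N * cmod (u n)"
        using assms by (simp add: bloch_def norm_mult)
      ultimately show ?thesis
        using assms(3) by simp
    qed
  qed (use assms in simp)
  then obtain B where B: "\<And>n. cmod (u n) * \<rho> powi (- n) \<le> B"
    using abs_le_D1 by blast
  have "cmod (u n) \<le> B * \<rho> powi n" for n
    using B[of n] assms(3) by (simp add: power_int_minus field_simps)
  then show ?thesis
    by blast
qed

lemma bloch_wronskian:
  assumes "bloch N q z r u" "bloch N q z s v"
  shows "u (n + 1) * v n - u n * v (n + 1) = u 1 * v 0 - u 0 * v 1"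
proof (rule int_periodic_induct[where a = 0 and N = 1 and n = n])
  fix n
  have "u n + u (n + 1 + 1) + of_real (q (n + 1)) * u (n + 1) = z * u (n + 1)"
    using assms(1) by (auto simp: bloch_def dest!: spec[of _ "n + 1"])
  moreover have "v n + v (n + 1 + 1) + of_real (q (n + 1)) * v (n + 1) = z * v (n + 1)"
    using assms(2) by (auto simp: bloch_def dest!: spec[of _ "n + 1"])
  ultimately have "u (n + 1 + 1) * v (n + 1) - u (n + 1) * v (n + 1 + 1) = u (n + 1) * v n - u n * v (n + 1)"
    by algebra
  then show "(u (n + 1 + 1) * v (n + 1) - u (n + 1) * v (n + 1 + 1) = u 1 * v 0 - u 0 * v 1) \<longleftrightarrow>
      (u (n + 1) * v n - u n * v (n + 1) = u 1 * v 0 - u 0 * v 1)"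
    by simp
next
  fix m :: int assume "0 \<le> m" "m < 0 + 1"
  then have "m = 0" by simp
  then show "u (m + 1) * v m - u m * v (m + 1) = u 1 * v 0 - u 0 * v 1"
    by simp
qed simp

text \<open>
  If the Wronskian vanished, the two solutions would be proportional and hence have the same
  multiplier.
\<close>

lemma bloch_independent:
  assumes u: "bloch N q z r u" and v: "bloch N q z s v" and "r \<noteq> s"
  shows "u 1 * v 0 - u 0 * v 1 \<noteq> 0"
proof
  assume W: "u 1 * v 0 - u 0 * v 1 = 0"
  \<comment> \<open>A nonvanishing entry of \<open>v\<close> serves as factor of proportionality.\<close>
  define a b where "a = (if v 0 \<noteq> 0 then v 0 else v 1)" and "b = (if v 0 \<noteq> 0 then u 0 else u 1)"
  define d where "d n = u n * a - v n * b" for n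
  have "d 0 = 0" "d 1 = 0"
    using W by (auto simp: d_def a_def b_def mult.commute)
  have rec: "d (n + 1) = (z - of_real (q n)) * d n - d (n - 1)" for n
  proof -
    have e: "u (n + 1) = (z - of_real (q n)) * u n - u (n - 1)" "v (n + 1) = (z - of_real (q n)) * v n - v (n - 1)"
      using u v by (auto simp: bloch_def algebra_simps dest!: spec[of _ n])
    show ?thesis
      unfolding d_def e by (simp add: algebra_simps)
  qed
  have "d n = 0 \<and> d (n + 1) = 0" for n
  proof (rule int_periodic_induct[where a = 0 and N = 1 and n = n])
    show "(d (n + 1) = 0 \<and> d (n + 1 + 1) = 0) \<longleftrightarrow> (d n = 0 \<and> d (n + 1) = 0)" for n
      using rec[of "n + 1"] by auto
    show "d m = 0 \<and> d (m + 1) = 0" if "0 \<le> m" "m < 0 + 1" for m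
    proof -
      have "m = 0" using that by simp
      then show ?thesis
        using \<open>d 0 = 0\<close> \<open>d 1 = 0\<close> by simp
    qed
  qed simp
  then have d0: "d n = 0" for n
    by blast
  have ab: "u n * a = v n * b" for n
    using d0[of n] by (simp add: d_def)
  have "a \<noteq> 0"
    using v by (auto simp: a_def bloch_def)
  have "r * (v n * b) = s * (v n * b)" for n
    using ab[of n] ab[of "n + int N"] u v by (simp add: bloch_def mult.assoc)
  then have vb: "v n * b = 0" for n
    using \<open>r \<noteq> s\<close> by (metis mult_right_cancel)
  have "u n = 0" for n
    using ab[of n] vb[of n] \<open>a \<noteq> 0\<close> by (metis mult_eq_0_iff)
  then show False
    using u by (simp add: bloch_def)
qed

text \<open>
  Off the unit circle one Bloch solution decays to the right and the other to the left.  Divided by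
  their Wronskian, their product at the larger and the smaller site is the Green function; it decays
  exponentially off the diagonal, so it defines a bounded operator, and it inverts \<open>L - z\<close> on both sides.
\<close>

lemma hyperbolic_in_resolvent_set:
  assumes per: "\<And>n. q (n + int N) = q n" and N: "N > 0"
    and u: "bloch N q z r u" and v: "bloch N q z (inverse r) v" and r: "r \<noteq> 0" "cmod r < 1"
  shows "z \<notin> spec q"
proof -
  \<comment> \<open>The decay rate per site.\<close>
  define \<rho> where "\<rho> = root N (cmod r)"
  have \<rho>: "0 < \<rho>" "\<rho> < 1" "\<rho> ^ N = cmod r"
    using r N by (auto simp: \<rho>_def)
  have "inverse \<rho> > 0" "inverse \<rho> ^ N = cmod (inverse r)"
    using \<rho> by (auto simp: norm_inverse power_inverse)
  then obtain B' where B': "\<And>n. cmod (v n) \<le> B' * inverse \<rho> powi n"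
    using bloch_exponential_bound[OF v N] by blast
  obtain B where B: "\<And>n. cmod (u n) \<le> B * \<rho> powi n"
    using bloch_exponential_bound[OF u N \<rho>(1,3)] by blast
  have "B \<ge> 0" "B' \<ge> 0"
    using order_trans[OF norm_ge_zero B[of 0]] order_trans[OF norm_ge_zero B'[of 0]] by auto
  define W where "W = u 1 * v 0 - u 0 * v 1"
  have "r \<noteq> inverse r"
  proof
    assume "r = inverse r"
    then have "r * r = 1"
      using r(1) by (metis right_inverse)
    then have "cmod r * cmod r = 1"
      by (metis norm_mult norm_one)
    then show False
      using r(2) mult_strict_mono[of "cmod r" 1 "cmod r" 1] by simp
  qed
  then have "W \<noteq> 0"
    using bloch_independent[OF u v] by (simp add: W_def)
  have W: "u (n + 1) * v n - u n * v (n + 1) = W" for n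
    using bloch_wronskian[OF u v] by (simp add: W_def)
  define G where "G n m = u (max n m) * v (min n m) / W" for n m
  define C where "C = B * B' / cmod W"
  interpret exponential_kernel G C \<rho>
  proof
    show "C \<ge> 0"
      using \<open>B \<ge> 0\<close> \<open>B' \<ge> 0\<close> by (simp add: C_def)
    show "cmod (G n m) \<le> C * \<rho> ^ nat \<bar>n - m\<bar>" for n m
    proof -
      have "cmod (G n m) \<le> (B * \<rho> powi max n m) * (B' * inverse \<rho> powi min n m) / cmod W"
        unfolding G_def norm_divide norm_mult
        using B B' \<open>B \<ge> 0\<close> \<rho>(1) by (intro divide_right_mono mult_mono) auto
      also have "\<dots> = C * (\<rho> powi (max n m - min n m))"
        using \<rho>(1) by (simp add: C_def power_int_diff power_int_inverse field_simps)
      also have "max n m - min n m = int (nat \<bar>n - m\<bar>)"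
        by auto
      finally show ?thesis
        by (simp only: power_int_of_nat)
    qed
  qed (use \<rho> in auto)
  have u_rec: "u (n - 1) + u (n + 1) + (of_real (q n) - z) * u n = 0"
    and v_rec: "v (n - 1) + v (n + 1) + (of_real (q n) - z) * v n = 0" for n
    using u v by (auto simp: bloch_def algebra_simps)
  have G_sym: "G n m = G m n" for n m
    by (simp add: G_def max.commute min.commute)
  define g where "g n m = u (max n m) * v (min n m)" for n m
  have g_delta: "g (n - 1) m + g (n + 1) m + (of_real (q n) - z) * g n m = (if n = m then W else 0)" for n m
  proof -
    consider "n < m" | "n > m" | "n = m"
      by linarith
    then show ?thesis
    proof cases
      case 1
      then have "g (n - 1) m + g (n + 1) m + (of_real (q n) - z) * g n m =
          u m * (v (n - 1) + v (n + 1) + (of_real (q n) - z) * v n)"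
        by (simp add: g_def max_def min_def algebra_simps)
      then show ?thesis
        using 1 v_rec by simp
    next
      case 2
      then have "max (n - 1) m = n - 1" "min (n - 1) m = m" "max (n + 1) m = n + 1" "min (n + 1) m = m"
          "max n m = n" "min n m = m"
        by auto
      then have "g (n - 1) m + g (n + 1) m + (of_real (q n) - z) * g n m =
          v m * (u (n - 1) + u (n + 1) + (of_real (q n) - z) * u n)"
        unfolding g_def by (simp add: algebra_simps)
      then show ?thesis
        using 2 u_rec by simp
    next
      case 3
      have D: "u (n + 1) * v n = W + u n * v (n + 1)"
        using W[of n] by (simp add: diff_eq_eq)
      have "u n * v (n - 1) + u (n + 1) * v n + (of_real (q n) - z) * (u n * v n)
          = W + u n * (v (n - 1) + v (n + 1) + (of_real (q n) - z) * v n)"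
        unfolding D by (simp add: algebra_simps)
      then show ?thesis
        using 3 v_rec by (simp add: g_def max_def min_def)
    qed
  qed
  \<comment> \<open>The kernel is a Green function in either argument, being symmetric.\<close>
  have G_delta: "G (n - 1) m + G (n + 1) m + (of_real (q n) - z) * G n m = (if n = m then 1 else 0)" for n m
  proof -
    have "G (n - 1) m + G (n + 1) m + (of_real (q n) - z) * G n m
        = (g (n - 1) m + g (n + 1) m + (of_real (q n) - z) * g n m) / W"
      by (simp add: G_def g_def add_divide_distrib)
    then show ?thesis
      using g_delta[of n m] \<open>W \<noteq> 0\<close> by simp
  qed
  define T where "T y = (\<lambda>n. schroedinger q y n - z * y n)" for y
  have T: "T y n = y (n - 1) + y (n + 1) + (of_real (q n) - z) * y n" for y n
    by (simp add: T_def schroedinger_def algebra_simps)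
  obtain Q where Q: "\<And>n. \<bar>q n\<bar> \<le> Q"
    using int_periodic_bounded[of "int N" q] per N by auto
  have T_l2Z: "T y \<in> l2Z" if "y \<in> l2Z" for y
  proof -
    have "cmod (of_real (q n) - z) \<le> Q + cmod z" for n
      using norm_triangle_ineq4[of "of_real (q n)" z] Q[of n] by simp
    then have "(\<lambda>n. y (n + (-1)) + y (n + 1) + (of_real (q n) - z) * y n) \<in> l2Z"
      using that by (intro l2Z_add l2Z_shift l2Z_mult_bounded)
    then show ?thesis
      by (simp add: T[abs_def])
  qed
  have delta: "(\<Sum>\<^sub>\<infinity>m. (if n = m then 1 else 0) * f m) = f n" for f :: "int \<Rightarrow> complex" and n
    by (rule infsumI, rule has_sum_finite_neutralI[where B = "{n}"]) auto
  have GT: "apply_kernel (T y) = y" if y: "y \<in> l2Z" for y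
  proof
    fix n
    have s: "(\<lambda>m. G n m * y (m + c)) summable_on UNIV" for c
      using kernel_summable[OF l2Z_shift[OF y]] by simp
    have bij: "bij_betw (\<lambda>m::int. m + c) UNIV UNIV" for c
      using bij_int_shift[of c] by simp
    have s': "(\<lambda>m. G n (m - c) * y m) summable_on UNIV" and e: "(\<Sum>\<^sub>\<infinity>m. G n m * y (m + c)) = (\<Sum>\<^sub>\<infinity>m. G n (m - c) * y m)" for c
      using summable_on_reindex_bij_betw[OF bij[of c], of "\<lambda>m. G n (m - c) * y m"] s[of c]
        infsum_reindex_bij_betw[OF bij[of c], of "\<lambda>m. G n (m - c) * y m"] by simp_all
    have s2: "(\<lambda>m. G n m * ((of_real (q m) - z) * y m)) summable_on UNIV"
    proof -
      have "cmod (of_real (q n) - z) \<le> Q + cmod z" for n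
        using norm_triangle_ineq4[of "of_real (q n)" z] Q[of n] by simp
      then show ?thesis
        by (intro kernel_summable l2Z_mult_bounded[OF y])
    qed
    have "apply_kernel (T y) n = (\<Sum>\<^sub>\<infinity>m. (G n m * y (m + (-1)) + G n m * y (m + 1)) + G n m * ((of_real (q m) - z) * y m))"
      by (simp add: apply_kernel_def T algebra_simps)
    also have "\<dots> = (\<Sum>\<^sub>\<infinity>m. G n m * y (m + (-1))) + (\<Sum>\<^sub>\<infinity>m. G n m * y (m + 1)) + (\<Sum>\<^sub>\<infinity>m. G n m * ((of_real (q m) - z) * y m))"
      by (subst infsum_add) (intro summable_on_add s s2 infsum_add arg_cong2[where f = "(+)"] refl)+
    also have "\<dots> = (\<Sum>\<^sub>\<infinity>m. G n (m - (-1)) * y m) + (\<Sum>\<^sub>\<infinity>m. G n (m - 1) * y m) + (\<Sum>\<^sub>\<infinity>m. G n m * ((of_real (q m) - z) * y m))"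
      unfolding e ..
    also have "\<dots> = (\<Sum>\<^sub>\<infinity>m. (G n (m - (-1)) * y m + G n (m - 1) * y m) + G n m * ((of_real (q m) - z) * y m))"
      by (subst infsum_add) (intro summable_on_add s' s2 infsum_add[symmetric] arg_cong2[where f = "(+)"] refl)+
    also have "\<dots> = (\<Sum>\<^sub>\<infinity>m. (G (m - 1) n + G (m + 1) n + (of_real (q m) - z) * G m n) * y m)"
      by (intro infsum_cong) (simp add: G_sym[of n] algebra_simps)
    also have "\<dots> = (\<Sum>\<^sub>\<infinity>m. (if n = m then 1 else 0) * y m)"
      unfolding G_delta by (intro infsum_cong) auto
    also have "\<dots> = y n"
      by (rule delta)
    finally show "apply_kernel (T y) n = y n" .
  qed
  have TG: "T (apply_kernel f) = f" if f: "f \<in> l2Z" for f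
  proof
    fix n
    note s = kernel_summable[OF f]
    have "T (apply_kernel f) n = (\<Sum>\<^sub>\<infinity>m. G (n - 1) m * f m) + (\<Sum>\<^sub>\<infinity>m. G (n + 1) m * f m) + (\<Sum>\<^sub>\<infinity>m. (of_real (q n) - z) * (G n m * f m))"
      unfolding T apply_kernel_def by (subst infsum_cmult_right) (use s in auto)
    also have "\<dots> = (\<Sum>\<^sub>\<infinity>m. (G (n - 1) m * f m + G (n + 1) m * f m) + (of_real (q n) - z) * (G n m * f m))"
      by (subst infsum_add) (intro summable_on_add s summable_on_cmult_right infsum_add[symmetric] arg_cong2[where f = "(+)"] refl)+
    also have "\<dots> = (\<Sum>\<^sub>\<infinity>m. (G (n - 1) m + G (n + 1) m + (of_real (q n) - z) * G n m) * f m)"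
      by (intro infsum_cong) (simp add: algebra_simps)
    also have "\<dots> = f n"
      unfolding G_delta by (rule delta)
    finally show "T (apply_kernel f) n = f n" .
  qed
  have "bij_betw T l2Z l2Z"
    by (rule bij_betw_byWitness[where f' = apply_kernel]) (use GT TG T_l2Z apply_kernel_l2Z(1) in auto)
  moreover have "l2Z_norm y \<le> (C * (2 / (1 - \<rho>))) * l2Z_norm (T y)" if "y \<in> l2Z" for y
    using apply_kernel_l2Z(2)[OF T_l2Z[OF that]] GT[OF that] by simp
  ultimately have "z \<in> resolvent_set (schroedinger q)"
    unfolding resolvent_set_def T_def by blast
  then show ?thesis
    by (simp add: spec_def op_spectrum_def)
qed

text \<open>
  The spectrum consists of the points at which the monodromy matrix has an eigenvalue of modulus 1.
\<close>

lemma periodic_spectrum: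
  assumes per: "\<And>n. q (n + int (2 * k)) = q n" and k: "k \<ge> 1"
  shows "spec q = complex_of_real ` bands (lyapunov k q)"
proof (intro equalityI subsetI)
  fix z assume z: "z \<in> spec q"
  obtain r where r: "r \<noteq> 0" "cmod r \<le> 1" "r\<^sup>2 - discriminant (2 * k) q z * r + 1 = 0"
    "(inverse r)\<^sup>2 - discriminant (2 * k) q z * inverse r + 1 = 0"
    using exists_multipliers by blast
  have N: "2 * k \<ge> 2" "2 * k > 0"
    using k by auto
  obtain u v where u: "bloch (2 * k) q z r u" and v: "bloch (2 * k) q z (inverse r) v"
    using exists_bloch[OF N(1) per r(1,3)] exists_bloch[OF N(1) per _ r(4)] r(1) by auto
  have "cmod r = 1"
    using hyperbolic_in_resolvent_set[OF per N(2) u v r(1)] z r(2) by force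
  then obtain x where "z = of_real x"
    using bloch_unit_multiplier_real[OF u N(1)] by (auto elim: Reals_cases)
  moreover obtain d where "discriminant (2 * k) q z = of_real d" "\<bar>d\<bar> \<le> 2"
    using cmod_one_discriminant[OF r(3)] \<open>cmod r = 1\<close> by blast
  ultimately show "z \<in> complex_of_real ` bands (lyapunov k q)"
    by (auto simp: discriminant_of_real bands_def)
next
  fix z assume "z \<in> complex_of_real ` bands (lyapunov k q)"
  then obtain x where x: "z = of_real x" "\<bar>poly (lyapunov k q) x\<bar> \<le> 2"
    by (auto simp: bands_def)
  have N: "2 * k \<ge> 2"
    using k by auto
  obtain r where r: "r \<noteq> 0" "cmod r \<le> 1" "r\<^sup>2 - discriminant (2 * k) q z * r + 1 = 0"
    using exists_multipliers by blast
  then have "cmod r = 1"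
    using discriminant_interval_multiplier x by (auto simp: discriminant_of_real)
  obtain u where "bloch (2 * k) q z r u"
    using exists_bloch[OF N per r(1,3)] by blast
  then show "z \<in> spec q"
    using \<open>cmod r = 1\<close> per by (intro unit_multiplier_in_spectrum[OF _ N])
qed

section \<open>Symmetry and coefficients for odd potentials\<close>

text \<open>
  The values of a solution on an initial segment, stated for any sequence satisfying the recursion
  there, so that it applies to reversed and reflected solutions.
\<close>

lemma solution_superposition:
  fixes y :: "nat \<Rightarrow> real"
  assumes "\<And>n. Suc (Suc n) \<le> M \<Longrightarrow> y (Suc (Suc n)) = (x - q (int (Suc n))) * y (Suc n) - y n" "n \<le> M"
  shows "y n = y 0 * poly (solution q 1 0 n) x + y 1 * poly (solution q 0 1 n) x"
  using assms(2)
proof (induction n rule: induct_nat_012)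
  case (ge2 n)
  have IH: "y (Suc n) = y 0 * poly (solution q 1 0 (Suc n)) x + y 1 * poly (solution q 0 1 (Suc n)) x"
    "y n = y 0 * poly (solution q 1 0 n) x + y 1 * poly (solution q 0 1 n) x"
    using ge2 by simp_all
  show ?case
    unfolding assms(1)[OF ge2.prems] IH by (simp add: solution.simps(3) algebra_simps)
qed auto

text \<open>
  Reading the solutions of the given equation backwards gives solutions of the reversed equation.
  Since the monodromy matrix has determinant 1, reversing keeps both diagonal entries and with them the
  trace.
\<close>

lemma lyapunov_reflection:
  assumes "k \<ge> 1" "\<And>j. j \<in> {1..2 * int k} \<Longrightarrow> q' j = q (2 * int k + 1 - j)"
  shows "poly (lyapunov k q') x = poly (lyapunov k q) x"
proof -
  define M where "M = 2 * k + 1"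
  define f where "f a b n = poly (solution q a b n) x" for a b n
  define f' where "f' a b n = poly (solution q' a b n) x" for a b n
  have rec: "f a b (M - Suc (Suc n)) = (x - q' (int (Suc n))) * f a b (M - Suc n) - f a b (M - n)"
    if n: "Suc (Suc n) \<le> M" for a b n
  proof -
    obtain m where m: "M - n = Suc (Suc m)" "M - Suc n = Suc m" "M - Suc (Suc n) = m"
      by (rule that[of "M - Suc (Suc n)"]) (use n in auto)
    have "q' (int (Suc n)) = q (2 * int k + 1 - int (Suc n))"
      using n by (intro assms(2)) (auto simp: M_def)
    also have "2 * int k + 1 - int (Suc n) = int (Suc m)"
      using m(2) n by (simp add: M_def)
    finally show ?thesis
      unfolding m by (simp add: f_def solution.simps(3) algebra_simps)
  qed
  \<comment> \<open>A reversed solution expressed by the fundamental solutions of the reversed equation; its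
    initial values are the values of the given solution at the right end.\<close>
  have sup: "f a b (M - n) = f a b M * f' 1 0 n + f a b (M - 1) * f' 0 1 n" if "n \<le> M" for a b n
    using solution_superposition[of M "\<lambda>n. f a b (M - n)" x q' n] rec[of _ a b] that by (simp add: f'_def)
  have W: "f 0 1 M * f 1 0 (M - 1) - f 0 1 (M - 1) * f 1 0 M = 1"
    using wronskian_phi_theta[of q "2 * k" x] by (simp add: f_def M_def)
  have M1: "M - (M - 1) = 1" "M - 1 \<le> M"
    by (auto simp: M_def)
  have "f 0 1 M * f' 1 0 M + f 0 1 (M - 1) * f' 0 1 M = 0" "f 1 0 M * f' 1 0 M + f 1 0 (M - 1) * f' 0 1 M = 1"
    using sup[of M 0 1] sup[of M 1 0] by (simp_all add: f_def)
  then have "f' 0 1 M * (f 0 1 M * f 1 0 (M - 1) - f 0 1 (M - 1) * f 1 0 M) = f 0 1 M"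
    by algebra
  moreover have "f 0 1 M * f' 1 0 (M - 1) + f 0 1 (M - 1) * f' 0 1 (M - 1) = 1"
    "f 1 0 M * f' 1 0 (M - 1) + f 1 0 (M - 1) * f' 0 1 (M - 1) = 0"
    using sup[of "M - 1" 0 1] sup[of "M - 1" 1 0] unfolding M1 by (simp_all add: f_def)
  then have "f' 1 0 (M - 1) * (f 0 1 M * f 1 0 (M - 1) - f 0 1 (M - 1) * f 1 0 M) = f 1 0 (M - 1)"
    by algebra
  ultimately have "f' 0 1 M + f' 1 0 (M - 1) = f 0 1 M + f 1 0 (M - 1)"
    using W by simp
  then show ?thesis
    by (simp add: lyapunov_def f_def f'_def M_def)
qed

lemma solution_minus:
  "poly (solution q 0 1 n) (- x) = (-1) ^ Suc n * poly (solution (\<lambda>j. - q j) 0 1 n) x"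
  "poly (solution q 1 0 n) (- x) = (-1) ^ n * poly (solution (\<lambda>j. - q j) 1 0 n) x"
proof -
  have "poly (solution q a b n) (- x) = (-1) ^ n * poly (solution (\<lambda>j. - q j) a (- b) n) x" for a b
    by (induction q a b n rule: solution.induct) (auto simp: solution.simps(3) algebra_simps)
  moreover have "poly (solution (\<lambda>j. - q j) 0 (- 1) n) x = - poly (solution (\<lambda>j. - q j) 0 1 n) x"
    using solution_superposition[of n "\<lambda>n. poly (solution (\<lambda>j. - q j) 0 (- 1) n) x" x "\<lambda>j. - q j" n]
    by (simp add: solution.simps(3) algebra_simps)
  ultimately show "poly (solution q 0 1 n) (- x) = (-1) ^ Suc n * poly (solution (\<lambda>j. - q j) 0 1 n) x"
    "poly (solution q 1 0 n) (- x) = (-1) ^ n * poly (solution (\<lambda>j. - q j) 1 0 n) x"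
    by auto
qed

lemma Qodd_reflect:
  assumes "q \<in> Qodd k" "j \<in> {1..2 * int k}"
  shows "q (2 * int k + 1 - j) = - q j"
proof (cases "j = 2 * int k")
  case True
  have "\<forall>n\<in>{1..2 * int k - 1}. q (2 * int k + 1 - n) = - q n"
    using assms(1) by (simp add: Qodd_def)
  moreover have "1 \<in> {1..2 * int k - 1}"
  proof -
    have "int k \<ge> 1"
      using assms(2) by auto
    then show ?thesis
      by simp
  qed
  ultimately have "q (2 * int k + 1 - 1) = - q 1"
    by blast
  then show ?thesis
    using True by simp
next
  case False
  then show ?thesis
    using assms by (auto simp: Qodd_def)
qed

text \<open>
  The sign change \<open>y\<^sub>n \<mapsto> (-1)\<^sup>n y\<^sub>n\<close> turns \<open>\<lambda>, q\<close> into \<open>-\<lambda>, -q\<close>, and for an odd potential \<open>-q\<close> is the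
  reversal of \<open>q\<close>.
\<close>

lemma lyapunov_even:
  assumes "q \<in> Qodd k" "k \<ge> 1"
  shows "poly (lyapunov k q) (- x) = poly (lyapunov k q) x"
proof -
  have "poly (lyapunov k q) (- x) = poly (lyapunov k (\<lambda>j. - q j)) x"
    by (simp add: lyapunov_def solution_minus)
  also have "\<dots> = poly (lyapunov k q) x"
    using Qodd_reflect[OF assms(1)] assms(2) by (intro lyapunov_reflection) auto
  finally show ?thesis .
qed

lemma Qodd_sum_zero:
  assumes "q \<in> Qodd k" "k \<ge> 1"
  shows "(\<Sum>j=1..2 * k. q (int j)) = 0"
proof -
  have "(\<Sum>j=1..2 * k. q (int j)) = (\<Sum>j=1..2 * k. q (int (2 * k + 1 - j)))"
    by (rule sum.reindex_bij_witness[of _ "\<lambda>j. 2 * k + 1 - j" "\<lambda>j. 2 * k + 1 - j"]) auto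
  also have "\<dots> = (\<Sum>j=1..2 * k. - q (int j))"
  proof (rule sum.cong)
    fix j assume "j \<in> {1..2 * k}"
    then show "q (int (2 * k + 1 - j)) = - q (int j)"
      using Qodd_reflect[OF assms(1), of "int j"] by (simp add: of_nat_diff algebra_simps)
  qed simp
  finally show ?thesis
    by (simp add: sum_negf)
qed

lemma lyapunov_odd_coeff:
  assumes "q \<in> Qodd k" "k \<ge> 1" "odd i"
  shows "coeff (lyapunov k q) i = 0"
proof -
  have "lyapunov k q \<circ>\<^sub>p [:0, -1:] = lyapunov k q"
    using lyapunov_even[OF assms(1,2)] by (intro poly_eqI_degree[where A = UNIV] poly_ext) (auto simp: poly_pcompose)
  then have "coeff (lyapunov k q) i = (-1) ^ i * coeff (lyapunov k q) i"
    by (metis coeff_pcompose_linear)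
  then show ?thesis
    using assms(3) by simp
qed

lemma lyapunov_expansion:
  assumes "q \<in> Qodd CARD('k::{finite,linorder})"
  shows "poly (lyapunov CARD('k) q) x =
    x ^ (2 * CARD('k)) + (\<Sum>i\<in>UNIV. (Phi_map q :: real ^ 'k::{finite,linorder}) $ i * x ^ (2 * CARD('k) - 2 * idx i))"
proof -
  define k where "k = CARD('k)"
  define D where "D = lyapunov k q"
  have k: "k \<ge> 1"
    by (simp add: k_def Suc_le_eq)
  have D: "degree D = 2 * k" "coeff D (2 * k) = 1"
    using monic_lyapunov[OF k] by (auto simp: D_def monic_of_degree_def)
  have "poly D x = (\<Sum>j\<in>{..2 * k}. coeff D j * x ^ j)"
    by (simp add: poly_altdef D)
  also have "\<dots> = (\<Sum>j\<in>(\<lambda>i. 2 * k - 2 * i) ` {0..k}. coeff D j * x ^ j)"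
  proof (rule sum.mono_neutral_right)
    show "\<forall>j\<in>{..2 * k} - (\<lambda>i. 2 * k - 2 * i) ` {0..k}. coeff D j * x ^ j = 0"
    proof
      fix j assume j: "j \<in> {..2 * k} - (\<lambda>i. 2 * k - 2 * i) ` {0..k}"
      have "odd j"
      proof
        assume "even j"
        then obtain m where "j = 2 * m" by blast
        then have "j = 2 * k - 2 * (k - m)" "k - m \<in> {0..k}"
          using j by auto
        then show False
          using j by blast
      qed
      then show "coeff D j * x ^ j = 0"
        using lyapunov_odd_coeff assms k by (simp add: D_def k_def)
    qed
  qed auto
  also have "\<dots> = (\<Sum>i\<in>{0..k}. coeff D (2 * k - 2 * i) * x ^ (2 * k - 2 * i))"
    by (subst sum.reindex) (auto simp: inj_on_def)
  also have "{0..k} = insert 0 {1..k}"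
    by auto
  also have "(\<Sum>i\<in>insert 0 {1..k}. coeff D (2 * k - 2 * i) * x ^ (2 * k - 2 * i))
      = x ^ (2 * k) + (\<Sum>i\<in>{1..k}. coeff D (2 * k - 2 * i) * x ^ (2 * k - 2 * i))"
    using D by simp
  also have "(\<Sum>i\<in>{1..k}. coeff D (2 * k - 2 * i) * x ^ (2 * k - 2 * i))
      = (\<Sum>i\<in>(UNIV :: 'k set). coeff D (2 * k - 2 * idx i) * x ^ (2 * k - 2 * idx i))"
    using sum.reindex_bij_betw[OF bij_betw_idx[where 'k = 'k], of "\<lambda>i. coeff D (2 * k - 2 * i) * x ^ (2 * k - 2 * i)"]
    by (simp add: k_def)
  finally show ?thesis
    by (simp add: D_def k_def Phi_map_def)
qed

lemma lyapunov_eq_iff_Phi_eq: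
  assumes "p \<in> Qodd CARD('k::{finite,linorder})" "q \<in> Qodd CARD('k::{finite,linorder})"
  shows "lyapunov CARD('k) p = lyapunov CARD('k) q \<longleftrightarrow> (Phi_map p :: real ^ 'k::{finite,linorder}) = Phi_map q"
proof
  assume "(Phi_map p :: real ^ 'k::{finite,linorder}) = Phi_map q"
  then show "lyapunov CARD('k) p = lyapunov CARD('k) q"
    by (intro poly_ext) (simp add: lyapunov_expansion[OF assms(1)] lyapunov_expansion[OF assms(2)])
qed (simp add: Phi_map_def)

section \<open>The spectrum determines the Lyapunov polynomial\<close>

text \<open>
  The left-hand side is the coefficient of \<open>x\<^sup>n\<close> in the Lagrange interpolation polynomial of \<open>D\<close> at the
  \<open>n + 1\<close> nodes, and a polynomial of degree less than \<open>n\<close> is its own interpolation polynomial.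
\<close>

lemma divided_difference_zero:
  fixes D :: "real poly"
  assumes "degree D < n \<or> D = 0" "inj_on e {..n}"
  shows "(\<Sum>i\<le>n. poly D (e i) / (\<Prod>j\<in>{..n} - {i}. e i - e j)) = 0"
proof -
  define w where "w i = (\<Prod>j\<in>{..n} - {i}. e i - e j)" for i
  define B where "B i = (\<Prod>j\<in>{..n} - {i}. [:- e j, 1:])" for i
  have w: "w i \<noteq> 0" if "i \<le> n" for i
    using assms(2) that by (auto simp: w_def inj_on_def)
  have B_poly: "poly (B i) x = (\<Prod>j\<in>{..n} - {i}. x - e j)" for i x
    by (simp add: B_def poly_prod algebra_simps)
  have B_deg: "degree (B i) = n" if "i \<le> n" for i
    unfolding B_def by (subst degree_prod_eq_sum_degree) (use that in auto)
  have B_lead: "coeff (B i) n = 1" if "i \<le> n" for i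
    using B_deg[OF that] lead_coeff_prod[of "\<lambda>j. [:- e j, 1:]" "{..n} - {i}"] by (simp add: B_def)
  define L where "L = (\<Sum>i\<le>n. smult (poly D (e i) / w i) (B i))"
  have "D = L"
  proof (rule poly_eqI_degree)
    fix x assume "x \<in> e ` {..n}"
    then obtain m where m: "m \<le> n" "x = e m"
      by auto
    have "poly L x = (\<Sum>i\<le>n. poly D (e i) / w i * poly (B i) (e m))"
      by (simp add: L_def poly_sum m)
    also have "\<dots> = (\<Sum>i\<in>{m}. poly D (e i) / w i * poly (B i) (e m))"
    proof (rule sum.mono_neutral_right)
      show "\<forall>i\<in>{..n} - {m}. poly D (e i) / w i * poly (B i) (e m) = 0"
      proof
        fix i assume "i \<in> {..n} - {m}"
        then have "poly (B i) (e m) = 0"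
          unfolding B_poly using m by (intro prod_zero) auto
        then show "poly D (e i) / w i * poly (B i) (e m) = 0"
          by simp
      qed
    qed (use m in auto)
    also have "\<dots> = poly D x"
      using w[OF m(1)] by (simp add: B_poly w_def m)
    finally show "poly D x = poly L x" ..
  next
    have "card (e ` {..n}) = Suc n"
      by (simp add: card_image assms(2))
    moreover have "degree L \<le> n"
      unfolding L_def by (intro degree_sum_le) (auto intro: order_trans[OF degree_smult_le] simp: B_deg)
    ultimately show "degree D < card (e ` {..n})" "degree L < card (e ` {..n})"
      using assms(1) by auto
  qed
  have "coeff L n = (\<Sum>i\<le>n. poly D (e i) / w i)"
    using B_lead by (simp add: L_def coeff_sum)
  moreover have "coeff D n = 0"
    using assms(1) by (auto simp: coeff_eq_0)
  ultimately show ?thesis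
    using \<open>D = L\<close> by (simp add: w_def)
qed

text \<open>
  The weights in the divided difference alternate in sign, so for weakly alternating values all its
  terms have the same sign.  As they add up to zero, \<open>D\<close> vanishes at all nodes.  Weak inequalities are
  essential here: counting sign changes would need multiplicities.
\<close>

lemma weakly_alternating_zero:
  fixes D :: "real poly"
  assumes "degree D < n \<or> D = 0" "\<And>i. i < n \<Longrightarrow> e i < e (Suc i)"
    "\<And>i. i \<le> n \<Longrightarrow> (-1) ^ (n - i) * poly D (e i) \<ge> 0"
  shows "D = 0"
proof -
  have e_less: "e i < e j" if "i < j" "j \<le> n" for i j
    using assms(2) that by (intro chain_less[of 0 n e i j]) auto
  have inj: "inj_on e {..n}"
    using chain_inj_on[of 0 n e] assms(2) by (simp add: atMost_atLeast0)
  define w where "w i = (\<Prod>j\<in>{..n} - {i}. e i - e j)" for i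
  have w_sign: "(-1) ^ (n - i) * w i > 0" if i: "i \<le> n" for i
  proof -
    have split: "{..n} - {i} = {..<i} \<union> {i<..n}"
      using i by auto
    have "w i = (\<Prod>j\<in>{..<i}. e i - e j) * (\<Prod>j\<in>{i<..n}. - (e j - e i))"
      unfolding w_def split by (subst prod.union_disjoint) auto
    also have "(\<Prod>j\<in>{i<..n}. - (e j - e i)) = (-1) ^ (n - i) * (\<Prod>j\<in>{i<..n}. e j - e i)"
      by (subst prod_uminus) simp
    finally have "(-1) ^ (n - i) * w i = (\<Prod>j\<in>{..<i}. e i - e j) * (\<Prod>j\<in>{i<..n}. e j - e i)"
      by simp
    also have "\<dots> > 0"
      using e_less i by (intro mult_pos_pos prod_pos) auto
    finally show ?thesis .
  qed
  have quotient_eq: "poly D (e i) / w i = ((-1) ^ (n - i) * poly D (e i)) / ((-1) ^ (n - i) * w i)" for i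
    by simp
  have nonneg: "poly D (e i) / w i \<ge> 0" if "i \<in> {..n}" for i
    unfolding quotient_eq using assms(3)[of i] w_sign[of i] that by (intro divide_nonneg_pos) auto
  have "(\<Sum>i\<le>n. poly D (e i) / w i) = 0"
    unfolding w_def by (rule divided_difference_zero[OF assms(1) inj])
  then have "poly D (e i) / w i = 0" if "i \<le> n" for i
    using nonneg that by (subst (asm) sum_nonneg_eq_0_iff) auto
  then have "poly D (e i) = 0" if "i \<le> n" for i
    using w_sign[OF that] that by fastforce
  then show "D = 0"
    using assms(1) inj by (intro poly_eqI_degree[where A = "e ` {..n}"]) (auto simp: card_image)
qed

text \<open>
  Chebyshev's extremality argument.  Both polynomials are bounded by 2 on the common set, and \<open>P\<close> attains
  \<open>\<plusminus>2\<close> with alternating signs at \<open>n + 1\<close> points of it.  So \<open>P - Q\<close>, whose degree is less than \<open>n\<close>,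
  alternates weakly at these points.
\<close>

lemma monic_eq_of_bands_eq:
  assumes P: "monic_of_degree n P" "ladder P n c" and Q: "monic_of_degree n Q" and n: "n \<ge> 1"
    and "bands P = bands Q"
  shows "P = Q"
proof -
  obtain lm lp where e:
    "\<And>i. i < n \<Longrightarrow> c i \<le> lp i \<and> lp i < lm (Suc i) \<and> lm (Suc i) \<le> c (Suc i)"
    "\<And>i. i < n \<Longrightarrow> (-1) ^ (n - Suc i) * poly P (lm (Suc i)) = 2"
    "\<And>i. i < n \<Longrightarrow> (-1) ^ (n - Suc i) * poly P (lp i) = - 2"
    using ladder_edges[OF P(2)] by metis
  \<comment> \<open>One edge of each band, and both edges of the lowest one.\<close>
  define y where "y i = (if i = 0 then lp 0 else lm i)" for i
  have val: "(-1) ^ (n - i) * poly P (y i) = 2" if "i \<le> n" for i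
  proof (cases i)
    case 0
    then show ?thesis
      using e(3)[of 0] minus_one_power_diff_Suc[of 0 n] n by (simp add: y_def)
  next
    case (Suc j)
    then show ?thesis
      using e(2)[of j] that by (simp add: y_def)
  qed
  have "P - Q = 0"
  proof (rule weakly_alternating_zero[where n = n and e = y])
    show "degree (P - Q) < n \<or> P - Q = 0"
    proof -
      have "degree (P - Q) \<le> n" "coeff (P - Q) n = 0"
        using P(1) Q by (auto simp: monic_of_degree_def intro!: degree_diff_le)
      then show ?thesis
        using n by (metis leading_coeff_0_iff le_neq_implies_less)
    qed
    show "y i < y (Suc i)" if "i < n" for i
    proof (cases "i = 0")
      case True
      then show ?thesis
        using e(1)[of 0] n by (simp add: y_def)
    next
      case False
      then have "lm i \<le> c i"
        using e(1)[of "i - 1"] that by simp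
      then show ?thesis
        using e(1)[of i] that False by (simp add: y_def)
    qed
    show "(-1) ^ (n - i) * poly (P - Q) (y i) \<ge> 0" if "i \<le> n" for i
    proof -
      have "\<bar>poly P (y i)\<bar> = 2"
        using arg_cong[OF val[OF that], of abs] by (simp add: abs_minus_one_power_mult)
      then have "y i \<in> bands P"
        by (simp add: bands_def)
      then have "y i \<in> bands Q"
        using assms(5) by simp
      then have "\<bar>(-1) ^ (n - i) * poly Q (y i)\<bar> \<le> 2"
        by (simp add: bands_def abs_minus_one_power_mult)
      then show ?thesis
        using val[OF that] by (simp add: right_diff_distrib)
    qed
  qed
  then show ?thesis
    by simp
qed

lemma Qodd_periodic: "q \<in> Qodd k \<Longrightarrow> q (n + int (2 * k)) = q n"
  by (simp add: Qodd_def)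

lemma Qodd_spectrum: "q \<in> Qodd k \<Longrightarrow> k \<ge> 1 \<Longrightarrow> spec q = complex_of_real ` bands (lyapunov k q)"
  by (intro periodic_spectrum Qodd_periodic)

lemma lyapunov_ladder: "k \<ge> 1 \<Longrightarrow> \<exists>c. ladder (lyapunov k q) (2 * k) c"
  using lyapunov_alternates exists_ladder[OF monic_lyapunov] by fastforce

lemma spec_eq_iff:
  assumes "p \<in> Qodd k" "q \<in> Qodd k" "k \<ge> 1"
  shows "spec p = spec q \<longleftrightarrow> lyapunov k p = lyapunov k q"
proof
  assume "spec p = spec q"
  then have "bands (lyapunov k p) = bands (lyapunov k q)"
    using assms by (simp add: Qodd_spectrum inj_image_eq_iff[OF inj_of_real])
  moreover obtain c where "ladder (lyapunov k p) (2 * k) c"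
    using lyapunov_ladder[OF assms(3)] by blast
  ultimately show "lyapunov k p = lyapunov k q"
    using assms(3) by (intro monic_eq_of_bands_eq[where n = "2 * k"] monic_lyapunov) auto
qed (use assms in \<open>simp add: Qodd_spectrum\<close>)

lemma phi_top_coeffs:
  "coeff (solution q 0 1 (Suc (Suc n))) n = - (\<Sum>j=1..Suc n. q (int j))"
  "coeff (solution q 0 1 (Suc (Suc (Suc n)))) n =
     ((\<Sum>j=1..Suc (Suc n). q (int j))\<^sup>2 - (\<Sum>j=1..Suc (Suc n). (q (int j))\<^sup>2)) / 2 - real (Suc n)"
proof -
  have lead: "coeff (solution q 0 1 (Suc n)) n = 1" for n
    using monic_phi[of n q] by (simp add: monic_of_degree_def)
  have above: "coeff (solution q 0 1 (Suc n)) i = 0" if "i > n" for n i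
    using monic_phi[of n q] that by (simp add: monic_of_degree_def coeff_eq_0)
  have sub: "coeff (solution q 0 1 (Suc (Suc n))) n = - (\<Sum>j=1..Suc n. q (int j))" for n
  proof (induction n)
    case 0
    show ?case by (simp add: solution.simps(3))
  next
    case (Suc n)
    show ?case
      using Suc lead[of "Suc n"] above[of n "Suc n"] by (simp add: solution.simps(3)[of _ _ _ "Suc n"])
  qed
  then show "coeff (solution q 0 1 (Suc (Suc n))) n = - (\<Sum>j=1..Suc n. q (int j))" .
  show "coeff (solution q 0 1 (Suc (Suc (Suc n)))) n =
     ((\<Sum>j=1..Suc (Suc n). q (int j))\<^sup>2 - (\<Sum>j=1..Suc (Suc n). (q (int j))\<^sup>2)) / 2 - real (Suc n)"
  proof (induction n)
    case 0
    show ?case by (simp add: solution.simps(3) power2_eq_square algebra_simps)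
  next
    case (Suc n)
    define s where "s = (\<Sum>j=1..Suc (Suc n). q (int j))"
    have "coeff (solution q 0 1 (Suc (Suc (Suc (Suc n))))) (Suc n) =
        coeff (solution q 0 1 (Suc (Suc (Suc n)))) n - q (int (Suc (Suc (Suc n)))) * coeff (solution q 0 1 (Suc (Suc (Suc n)))) (Suc n) - 1"
      using lead[of "Suc n"] by (simp add: solution.simps(3)[of _ _ _ "Suc (Suc n)"])
    also have "coeff (solution q 0 1 (Suc (Suc (Suc n)))) (Suc n) = - s"
      unfolding s_def by (rule sub)
    finally show ?case
      unfolding Suc sum.cl_ivl_Suc[of _ _ "Suc (Suc n)"] s_def[symmetric]
      by (simp add: power2_eq_square field_simps)
  qed
qed

text \<open>
  The sum of the squares of the potential is an isospectral invariant.  This is what confines an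
  isospectral set to a sphere.
\<close>

lemma lyapunov_second_coeff:
  assumes "q \<in> Qodd k" "k \<ge> 1"
  shows "coeff (lyapunov k q) (2 * k - 2) = - 2 * real k - (\<Sum>j=1..2 * k. (q (int j))\<^sup>2) / 2"
proof -
  obtain n where n: "2 * k = Suc (Suc n)"
    by (rule that[of "2 * k - 2"]) (use assms in simp)
  have "coeff (solution q 1 0 (2 * k)) n = - 1"
    using monic_phi[of n "\<lambda>i. q (i + 1)"] unfolding n theta_eq_shifted_phi by (simp add: monic_of_degree_def)
  moreover have "coeff (solution q 0 1 (2 * k + 1)) n = - (\<Sum>j=1..2 * k. (q (int j))\<^sup>2) / 2 - real (Suc n)"
    using phi_top_coeffs(2)[of q n] Qodd_sum_zero[OF assms] unfolding n Suc_eq_plus1[symmetric] by simp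
  moreover have "real k = (real n + 2) / 2"
    using arg_cong[OF n, of real] by simp
  ultimately show ?thesis
    using n by (simp add: lyapunov_def field_simps)
qed

section \<open>Derivatives of the gap heights\<close>

lemma bounded_linear_of_coords: "bounded_linear (\<lambda>x :: real ^ 'k::{finite,linorder}. of_coords x n)"
  unfolding of_coords_def Let_def
  by (cases "(n - 1) mod (2 * int CARD('k)) + 1 \<le> int CARD('k)")
    (auto intro: bounded_linear_vec_nth bounded_linear_minus)

lemma polynomial_function_coeff:
  "real_polynomial_function (\<lambda>x :: real ^ 'k::{finite,linorder}. coeff (solution (of_coords x) a b n) i)"
proof (induction n arbitrary: i rule: induct_nat_012)
  case (ge2 n)
  have lin: "real_polynomial_function (\<lambda>x :: (real, 'k) vec. of_coords x (int (Suc n)))"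
    by (intro real_polynomial_function.intros(1) bounded_linear_of_coords)
  have "coeff (solution (of_coords x) a b (Suc (Suc n))) i =
      (case i of 0 \<Rightarrow> 0 | Suc j \<Rightarrow> coeff (solution (of_coords x) a b (Suc n)) j)
      - of_coords x (int (Suc n)) * coeff (solution (of_coords x) a b (Suc n)) i
      - coeff (solution (of_coords x) a b n) i" for x :: "(real, 'k) vec"
    by (simp add: solution.simps(3) coeff_pCons split: nat.splits)
  moreover have "real_polynomial_function (\<lambda>x :: (real, 'k) vec.
      (case i of 0 \<Rightarrow> 0 | Suc j \<Rightarrow> coeff (solution (of_coords x) a b (Suc n)) j)
      - of_coords x (int (Suc n)) * coeff (solution (of_coords x) a b (Suc n)) i
      - coeff (solution (of_coords x) a b n) i)"
    using ge2 lin
    by (cases i) (auto intro!: real_polynomial_function_diff real_polynomial_function.intros(2,4))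
  ultimately show ?case
    by simp
qed (auto simp: real_polynomial_function.intros(2))

lemma polynomial_function_lyapunov_coeff:
  "real_polynomial_function (\<lambda>x :: real ^ 'k::{finite,linorder}. coeff (lyapunov k (of_coords x)) i)"
  unfolding lyapunov_def coeff_add by (intro real_polynomial_function.intros(3) polynomial_function_coeff)

lemma has_derivative_vec_componentwise:
  fixes f :: "'a::real_normed_vector \<Rightarrow> real ^ 'n"
  assumes "\<And>i. ((\<lambda>x. f x $ i) has_derivative (\<lambda>v. f' v $ i)) (at a)"
  shows "(f has_derivative f') (at a)"
  using assms by (subst has_derivative_componentwise_within) (auto simp: Basis_vec_def inner_axis)

lemma has_derivative_vec_nth:
  fixes f :: "'a::real_normed_vector \<Rightarrow> real ^ 'n"
  assumes "(f has_derivative f') (at a)"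
  shows "((\<lambda>x. f x $ i) has_derivative (\<lambda>v. f' v $ i)) (at a)"
  using bounded_linear.has_derivative[OF bounded_linear_vec_nth assms] .

lemma Phi_has_derivative:
  obtains Phi' where
    "((\<lambda>x :: real ^ 'k::{finite,linorder}. Phi_map (of_coords x) :: (real, 'k) vec) has_derivative Phi') (at a)"
proof -
  have "\<forall>i. \<exists>d. ((\<lambda>x :: (real, 'k) vec. (Phi_map (of_coords x) :: (real, 'k) vec) $ i) has_derivative d) (at a)"
    using differentiable_at_real_polynomial_function[OF polynomial_function_lyapunov_coeff]
    by (auto simp: Phi_map_def differentiable_def)
  then obtain d where "\<And>i. ((\<lambda>x :: (real, 'k) vec. (Phi_map (of_coords x) :: (real, 'k) vec) $ i) has_derivative d i) (at a)"
    by metis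
  then have "((\<lambda>x :: (real, 'k) vec. Phi_map (of_coords x) :: (real, 'k) vec) has_derivative (\<lambda>v. \<chi> i. d i v)) (at a)"
    by (intro has_derivative_vec_componentwise) simp
  then show ?thesis
    by (rule that)
qed

text \<open>
  Remainders of this form arise in the envelope principle: an increment of a differentiable function,
  multiplied by the displacement of the critical point.
\<close>

lemma has_derivative_small_remainder:
  fixes f :: "'a::real_normed_vector \<Rightarrow> 'b::real_normed_vector" and r :: "'a \<Rightarrow> 'c::real_normed_vector"
  assumes f: "(f has_derivative f') (at a)" and u: "(u \<longlongrightarrow> 0) (at a)" "\<And>x. u x \<ge> 0"
    and r: "\<forall>\<^sub>F x in at a. norm (r x) \<le> norm (f x - f a) * u x" and "r a = 0"
  shows "(r has_derivative (\<lambda>v. 0)) (at a)"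
proof -
  have f': "bounded_linear f'" and lim: "((\<lambda>x. norm (f x - f a - f' (x - a)) / norm (x - a)) \<longlongrightarrow> 0) (at a)"
    using f by (auto simp: has_derivative_iff_norm)
  obtain B where B: "\<And>v. norm (f' v) \<le> norm v * B"
    using bounded_linear.bounded[OF f'] by blast
  have "\<forall>\<^sub>F x in at a. norm (f x - f a - f' (x - a)) / norm (x - a) < 1"
    using lim by (rule order_tendstoD) simp
  then have bound: "\<forall>\<^sub>F x in at a. norm (r x) / norm (x - a) \<le> (B + 1) * u x"
    using r eventually_neq_at_within[of a a UNIV]
  proof eventually_elim
    case (elim x)
    have "norm (x - a) > 0"
      using elim by simp
    have "norm (f x - f a) \<le> norm (f x - f a - f' (x - a)) + norm (f' (x - a))"
      by (metis add.commute norm_triangle_sub)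
    also have "\<dots> \<le> norm (x - a) + norm (x - a) * B"
      using elim(1) B[of "x - a"] \<open>norm (x - a) > 0\<close> by (intro add_mono) (auto simp: field_simps)
    finally have le: "norm (f x - f a) \<le> (B + 1) * norm (x - a)"
      by (simp add: algebra_simps)
    have "norm (r x) \<le> (B + 1) * norm (x - a) * u x"
      using elim(2) mult_right_mono[OF le u(2)[of x]] by simp
    then show ?case
      using \<open>norm (x - a) > 0\<close> by (simp add: field_simps)
  qed
  have "((\<lambda>x. (B + 1) * u x) \<longlongrightarrow> 0) (at a)"
    using tendsto_mult_left[OF u(1), of "B + 1"] by simp
  then have "((\<lambda>x. norm (r x) / norm (x - a)) \<longlongrightarrow> 0) (at a)"
    by (rule Lim_null_comparison[rotated]) (use bound in \<open>simp add: divide_nonneg_nonneg\<close>)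
  then show ?thesis
    using assms(5) by (simp add: has_derivative_iff_norm)
qed

text \<open>
  A vector in the kernel of a Vandermonde matrix is the coefficient vector of a polynomial of degree
  less than \<open>k\<close> with \<open>k\<close> distinct roots.
\<close>

lemma vandermonde_injective:
  fixes w :: "real ^ 'k::{finite,linorder}" and t :: "'k \<Rightarrow> real"
  assumes "inj t" "\<And>j. (\<Sum>i\<in>UNIV. w $ i * t j ^ (CARD('k) - idx i)) = 0"
  shows "w = 0"
proof -
  define k where "k = CARD('k)"
  define Q where "Q = (\<Sum>i\<in>UNIV. monom (w $ i) (k - idx i))"
  have exp_eq: "k - idx i = k - idx j \<longleftrightarrow> i = j" for i j :: 'k
  proof -
    have "k - idx i = k - idx j \<longleftrightarrow> idx i = idx j"
      using idx_bounds(2)[of i] idx_bounds(2)[of j] unfolding k_def by linarith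
    then show ?thesis
      using inj_idx by (metis injD)
  qed
  have "degree Q < k"
  proof -
    have "degree (monom (w $ i) (k - idx i)) \<le> k - 1" for i
      using idx_bounds(1)[of i] by (intro order_trans[OF degree_monom_le]) simp
    then have "degree Q \<le> k - 1"
      unfolding Q_def by (intro degree_sum_le) auto
    moreover have "k > 0"
      by (simp add: k_def)
    ultimately show ?thesis
      by linarith
  qed
  have "Q = 0"
  proof (rule poly_eqI_degree[where A = "range t"])
    show "poly Q x = poly 0 x" if "x \<in> range t" for x
      using assms(2) that by (auto simp: Q_def poly_sum poly_monom k_def)
    have "card (range t) = k"
      using card_image[OF assms(1)] by (simp add: k_def)
    then show "degree Q < card (range t)" "degree (0 :: real poly) < card (range t)"
      using \<open>degree Q < k\<close> by auto
  qed
  have "w $ j = 0" for j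
  proof -
    have "coeff Q (k - idx j) = (\<Sum>i\<in>UNIV. if i = j then w $ i else 0)"
      unfolding Q_def coeff_sum by (intro sum.cong) (auto simp: exp_eq)
    then show ?thesis
      using \<open>Q = 0\<close> by simp
  qed
  then show ?thesis
    by (simp add: vec_eq_iff)
qed

lemma lyapunov_critical_odd:
  assumes "q \<in> Qodd k" "k \<ge> 1" "ladder (lyapunov k q) (2 * k) c" "i \<in> {1..2 * k - 1}"
  shows "c (2 * k - i) = - c i"
proof -
  define D where "D = lyapunov k q"
  have L: "ladder D (2 * k) c"
    using assms(3) by (simp add: D_def)
  have "poly (pderiv D) (- x) = - poly (pderiv D) x" for x
  proof -
    have "D \<circ>\<^sub>p [:0, -1:] = D"
      using lyapunov_even[OF assms(1,2)] by (intro poly_ext) (simp add: poly_pcompose D_def)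
    then have "pderiv D = pderiv (D \<circ>\<^sub>p [:0, -1:])"
      by simp
    then have "poly (pderiv D) x = poly (pderiv (D \<circ>\<^sub>p [:0, -1:])) x"
      by simp
    then show ?thesis
      by (simp add: pderiv_pcompose pderiv_pCons poly_pcompose)
  qed
  note odd = this
  have "- c (2 * k - i) = c i"
  proof (rule strict_chain_unique[where m = "2 * k - 1" and y = "\<lambda>i. - c (2 * k - i)"])
    show "- c (2 * k - j) < - c (2 * k - Suc j)" if "1 \<le> j" "j < 2 * k - 1" for j
      using ladder_less[OF L, of "2 * k - Suc j" "2 * k - j"] that by auto
    show "c j < c (Suc j)" if "1 \<le> j" "j < 2 * k - 1" for j
      using ladder_less[OF L, of j "Suc j"] that by auto
    show "- c (2 * k - j) \<in> c ` {1..2 * k - 1}" if "j \<in> {1..2 * k - 1}" for j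
    proof -
      have "2 * k - j \<in> {1..2 * k - 1}"
        using that by auto
      then have "poly (pderiv D) (c (2 * k - j)) = 0"
        using ladder_critical_iff[OF L] assms(2) by auto
      then have "poly (pderiv D) (- c (2 * k - j)) = 0"
        by (simp add: odd)
      then show ?thesis
        using ladder_critical_iff[OF L] assms(2) by auto
    qed
  qed (rule assms(4))
  then show ?thesis
    by simp
qed

text \<open>
  The critical points are symmetric about 0 and the middle one, number \<open>k\<close>, is 0.  So the first \<open>k\<close> are
  distinct and at most 0, which makes their squares distinct.
\<close>

lemma critical_squares_inj:
  assumes "q \<in> Qodd CARD('k::{finite,linorder})" "ladder (lyapunov CARD('k) q) (2 * CARD('k)) c"
  shows "inj (\<lambda>i::'k. (c (idx i))\<^sup>2)"
proof (rule injI)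
  define k where "k = CARD('k)"
  have k: "k \<ge> 1"
    by (simp add: k_def Suc_le_eq)
  have L: "ladder (lyapunov k q) (2 * k) c" and q: "q \<in> Qodd k"
    using assms by (auto simp: k_def)
  have "c (2 * k - k) = - c k"
    by (rule lyapunov_critical_odd[OF q k L]) (use k in auto)
  then have "c k = 0"
    by simp
  then have nonpos: "c (idx i) \<le> 0" for i :: 'k
    using ladder_le[OF L, of "idx i" k] idx_bounds(2)[of i] by (simp add: k_def)
  fix i j :: 'k assume "(c (idx i))\<^sup>2 = (c (idx j))\<^sup>2"
  then have "c (idx i) = c (idx j) \<or> c (idx i) = - c (idx j)"
    by (simp add: power2_eq_iff)
  then have c: "c (idx i) = c (idx j)"
    using nonpos[of i] nonpos[of j] by (elim disjE) linarith+
  have "idx i \<le> 2 * k" "idx j \<le> 2 * k"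
    using idx_bounds(2)[of i] idx_bounds(2)[of j] by (auto simp: k_def)
  then have "idx i = idx j"
    using c ladder_less[OF L, of "idx i" "idx j"] ladder_less[OF L, of "idx j" "idx i"]
    by (cases "idx i" "idx j" rule: linorder_cases) auto
  then show "i = j"
    using inj_idx by (metis injD)
qed

definition lyap :: "real ^ 'k::{finite,linorder} \<Rightarrow> real poly" where
  "lyap x = lyapunov CARD('k) (of_coords x)"

text \<open>
  Only the inner entries, the critical points, are determined by \<open>x\<close>; the choice affects the two outer
  ones.
\<close>

definition crit :: "real ^ 'k::{finite,linorder} \<Rightarrow> nat \<Rightarrow> real" where
  "crit x = (SOME c. ladder (lyap x) (2 * CARD('k)) c)"

text \<open>
  This number is \<open>2 cosh h\<^sub>i\<close>, where \<open>h\<^sub>i\<close> is the height of gap \<open>i\<close>.  Unlike \<open>h\<^sub>i\<close>, it is a differentiable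
  function of the potential even where the gap is closed.
\<close>

definition gap_value :: "nat \<Rightarrow> real ^ 'k::{finite,linorder} \<Rightarrow> real" where
  "gap_value i x = (-1) ^ (2 * CARD('k) - i) * poly (lyap x) (crit x i)"

definition Phi :: "real ^ 'k::{finite,linorder} \<Rightarrow> real ^ 'k::{finite,linorder}" where
  "Phi x = Phi_map (of_coords x)"

text \<open>
  The powers of \<open>y\<close> that multiply \<open>\<phi>\<^sub>1, \<phi>\<^sub>3, \<dots>\<close> in the Lyapunov polynomial.
\<close>

definition moments :: "real \<Rightarrow> real ^ 'k::{finite,linorder}" where
  "moments y = (\<chi> i. (y\<^sup>2) ^ (CARD('k) - idx i))"

lemma card_ge_1: "1 \<le> CARD('k::finite)"
  by (simp add: Suc_le_eq)

lemma crit_ladder: "ladder (lyap x) (2 * CARD('k)) (crit (x :: real ^ 'k::{finite,linorder}))"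
  unfolding crit_def
proof (rule someI_ex[of "ladder (lyap x) (2 * CARD('k))"])
  show "\<exists>c. ladder (lyap x) (2 * CARD('k)) c"
    unfolding lyap_def by (intro lyapunov_ladder card_ge_1)
qed

lemma lyap_eq_inner:
  "poly (lyap x) y = y ^ (2 * CARD('k)) + Phi x \<bullet> moments y" for x :: "real ^ 'k::{finite,linorder}"
  unfolding lyap_def lyapunov_expansion[OF of_coords_in_Qodd]
  by (simp add: inner_vec_def Phi_def moments_def power_mult[symmetric] right_diff_distrib')

lemma continuous_pderiv_lyap:
  "isCont (\<lambda>x :: real ^ 'k::{finite,linorder}. poly (pderiv (lyap x)) y) a"
proof -
  have deg: "degree (pderiv (lyap x)) = 2 * CARD('k) - 1" for x :: "(real, 'k) vec"
    using monic_lyapunov[OF card_ge_1[where 'k = 'k]] by (simp add: lyap_def degree_pderiv monic_of_degree_def)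
  have "isCont (\<lambda>x :: (real, 'k) vec. coeff (lyap x) i) a" for i
    unfolding lyap_def
    using differentiable_at_real_polynomial_function[OF polynomial_function_lyapunov_coeff]
    by (rule differentiable_imp_continuous_within)
  then show ?thesis
    unfolding poly_altdef deg coeff_pderiv by (intro continuous_intros)
qed

text \<open>
  The derivative of the Lyapunov polynomial has simple roots, hence opposite signs on the two sides of
  each of them.  At fixed points on the two sides the signs persist for nearby potentials, and the
  roots found between them, in disjoint intervals, are all critical points in the right order.
\<close>

lemma crit_continuous:
  fixes a :: "real ^ 'k::{finite,linorder}"
  assumes i: "i \<in> {1..2 * CARD('k) - 1}"
  shows "((\<lambda>x. crit x i) \<longlongrightarrow> crit a i) (nhds a)"
proof (rule tendstoI)
  fix e :: real assume "e > 0"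
  define n where "n = 2 * CARD('k)"
  have L: "ladder (lyap x) n (crit x)" for x :: "(real, 'k) vec"
    using crit_ladder[of x] by (simp add: n_def)
  have n: "n \<ge> 1"
    using card_ge_1[where 'k = 'k] by (simp add: n_def)
  define c where "c = crit a"
  \<comment> \<open>Intervals of radius at most half the smallest distance stay disjoint.\<close>
  define d where "d = Min ((\<lambda>j. (c (Suc j) - c j) / 2) ` {..<n})"
  have d: "d \<le> (c (Suc j) - c j) / 2" if "j < n" for j
    unfolding d_def using that by (intro Min_le) auto
  have "d > 0"
    unfolding d_def using n ladder_less[OF L] by (subst Min_gr_iff) (auto simp: c_def lessThan_empty_iff)
  define r where "r = min e d"
  have r: "r > 0" "r \<le> e" "\<And>j. j < n \<Longrightarrow> 2 * r \<le> c (Suc j) - c j"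
    using \<open>e > 0\<close> \<open>d > 0\<close> d by (fastforce simp: r_def min_def)+
  have sign: "poly (pderiv (lyap a)) (c j - r) * poly (pderiv (lyap a)) (c j + r) < 0"
    if j: "j \<in> {1..n - 1}" for j
  proof -
    have j': "1 \<le> j" "j < n"
      using j by auto
    have "(-1) ^ (n - Suc j) * poly (pderiv (lyap a)) (c j + r) > 0"
    proof (rule ladder_pderiv_sign[OF L j'(2)])
      show "crit a m < c j + r" if "1 \<le> m" "m \<le> j" for m
        using ladder_le[OF L[of a], of m j] that j' r(1) by (simp add: c_def)
      show "c j + r < crit a m" if "j < m" "m < n" for m
        using ladder_le[OF L[of a], of "Suc j" m] that j' r(1) r(3)[of j] by (simp add: c_def)
    qed
    moreover have "(-1) ^ (n - Suc (j - 1)) * poly (pderiv (lyap a)) (c j - r) > 0"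
    proof (rule ladder_pderiv_sign[OF L])
      show "crit a m < c j - r" if "1 \<le> m" "m \<le> j - 1" for m
      proof -
        have "c m \<le> c (j - 1)"
          unfolding c_def by (rule ladder_le[OF L]) (use that j' in auto)
        moreover have "2 * r \<le> c j - c (j - 1)"
          using r(3)[of "j - 1"] j' by simp
        ultimately show ?thesis
          using r(1) by (simp add: c_def)
      qed
      show "c j - r < crit a m" if "j - 1 < m" "m < n" for m
      proof -
        have "c j \<le> c m"
          unfolding c_def by (rule ladder_le[OF L]) (use that j' in auto)
        then show ?thesis
          using r(1) by (simp add: c_def)
      qed
    qed (use j' in simp)
    moreover have "(-1) ^ (n - Suc (j - 1)) = - ((-1) ^ (n - Suc j) :: real)"
      using minus_one_power_diff_Suc[OF j'(2)] j' by simp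
    ultimately show ?thesis
      by (cases "even (n - Suc j)") (auto simp: mult_less_0_iff)
  qed
  have "\<forall>\<^sub>F x in nhds a. \<forall>j\<in>{1..n - 1}. poly (pderiv (lyap x)) (c j - r) * poly (pderiv (lyap x)) (c j + r) < 0"
  proof (rule eventually_ball_finite)
    show "\<forall>j\<in>{1..n - 1}. \<forall>\<^sub>F x in nhds a. poly (pderiv (lyap x)) (c j - r) * poly (pderiv (lyap x)) (c j + r) < 0"
    proof
      fix j assume j: "j \<in> {1..n - 1}"
      have "((\<lambda>x. poly (pderiv (lyap x)) (c j - r) * poly (pderiv (lyap x)) (c j + r)) \<longlongrightarrow>
          poly (pderiv (lyap a)) (c j - r) * poly (pderiv (lyap a)) (c j + r)) (nhds a)"
        using continuous_pderiv_lyap unfolding isCont_def tendsto_nhds_iff[symmetric]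
        by (intro tendsto_mult) (auto simp: tendsto_nhds_iff)
      then show "\<forall>\<^sub>F x in nhds a. poly (pderiv (lyap x)) (c j - r) * poly (pderiv (lyap x)) (c j + r) < 0"
        using sign[OF j] by (rule order_tendstoD)
    qed
  qed simp
  then show "\<forall>\<^sub>F x in nhds a. dist (crit x i) (crit a i) < e"
  proof eventually_elim
    case (elim x)
    have "\<exists>y. c j - r < y \<and> y < c j + r \<and> poly (pderiv (lyap x)) y = 0" if "j \<in> {1..n - 1}" for j
      using poly_IVT[of "c j - r" "c j + r" "pderiv (lyap x)"] elim that r(1) by auto
    then obtain y where y: "\<And>j. j \<in> {1..n - 1} \<Longrightarrow> c j - r < y j \<and> y j < c j + r \<and> poly (pderiv (lyap x)) (y j) = 0"
      by metis
    have "y i = crit x i"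
    proof (rule strict_chain_unique[where m = "n - 1"])
      show "y j < y (Suc j)" if "1 \<le> j" "j < n - 1" for j
      proof -
        have "j \<in> {1..n - 1}" "Suc j \<in> {1..n - 1}" "j < n"
          using that by auto
        then show ?thesis
          using y[of j] y[of "Suc j"] r(3)[of j] by linarith
      qed
      show "crit x j < crit x (Suc j)" if "1 \<le> j" "j < n - 1" for j
        using ladder_less[OF L] that by auto
      show "y j \<in> crit x ` {1..n - 1}" if "j \<in> {1..n - 1}" for j
        using y[OF that] ladder_critical_iff[OF L n, of x "y j"] by simp
    qed (use i in \<open>simp add: n_def\<close>)
    then show ?case
      using y[of i] i r(2) by (simp add: dist_real_def c_def n_def abs_less_iff)
  qed
qed

lemma gap_value_ge_2: "i \<in> {1..2 * CARD('k) - 1} \<Longrightarrow> 2 \<le> gap_value i (x :: real ^ 'k::{finite,linorder})"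
  unfolding gap_value_def by (intro ladder_value[OF crit_ladder]) auto

text \<open>
  The envelope principle.  Let \<open>c\<close> and \<open>c'\<close> be the critical points for \<open>a\<close> and \<open>x\<close>.  Since \<open>c'\<close> maximizes the
  signed polynomial of \<open>x\<close> locally and \<open>c\<close> that of \<open>a\<close>, the increment of the gap value lies between the
  increments from \<open>a\<close> to \<open>x\<close> of the signed polynomial at the fixed points \<open>c\<close> and \<open>c'\<close>.  These two differ by
  \<open>(Phi x - Phi a) \<bullet> (moments c' - moments c)\<close> up to sign, which is of smaller order because \<open>c'\<close> tends to \<open>c\<close>.
  Continuity of the critical points suffices for this; their derivatives do not enter.
\<close>

lemma gap_value_has_derivative:
  fixes a :: "real ^ 'k::{finite,linorder}"
  assumes i: "i \<in> {1..2 * CARD('k) - 1}" and Phi': "(Phi has_derivative Phi') (at a)"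
  shows "(gap_value i has_derivative (\<lambda>v. (-1) ^ (2 * CARD('k) - i) * (Phi' v \<bullet> moments (crit a i)))) (at a)"
proof -
  define n where "n = 2 * CARD('k)"
  have L: "ladder (lyap x) n (crit x)" for x :: "(real, 'k) vec"
    using crit_ladder[of x] by (simp add: n_def)
  have i': "1 \<le> i" "i < n"
    using i by (auto simp: n_def)
  define s :: real where "s = (-1) ^ (n - i)"
  define c where "c = crit a"
  define u where "u x = norm (moments (crit x i) - moments (c i) :: (real, 'k) vec)" for x :: "(real, 'k) vec"
  define R where "R x = gap_value i x - gap_value i a - s * ((Phi x - Phi a) \<bullet> moments (c i))" for x :: "(real, 'k) vec"
  have diff: "s * poly (lyap x) y - s * poly (lyap a) y = s * ((Phi x - Phi a) \<bullet> moments y)" for x y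
    by (simp add: lyap_eq_inner inner_diff_left algebra_simps)
  have lim: "((\<lambda>x. crit x j) \<longlongrightarrow> c j) (nhds a)" if "1 \<le> j" "j < n" for j
    unfolding c_def using that by (intro crit_continuous) (auto simp: n_def)
  have ev_less: "\<forall>\<^sub>F x in nhds a. crit x j < c m \<and> c j < crit x m" if "1 \<le> j" "j < m" "m < n" for j m
  proof -
    have "c j < c m"
      using ladder_less[OF L, of j m a] that by (simp add: c_def)
    then show ?thesis
      using order_tendstoD(2)[OF lim[of j]] order_tendstoD(1)[OF lim[of m]] that
      by (intro eventually_conj) auto
  qed
  have "\<forall>\<^sub>F x in nhds a. (\<forall>j\<in>{1..<i}. crit x j < c i \<and> c j < crit x i) \<and> (\<forall>j\<in>{i<..<n}. crit x i < c j \<and> c i < crit x j)"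
    using ev_less i' by (intro eventually_conj eventually_ball_finite) auto
  then have "\<forall>\<^sub>F x in nhds a. norm (R x) \<le> norm (Phi x - Phi a) * u x"
  proof eventually_elim
    case (elim x)
    have "s * poly (lyap x) (c i) \<le> s * poly (lyap x) (crit x i)"
      unfolding s_def by (rule ladder_max[OF L i']) (use elim in \<open>auto intro: less_imp_le\<close>)
    then have lower: "s * ((Phi x - Phi a) \<bullet> moments (c i)) \<le> gap_value i x - gap_value i a"
      using diff[of x "c i"] by (simp add: gap_value_def s_def n_def c_def)
    have "s * poly (lyap a) (crit x i) \<le> s * poly (lyap a) (c i)"
      unfolding s_def c_def by (rule ladder_max[OF L i']) (use elim in \<open>auto intro: less_imp_le simp: c_def\<close>)
    then have upper: "gap_value i x - gap_value i a \<le> s * ((Phi x - Phi a) \<bullet> moments (crit x i))"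
      using diff[of x "crit x i"] by (simp add: gap_value_def s_def n_def c_def)
    have "0 \<le> R x" "R x \<le> s * ((Phi x - Phi a) \<bullet> (moments (crit x i) - moments (c i)))"
      using lower upper by (auto simp: R_def inner_diff_right right_diff_distrib)
    then have "norm (R x) \<le> \<bar>s * ((Phi x - Phi a) \<bullet> (moments (crit x i) - moments (c i)))\<bar>"
      by simp
    also have "\<dots> = \<bar>(Phi x - Phi a) \<bullet> (moments (crit x i) - moments (c i))\<bar>"
      by (simp add: s_def abs_minus_one_power_mult)
    also have "\<dots> \<le> norm (Phi x - Phi a) * u x"
      unfolding u_def by (rule Cauchy_Schwarz_ineq2)
    finally show ?case .
  qed
  then have R_bound: "\<forall>\<^sub>F x in at a. norm (R x) \<le> norm (Phi x - Phi a) * u x"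
    by (simp add: eventually_at_filter eventually_mono)
  have "((\<lambda>x. moments (crit x i) :: (real, 'k) vec) \<longlongrightarrow> moments (c i)) (nhds a)"
    unfolding moments_def by (intro tendsto_intros lim i')
  then have "((\<lambda>x. moments (crit x i) - moments (c i) :: (real, 'k) vec) \<longlongrightarrow> 0) (nhds a)"
    using LIM_zero by blast
  then have "(u \<longlongrightarrow> 0) (nhds a)"
    unfolding u_def by (rule tendsto_norm_zero)
  then have u: "(u \<longlongrightarrow> 0) (at a)"
    by (simp add: tendsto_nhds_iff)
  have "(R has_derivative (\<lambda>v. 0)) (at a)"
    by (rule has_derivative_small_remainder[OF Phi' u _ R_bound]) (auto simp: u_def R_def)
  moreover have "((\<lambda>x. gap_value i a + s * ((Phi x - Phi a) \<bullet> moments (c i))) has_derivative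
      (\<lambda>v. s * (Phi' v \<bullet> moments (c i)))) (at a)"
    using Phi' by (auto intro!: derivative_eq_intros)
  ultimately have "((\<lambda>x. R x + (gap_value i a + s * ((Phi x - Phi a) \<bullet> moments (c i)))) has_derivative
      (\<lambda>v. 0 + s * (Phi' v \<bullet> moments (c i)))) (at a)"
    by (rule has_derivative_add)
  then show ?thesis
    by (simp add: R_def s_def n_def c_def)
qed

text \<open>
  At a closed gap the gap value attains its minimum 2, so its derivative vanishes.  But this derivative
  is \<open>Phi'\<close> followed by a nonzero linear form.
\<close>

lemma open_gaps_of_regular:
  fixes a :: "real ^ 'k::{finite,linorder}"
  assumes Phi': "(Phi has_derivative Phi') (at a)" "inj Phi'" and i: "i \<in> {1..2 * CARD('k) - 1}"
  shows "gap_value i a > 2"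
proof (rule ccontr)
  assume "\<not> gap_value i a > 2"
  then have "gap_value i a \<le> gap_value i x" for x :: "(real, 'k) vec"
    using gap_value_ge_2[OF i, of x] by linarith
  then have zero: "(\<lambda>v. (-1) ^ (2 * CARD('k) - i) * (Phi' v \<bullet> moments (crit a i))) = (\<lambda>v. 0)"
    by (intro has_derivative_local_min[OF gap_value_has_derivative[OF i Phi'(1)]]) auto
  have "linear Phi'"
    using Phi'(1) has_derivative_linear by blast
  then have "surj Phi'"
    using Phi'(2) by (rule linear_injective_imp_surjective) simp
  then obtain v where "Phi' v = moments (crit a i)"
    by (metis surjD)
  then have "moments (crit a i) = (0 :: (real, 'k) vec)"
    using fun_cong[OF zero, of v] by simp
  \<comment> \<open>The coordinate \<open>\<phi>\<^bsub>2k-1\<^esub>\<close> is the constant term of \<open>\<Delta>\<close>, so its factor is \<open>y\<^sup>0 = 1\<close> even for \<open>y = 0\<close>.\<close>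
  moreover have "moments (crit a i) $ (inv idx CARD('k) :: 'k) = 1"
    using idx_inv[of "CARD('k)", where 'k = 'k] card_ge_1[where 'k = 'k] by (simp add: moments_def)
  ultimately show False
    by simp
qed

lemma gap_quantities:
  fixes a :: "real ^ 'k::{finite,linorder}"
  assumes i: "i \<in> {1..2 * CARD('k) - 1}"
  shows "gap_height CARD('k) (of_coords a) i = arcosh (gap_value i a / 2)"
    and "gap_value i a > 2 \<Longrightarrow> lambda_minus CARD('k) (of_coords a) i < lambda_plus CARD('k) (of_coords a) i"
  using gap_invariants[OF _ card_ge_1 Qodd_spectrum[OF of_coords_in_Qodd card_ge_1] i] crit_ladder[of a]
  by (simp_all add: gap_value_def lyap_def)

lemma idx_in_gap_range: "idx (i :: 'k::{finite,linorder}) \<in> {1..2 * CARD('k) - 1}"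
  using idx_bounds[of i] by simp

lemma h_map_nth:
  "(h_map (of_coords a) :: real ^ 'k::{finite,linorder}) $ i = arcosh (gap_value (idx i) (a :: (real, 'k) vec) / 2)"
  by (simp add: h_map_def gap_quantities(1)[OF idx_in_gap_range])

text \<open>
  The heights are smooth functions of the gap values as long as these exceed 2.  The matrix relating
  the derivative of the heights to that of \<open>Phi\<close> is a Vandermonde matrix with rescaled rows.
\<close>

lemma h_map_has_derivative:
  fixes a :: "real ^ 'k::{finite,linorder}"
  assumes Phi': "(Phi has_derivative Phi') (at a)" and open_gaps: "\<And>i :: 'k. gap_value (idx i) a > 2"
  obtains h' where "((\<lambda>x :: (real, 'k) vec. h_map (of_coords x) :: (real, 'k) vec) has_derivative h') (at a)"
    "inj h' \<longleftrightarrow> inj Phi'"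
proof -
  define s :: "'k \<Rightarrow> real" where "s i = (-1) ^ (2 * CARD('k) - idx i)" for i
  define D where "D i = 1 / sqrt ((gap_value (idx i) a / 2)\<^sup>2 - 1) / 2" for i :: 'k
  have D: "D i > 0" for i
  proof -
    have "1 < (gap_value (idx i) a / 2)\<^sup>2"
      using open_gaps[of i] by (simp add: one_less_power)
    then show ?thesis
      by (simp add: D_def)
  qed
  define h' where "h' v = (\<chi> i. D i * (s i * (Phi' v \<bullet> moments (crit a (idx i)))))" for v
  have deriv: "((\<lambda>x :: (real, 'k) vec. h_map (of_coords x) :: (real, 'k) vec) has_derivative h') (at a)"
  proof (rule has_derivative_vec_componentwise)
    fix i :: 'k
    have "(arcosh has_field_derivative (1 / sqrt ((gap_value (idx i) a / 2)\<^sup>2 - 1))) (at (gap_value (idx i) a / 2))"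
      using open_gaps[of i] by (intro arcosh_real_has_field_derivative) simp
    moreover have "((\<lambda>x. gap_value (idx i) x / 2) has_derivative (\<lambda>v. s i * (Phi' v \<bullet> moments (crit a (idx i))) / 2)) (at a)"
      unfolding s_def
      by (rule bounded_linear.has_derivative[OF bounded_linear_divide gap_value_has_derivative[OF idx_in_gap_range Phi']])
    ultimately have "((\<lambda>x. arcosh (gap_value (idx i) x / 2)) has_derivative
        (\<lambda>v. 1 / sqrt ((gap_value (idx i) a / 2)\<^sup>2 - 1) * (s i * (Phi' v \<bullet> moments (crit a (idx i))) / 2))) (at a)"
      unfolding has_field_derivative_def by (rule has_derivative_compose[rotated])
    then show "((\<lambda>x :: (real, 'k) vec. (h_map (of_coords x) :: (real, 'k) vec) $ i) has_derivative (\<lambda>v. h' v $ i)) (at a)"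
      by (simp add: h_map_nth h'_def D_def mult_ac)
  qed
  have lin: "linear Phi'" "linear h'"
    using Phi' deriv has_derivative_linear by blast+
  have "Phi' v = 0" if "h' v = 0" for v
  proof (rule vandermonde_injective)
    show "inj (\<lambda>i::'k. (crit a (idx i))\<^sup>2)"
      using critical_squares_inj[OF of_coords_in_Qodd] crit_ladder[of a] unfolding lyap_def by blast
    show "(\<Sum>i\<in>UNIV. Phi' v $ i * (crit a (idx j))\<^sup>2 ^ (CARD('k) - idx i)) = 0" for j :: 'k
    proof -
      have "D j * (s j * (Phi' v \<bullet> moments (crit a (idx j)))) = h' v $ j"
        by (simp add: h'_def)
      then have "Phi' v \<bullet> moments (crit a (idx j)) = 0"
        using that D[of j] by (simp add: s_def)
      then show ?thesis
        by (simp add: inner_vec_def moments_def)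
    qed
  qed
  moreover have "h' v = 0" if "Phi' v = 0" for v
    unfolding h'_def that by (simp add: vec_eq_iff)
  ultimately have "inj h' \<longleftrightarrow> inj Phi'"
    using linear_injective_0[OF lin(1)] linear_injective_0[OF lin(2)] by blast
  then show ?thesis
    using deriv that by blast
qed

text \<open>
  A vanishing height is a minimum of that component of \<open>h\<close>, whose derivative must then be zero if it
  exists.
\<close>

lemma open_gaps_of_regular_heights:
  fixes a :: "real ^ 'k::{finite,linorder}"
  assumes h': "((\<lambda>x :: (real, 'k) vec. h_map (of_coords x) :: (real, 'k) vec) has_derivative h') (at a)" and "inj h'"
  shows "gap_value (idx (i :: 'k)) a > 2"
proof (rule ccontr)
  assume "\<not> gap_value (idx i) a > 2"
  then have val: "gap_value (idx i) a = 2"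
    using gap_value_ge_2[OF idx_in_gap_range[of i], of a] by simp
  have "(h_map (of_coords a) :: (real, 'k) vec) $ i \<le> (h_map (of_coords x) :: (real, 'k) vec) $ i" for x :: "(real, 'k) vec"
    using gap_value_ge_2[OF idx_in_gap_range[of i], of x] by (simp add: h_map_nth val)
  then have zero: "(\<lambda>v. h' v $ i) = (\<lambda>v. 0)"
    by (intro has_derivative_local_min[OF has_derivative_vec_nth[OF h']]) auto
  have "linear h'"
    using h' has_derivative_linear by blast
  then have "surj h'"
    using assms(2) by (rule linear_injective_imp_surjective) simp
  then obtain v where "h' v = axis i 1"
    by (metis surjD)
  then show False
    using fun_cong[OF zero, of v] by simp
qed

lemma det_jacobian_nonzero_iff:
  fixes F :: "(int \<Rightarrow> real) \<Rightarrow> real ^ 'k::{finite,linorder}"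
  assumes "((\<lambda>x :: (real, 'k) vec. F (of_coords x)) has_derivative F') (at (coords q))"
  shows "det (q_jacobian F q) \<noteq> 0 \<longleftrightarrow> inj F'"
  unfolding q_jacobian_def frechet_derivative_at[OF assms, symmetric]
  using det_nz_iff_inj[OF has_derivative_linear[OF assms]] .

lemma singular_iff:
  fixes a :: "real ^ 'k::{finite,linorder}"
  assumes "(Phi has_derivative Phi') (at a)"
  shows "of_coords a \<in> singular_set TYPE('k) \<longleftrightarrow> \<not> inj Phi'"
proof -
  have "((\<lambda>x :: (real, 'k) vec. Phi_map (of_coords x) :: (real, 'k) vec) has_derivative Phi') (at (coords (of_coords a)))"
    using assms unfolding coords_of_coords Phi_def[abs_def] .
  from det_jacobian_nonzero_iff[OF this] show ?thesis
    using of_coords_in_Qodd[of a] by (auto simp: singular_set_def)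
qed

lemma regular_heights_iff:
  fixes a :: "real ^ 'k::{finite,linorder}"
  shows "q_differentiable (h_map :: _ \<Rightarrow> (real, 'k) vec) (of_coords a) \<and>
      det (q_jacobian (h_map :: _ \<Rightarrow> (real, 'k) vec) (of_coords a)) \<noteq> 0
    \<longleftrightarrow> of_coords a \<notin> singular_set TYPE('k)"
proof -
  obtain Phi' where Phi': "(Phi has_derivative Phi') (at a)"
    using Phi_has_derivative[of a] unfolding Phi_def[abs_def] by blast
  show ?thesis
  proof
    assume h: "q_differentiable (h_map :: _ \<Rightarrow> (real, 'k) vec) (of_coords a) \<and>
      det (q_jacobian (h_map :: _ \<Rightarrow> (real, 'k) vec) (of_coords a)) \<noteq> 0"
    then obtain h1 where h1: "((\<lambda>x :: (real, 'k) vec. h_map (of_coords x) :: (real, 'k) vec) has_derivative h1) (at a)"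
      by (auto simp: q_differentiable_def differentiable_def coords_of_coords)
    then have "inj h1"
      using h det_jacobian_nonzero_iff[of h_map h1 "of_coords a"] by (simp add: coords_of_coords)
    then obtain h2 where h2: "((\<lambda>x :: (real, 'k) vec. h_map (of_coords x) :: (real, 'k) vec) has_derivative h2) (at a)"
        "inj h2 \<longleftrightarrow> inj Phi'"
      using h_map_has_derivative[OF Phi'] open_gaps_of_regular_heights[OF h1] by blast
    then have "h1 = h2"
      using has_derivative_unique h1 by blast
    then show "of_coords a \<notin> singular_set TYPE('k)"
      using h2(2) \<open>inj h1\<close> singular_iff[OF Phi'] by simp
  next
    assume "of_coords a \<notin> singular_set TYPE('k)"
    then have inj: "inj Phi'"
      using singular_iff[OF Phi'] by simp
    then obtain h' where h': "((\<lambda>x :: (real, 'k) vec. h_map (of_coords x) :: (real, 'k) vec) has_derivative h') (at a)"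
        "inj h' \<longleftrightarrow> inj Phi'"
      using h_map_has_derivative[OF Phi'] open_gaps_of_regular[OF Phi' _ idx_in_gap_range] by blast
    then show "q_differentiable (h_map :: _ \<Rightarrow> (real, 'k) vec) (of_coords a) \<and>
      det (q_jacobian (h_map :: _ \<Rightarrow> (real, 'k) vec) (of_coords a)) \<noteq> 0"
      using inj det_jacobian_nonzero_iff[of h_map h' "of_coords a"]
      by (auto simp: q_differentiable_def differentiable_def coords_of_coords)
  qed
qed

lemma regular_open_gaps:
  fixes a :: "real ^ 'k::{finite,linorder}"
  assumes "of_coords a \<notin> singular_set TYPE('k)" "i \<in> {1..2 * CARD('k) - 1}"
  shows "gap_height CARD('k) (of_coords a) i > 0"
    "lambda_minus CARD('k) (of_coords a) i < lambda_plus CARD('k) (of_coords a) i"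
proof -
  obtain Phi' where Phi': "(Phi has_derivative Phi') (at a)"
    using Phi_has_derivative[of a] unfolding Phi_def[abs_def] by blast
  then have "gap_value i a > 2"
    using open_gaps_of_regular[OF Phi' _ assms(2)] singular_iff[OF Phi'] assms(1) by simp
  then show "gap_height CARD('k) (of_coords a) i > 0"
    "lambda_minus CARD('k) (of_coords a) i < lambda_plus CARD('k) (of_coords a) i"
    using gap_quantities[OF assms(2)] by (simp_all)
qed

section \<open>The sine basis\<close>

text \<open>
  The point \<open>2 cos (bragg k m)\<close> is the \<open>m\<close>-th critical point from above of the Lyapunov polynomial of the zero
  potential.  The monodromy matrix is \<open>\<plusminus>1\<close> there, and gaps can open under perturbation.
\<close>

definition bragg :: "nat \<Rightarrow> nat \<Rightarrow> real" where
  "bragg k m = real m * pi / (2 * real k)"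

definition sine_coeff :: "nat \<Rightarrow> nat \<Rightarrow> (int \<Rightarrow> real) \<Rightarrow> real" where
  "sine_coeff k m q = (\<Sum>n=1..2 * k. q (int n) * sin ((2 * real n - 1) * bragg k m))"

lemma bragg_range:
  assumes "m \<in> {1..k}"
  shows "0 < bragg k m" "bragg k m \<le> pi / 2" "sin (bragg k m) > 0"
proof -
  show p: "0 < bragg k m"
    using assms by (auto simp: bragg_def)
  have "real m * pi \<le> real k * pi"
    using assms by (intro mult_right_mono) auto
  then show "bragg k m \<le> pi / 2"
    using assms by (auto simp: bragg_def field_simps)
  then show "sin (bragg k m) > 0"
    using p pi_gt_zero by (intro sin_gt_zero) linarith+
qed

lemma bragg_period: "k \<ge> 1 \<Longrightarrow> 2 * real k * bragg k m = real m * pi"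
  by (simp add: bragg_def)

text \<open>
  The sum telescopes after multiplication by \<open>2 sin x\<close>.
\<close>

lemma cos_odd_multiples_sum: "2 * sin x * (\<Sum>n=1..M. cos ((2 * real n - 1) * x)) = sin (2 * real M * x)"
proof (induction M)
  case (Suc M)
  define A where "A = (2 * real (Suc M) - 1) * x"
  have "2 * real (Suc M) * x = A + x" "2 * real M * x = A - x"
    by (simp_all add: A_def algebra_simps)
  then have "sin (2 * real (Suc M) * x) - sin (2 * real M * x) = 2 * sin x * cos ((2 * real (Suc M) - 1) * x)"
    unfolding A_def[symmetric] by (simp add: sin_add sin_diff)
  then show ?case
    using Suc by (simp add: algebra_simps)
qed simp

lemma cos_bragg_sum:
  assumes "k \<ge> 1" "j \<le> 2 * k"
  shows "(\<Sum>n=1..2 * k. cos ((2 * real n - 1) * bragg k j)) =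
    (if j = 0 then 2 * real k else if j = 2 * k then - 2 * real k else 0)"
proof -
  consider "j = 0" | "j = 2 * k" "j \<noteq> 0" | "0 < j" "j < 2 * k"
    using assms(2) by linarith
  then show ?thesis
  proof cases
    case 1
    then show ?thesis by (simp add: bragg_def)
  next
    case 2
    have "cos ((2 * real n - 1) * bragg k j) = -1" for n
    proof -
      have "(2 * real n - 1) * bragg k j = 2 * real n * pi - pi"
        using 2 assms(1) by (simp add: bragg_def field_simps)
      then show ?thesis
        by (simp add: cos_diff)
    qed
    then show ?thesis
      using 2 by simp
  next
    case 3
    have x: "0 < bragg k j" "bragg k j < pi"
      using 3 assms(1) by (auto simp: bragg_def field_simps)
    have "sin (2 * real (2 * k) * bragg k j) = 0"
    proof -
      have e: "2 * real (2 * k) * bragg k j = 2 * real j * pi"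
        using assms(1) by (simp add: bragg_def)
      show ?thesis
        unfolding e by (rule sin_2npi)
    qed
    then show ?thesis
      using cos_odd_multiples_sum[of "bragg k j" "2 * k"] sin_gt_zero[OF x] 3 by simp
  qed
qed

lemma sine_orthogonality:
  assumes "m \<in> {1..k}" "l \<in> {1..k}"
  shows "(\<Sum>n=1..2 * k. sin ((2 * real n - 1) * bragg k m) * sin ((2 * real n - 1) * bragg k l)) =
    (if m = l then if m = k then 2 * real k else real k else 0)"
proof -
  have k: "k \<ge> 1"
    using assms by auto
  have "(\<Sum>n=1..2 * k. sin ((2 * real n - 1) * bragg k m) * sin ((2 * real n - 1) * bragg k l)) =
     (\<Sum>n=1..2 * k. (cos ((2 * real n - 1) * bragg k m - (2 * real n - 1) * bragg k l) - cos ((2 * real n - 1) * bragg k m + (2 * real n - 1) * bragg k l)) / 2)"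
    by (simp add: sin_times_sin)
  also have "\<dots> = (\<Sum>n=1..2 * k. (cos ((2 * real n - 1) * bragg k (max m l - min m l)) - cos ((2 * real n - 1) * bragg k (m + l))) / 2)"
  proof (intro sum.cong refl)
    fix n
    have "bragg k (m + l) = bragg k m + bragg k l"
      by (simp add: bragg_def distrib_right add_divide_distrib)
    moreover have "cos ((2 * real n - 1) * bragg k m - (2 * real n - 1) * bragg k l) = cos ((2 * real n - 1) * bragg k (max m l - min m l))"
    proof (cases "l \<le> m")
      case True
      then have e: "bragg k (max m l - min m l) = bragg k m - bragg k l"
        by (simp add: bragg_def of_nat_diff diff_divide_distrib left_diff_distrib)
      show ?thesis
        unfolding e by (simp only: right_diff_distrib)
    next
      case False
      then have e: "bragg k (max m l - min m l) = bragg k l - bragg k m"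
        by (simp add: bragg_def of_nat_diff diff_divide_distrib left_diff_distrib)
      have "(2 * real n - 1) * bragg k m - (2 * real n - 1) * bragg k l = - ((2 * real n - 1) * bragg k (max m l - min m l))"
        unfolding e by (simp only: right_diff_distrib minus_diff_eq)
      then show ?thesis
        by (simp only: cos_minus)
    qed
    ultimately show "(cos ((2 * real n - 1) * bragg k m - (2 * real n - 1) * bragg k l) - cos ((2 * real n - 1) * bragg k m + (2 * real n - 1) * bragg k l)) / 2 =
      (cos ((2 * real n - 1) * bragg k (max m l - min m l)) - cos ((2 * real n - 1) * bragg k (m + l))) / 2"
      by (simp add: distrib_left)
  qed
  also have "\<dots> = ((\<Sum>n=1..2 * k. cos ((2 * real n - 1) * bragg k (max m l - min m l))) - (\<Sum>n=1..2 * k. cos ((2 * real n - 1) * bragg k (m + l)))) / 2"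
    by (simp add: sum_subtractf flip: sum_divide_distrib)
  also have "\<dots> = (if m = l then if m = k then 2 * real k else real k else 0)"
  proof -
    have "max m l - min m l \<le> 2 * k" "m + l \<le> 2 * k" "max m l - min m l \<noteq> 2 * k" "m + l \<noteq> 0"
      using assms by auto
    moreover have "max m l - min m l = 0 \<longleftrightarrow> m = l" "m + l = 2 * k \<longleftrightarrow> m = k \<and> l = k"
      using assms by auto
    ultimately show ?thesis
      using cos_bragg_sum[OF k, of "max m l - min m l"] cos_bragg_sum[OF k, of "m + l"] by auto
  qed
  finally show ?thesis .
qed

lemma e_hat_eq: "e_hat k m (int n) = 2 powr (- (if m = k then 1 else 0) / 2) / sqrt (real k) * sin ((2 * real n - 1) * bragg k m)"
  by (simp add: e_hat_def bragg_def mult.assoc)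

text \<open>
  The factor between a sine coefficient and the coordinate \<open>q_hat k q m\<close>: the normalization of the
  basis vector times the squared norm of the unnormalized one.
\<close>

definition sine_norm :: "nat \<Rightarrow> nat \<Rightarrow> real" where
  "sine_norm k m = 2 powr (- (if m = k then 1 else 0) / 2) / sqrt (real k) * (if m = k then 2 * real k else real k)"

lemma sine_norm_pos: "k \<ge> 1 \<Longrightarrow> sine_norm k m > 0"
  by (simp add: sine_norm_def)

text \<open>
  Orthogonality extracts the coefficients of any expansion in the basis.
\<close>

lemma sine_coeff_expansion:
  assumes "l \<in> {1..k}" "\<And>n. n \<in> {1..2 * int k} \<Longrightarrow> q n = (\<Sum>m=1..k. c m * e_hat k m n)"
  shows "sine_coeff k l q = sine_norm k l * c l"
proof -
  define w where "w m = 2 powr (- (if m = k then 1 else 0) / 2) / sqrt (real k)" for m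
  have "sine_coeff k l q = (\<Sum>n=1..2 * k. \<Sum>m=1..k. c m * w m * (sin ((2 * real n - 1) * bragg k m) * sin ((2 * real n - 1) * bragg k l)))"
    unfolding sine_coeff_def
  proof (intro sum.cong refl)
    fix n assume "n \<in> {1..2 * k}"
    then have "q (int n) = (\<Sum>m=1..k. c m * e_hat k m (int n))"
      by (intro assms(2)) auto
    then show "q (int n) * sin ((2 * real n - 1) * bragg k l) =
        (\<Sum>m=1..k. c m * w m * (sin ((2 * real n - 1) * bragg k m) * sin ((2 * real n - 1) * bragg k l)))"
      by (simp add: sum_distrib_right e_hat_eq w_def mult.assoc)
  qed
  also have "\<dots> = (\<Sum>m=1..k. c m * w m * (\<Sum>n=1..2 * k. sin ((2 * real n - 1) * bragg k m) * sin ((2 * real n - 1) * bragg k l)))"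
    by (subst sum.swap) (simp add: sum_distrib_left)
  also have "\<dots> = (\<Sum>m=1..k. if m = l then sine_norm k l * c l else 0)"
  proof (intro sum.cong refl)
    fix m assume m: "m \<in> {1..k}"
    show "c m * w m * (\<Sum>n=1..2 * k. sin ((2 * real n - 1) * bragg k m) * sin ((2 * real n - 1) * bragg k l)) =
        (if m = l then sine_norm k l * c l else 0)"
      unfolding sine_orthogonality[OF m assms(1)] by (auto simp: w_def sine_norm_def)
  qed
  also have "\<dots> = sine_norm k l * c l"
    using assms(1) by simp
  finally show ?thesis .
qed

definition sine_transform :: "real ^ 'k::{finite,linorder} \<Rightarrow> real ^ 'k::{finite,linorder}" where
  "sine_transform x = (\<chi> i. sine_coeff CARD('k) (idx i) (of_coords x))"

lemma linear_sine_transform: "linear (sine_transform :: real ^ 'k::{finite,linorder} \<Rightarrow> (real, 'k) vec)"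
proof -
  have lin: "linear (\<lambda>x :: (real, 'k) vec. of_coords x n)" for n
    using bounded_linear_of_coords bounded_linear.linear by blast
  show ?thesis
    by (rule linearI)
      (simp_all add: sine_transform_def sine_coeff_def vec_eq_iff linear_add[OF lin] linear_scale[OF lin]
        distrib_right sum.distrib sum_distrib_left mult.assoc)
qed

lemma e_hat_reflect:
  assumes "k \<ge> 1"
  shows "e_hat k m (2 * int k + 1 - n) = - e_hat k m n"
proof -
  have "of_int (2 * (2 * int k + 1 - n) - 1) * real m * pi / (2 * real k) = 2 * pi * of_int (int m) - of_int (2 * n - 1) * real m * pi / (2 * real k)"
    using assms by (simp add: field_simps)
  then have "sin (of_int (2 * (2 * int k + 1 - n) - 1) * real m * pi / (2 * real k)) = - sin (of_int (2 * n - 1) * real m * pi / (2 * real k))"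
    by (simp only: sin_diff sin_int_2pin cos_int_2pin)
  then show ?thesis
    unfolding e_hat_def by simp
qed

text \<open>
  The basis vectors are odd, so an expansion that holds on the first half of the period holds on all of it.
\<close>

lemma of_coords_sines:
  fixes c :: "nat \<Rightarrow> real"
  assumes n: "n \<in> {1..2 * int CARD('k::{finite,linorder})}"
  defines "x \<equiv> (\<chi> i. \<Sum>m=1..CARD('k). c m * e_hat CARD('k) m (int (idx i))) :: (real, 'k) vec"
  shows "of_coords x n = (\<Sum>m=1..CARD('k). c m * e_hat CARD('k) m n)"
proof -
  define f where "f n = (\<Sum>m=1..CARD('k). c m * e_hat CARD('k) m n)" for n
  \<comment> \<open>Beyond the middle of the period \<open>of_coords\<close> is the odd reflection, and so is the expansion.\<close>
  have f_reflect: "f (2 * int CARD('k) + 1 - n) = - f n" for n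
    by (simp add: f_def e_hat_reflect[OF card_ge_1] sum_negf)
  have x: "x $ inv idx j = f (int j)" if "1 \<le> j" "j \<le> CARD('k)" for j
    using idx_inv[OF that] by (simp add: x_def f_def)
  have "(n - 1) mod (2 * int CARD('k)) = n - 1"
    using n by (intro mod_pos_pos_trivial) auto
  then have r: "of_coords x n = (if n \<le> int CARD('k) then x $ inv idx (nat n) else - x $ inv idx (nat (2 * int CARD('k) + 1 - n)))"
    by (simp add: of_coords_def Let_def)
  have "of_coords x n = f n"
  proof (cases "n \<le> int CARD('k)")
    case True
    then have "x $ inv idx (nat n) = f (int (nat n))"
      using n by (intro x) auto
    then show ?thesis
      using r True n by simp
  next
    case False
    then have "x $ inv idx (nat (2 * int CARD('k) + 1 - n)) = f (int (nat (2 * int CARD('k) + 1 - n)))"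
      using n by (intro x) auto
    then show ?thesis
      using r False n f_reflect[of n] by simp
  qed
  then show ?thesis
    by (simp add: f_def)
qed

text \<open>
  Orthogonality exhibits a preimage of every vector; a surjective endomorphism of a
  finite-dimensional space is injective.
\<close>

lemma inj_sine_transform: "inj (sine_transform :: real ^ 'k::{finite,linorder} \<Rightarrow> (real, 'k) vec)"
proof -
  have "surj (sine_transform :: (real, 'k) vec \<Rightarrow> (real, 'k) vec)"
  proof (rule surjI)
    fix y :: "(real, 'k) vec"
    define c where "c m = y $ inv idx m / sine_norm CARD('k) m" for m
    have "sine_coeff CARD('k) (idx l) (of_coords (\<chi> i. \<Sum>m=1..CARD('k). c m * e_hat CARD('k) m (int (idx i)) :: (real, 'k) vec)) =
        sine_norm CARD('k) (idx l) * c (idx l)" for l :: 'k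
    proof (rule sine_coeff_expansion)
      show "idx l \<in> {1..CARD('k)}"
        using idx_bounds[of l] by simp
    qed (rule of_coords_sines)
    moreover have "sine_norm CARD('k) (idx l) * c (idx l) = y $ l" for l :: 'k
      using sine_norm_pos[OF card_ge_1[where 'k = 'k], of "idx l"] by (simp add: c_def inv_f_f[OF inj_idx])
    ultimately show "sine_transform (\<chi> i. \<Sum>m=1..CARD('k). (y $ inv idx m / sine_norm CARD('k) m) * e_hat CARD('k) m (int (idx i))) = y"
      by (simp add: sine_transform_def vec_eq_iff c_def)
  qed
  then show ?thesis
    using linear_surjective_imp_injective[OF linear_sine_transform] by simp
qed

lemma q_hat_eq:
  assumes "q \<in> Qodd CARD('k::{finite,linorder})" "m \<in> {1..CARD('k)}"
  shows "sine_coeff CARD('k) m q = sine_norm CARD('k) m * q_hat CARD('k) q m"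
proof -
  define k where "k = CARD('k)"
  define c where "c m = (if m \<in> {1..k} then sine_coeff k m q / sine_norm k m else 0)" for m
  define x where "x = (\<chi> i. \<Sum>m=1..k. c m * e_hat k m (int (idx i)) :: (real, 'k) vec)"
  have k: "k \<ge> 1"
    by (simp add: k_def Suc_le_eq)
  have x: "of_coords x n = (\<Sum>m=1..k. c m * e_hat k m n)" if "n \<in> {1..2 * int k}" for n
    using of_coords_sines[of n c, where 'k = 'k] that by (simp add: k_def x_def)
  have "sine_coeff k (idx l) (of_coords x) = sine_coeff k (idx l) q" for l :: 'k
  proof -
    have "sine_coeff k (idx l) (of_coords x) = sine_norm k (idx l) * c (idx l)"
      by (rule sine_coeff_expansion[OF _ x]) (use idx_bounds[of l] in \<open>auto simp: k_def\<close>)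
    then show ?thesis
      using sine_norm_pos[OF k, of "idx l"] idx_bounds[of l] by (simp add: c_def k_def)
  qed
  then have "sine_transform x = sine_transform (coords q)"
    using of_coords_coords[OF assms(1)] by (simp add: sine_transform_def vec_eq_iff k_def)
  then have "x = coords q"
    using inj_sine_transform by (metis injD)
  then have q: "of_coords x = q"
    using of_coords_coords[OF assms(1)] by simp
  have "q_hat k q = c"
    unfolding q_hat_def
  proof (rule the_equality)
    show "(\<forall>m. m \<notin> {1..k} \<longrightarrow> c m = 0) \<and> (\<forall>n\<in>{1..2 * int k}. q n = (\<Sum>m=1..k. c m * e_hat k m n))"
      using x q by (auto simp: c_def)
    fix d assume d: "(\<forall>m. m \<notin> {1..k} \<longrightarrow> d m = 0) \<and> (\<forall>n\<in>{1..2 * int k}. q n = (\<Sum>m=1..k. d m * e_hat k m n))"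
    show "d = c"
    proof
      fix m
      show "d m = c m"
      proof (cases "m \<in> {1..k}")
        case True
        then have "sine_coeff k m q = sine_norm k m * d m"
          using d by (intro sine_coeff_expansion) auto
        then show ?thesis
          using True sine_norm_pos[OF k, of m] by (simp add: c_def)
      next
        case False
        then have "d m = 0"
          using d by blast
        then show ?thesis
          using False unfolding c_def by (simp only: if_False)
      qed
    qed
  qed
  then show ?thesis
    using assms(2) sine_norm_pos[OF k, of m] by (simp add: c_def k_def)
qed

section \<open>The Lyapunov polynomial of a small potential\<close>

text \<open>
  Each order of the expansion in the size of the potential solves such an inhomogeneous equation, with
  the order before as source.
\<close>

fun forced :: "real \<Rightarrow> (nat \<Rightarrow> real) \<Rightarrow> (nat \<Rightarrow> real) \<Rightarrow> nat \<Rightarrow> real" where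
  "forced l v g 0 = 0"
| "forced l v g (Suc 0) = 0"
| "forced l v g (Suc (Suc n)) = (l - v (Suc n)) * forced l v g (Suc n) - forced l v g n - g (Suc n)"

definition free :: "real \<Rightarrow> real \<Rightarrow> real \<Rightarrow> nat \<Rightarrow> real" where
  "free l a b n = poly (solution (\<lambda>_. 0) a b n) l"

definition order1 :: "real \<Rightarrow> real \<Rightarrow> real \<Rightarrow> (int \<Rightarrow> real) \<Rightarrow> nat \<Rightarrow> real" where
  "order1 l a b r = forced l (\<lambda>_. 0) (\<lambda>j. r (int j) * free l a b j)"

definition order2 :: "real \<Rightarrow> real \<Rightarrow> real \<Rightarrow> (int \<Rightarrow> real) \<Rightarrow> nat \<Rightarrow> real" where
  "order2 l a b r = forced l (\<lambda>_. 0) (\<lambda>j. r (int j) * order1 l a b r j)"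

text \<open>
  The exact coefficient of \<open>s\<^sup>3\<close>, itself a function of \<open>s\<close>: it solves an equation with the full potential \<open>s r\<close>
  and therefore is a polynomial in \<open>s\<close> and \<open>r\<close>.
\<close>

definition remainder3 :: "real \<Rightarrow> real \<Rightarrow> real \<Rightarrow> real \<Rightarrow> (int \<Rightarrow> real) \<Rightarrow> nat \<Rightarrow> real" where
  "remainder3 l a b s r = forced l (\<lambda>j. s * r (int j)) (\<lambda>j. r (int j) * order2 l a b r j)"

lemma solution_expansion:
  "poly (solution (\<lambda>j. s * r j) a b n) l =
    free l a b n + s * order1 l a b r n + s\<^sup>2 * order2 l a b r n + s ^ 3 * remainder3 l a b s r n"
proof (induction n rule: induct_nat_012)
  case (ge2 n)
  define t where "t = r (int (Suc n))"
  have steps: "free l a b (Suc (Suc n)) = l * free l a b (Suc n) - free l a b n"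
    "order1 l a b r (Suc (Suc n)) = l * order1 l a b r (Suc n) - order1 l a b r n - t * free l a b (Suc n)"
    "order2 l a b r (Suc (Suc n)) = l * order2 l a b r (Suc n) - order2 l a b r n - t * order1 l a b r (Suc n)"
    "remainder3 l a b s r (Suc (Suc n)) =
      (l - s * t) * remainder3 l a b s r (Suc n) - remainder3 l a b s r n - t * order2 l a b r (Suc n)"
    "poly (solution (\<lambda>j. s * r j) a b (Suc (Suc n))) l =
      (l - s * t) * poly (solution (\<lambda>j. s * r j) a b (Suc n)) l - poly (solution (\<lambda>j. s * r j) a b n) l"
    by (simp_all add: free_def order1_def order2_def remainder3_def solution.simps(3) t_def algebra_simps)
  show ?case
    unfolding steps ge2 by (simp add: algebra_simps power2_eq_square power3_eq_cube)
qed (auto simp: free_def order1_def order2_def remainder3_def)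

text \<open>
  Variation of constants: each site \<open>j\<close> contributes a free solution that starts there.
\<close>

lemma duhamel: "forced l (\<lambda>_. 0) g n = - (\<Sum>j=1..<n. g j * free l 0 1 (n - j))"
proof (induction n rule: induct_nat_012)
  case (ge2 n)
  have f0: "free l 0 1 0 = 0" "free l 0 1 (Suc 0) = 1"
    by (simp_all add: free_def)
  have ext: "(\<Sum>j=1..<n. g j * free l 0 1 (n - j)) = (\<Sum>j=1..<Suc n. g j * free l 0 1 (n - j))"
    using f0 by (cases "n = 0") auto
  have "(\<Sum>j=1..<Suc n. g j * free l 0 1 (Suc (Suc n) - j)) =
      l * (\<Sum>j=1..<Suc n. g j * free l 0 1 (Suc n - j)) - (\<Sum>j=1..<Suc n. g j * free l 0 1 (n - j))"
    unfolding sum_distrib_left sum_subtractf[symmetric]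
  proof (rule sum.cong)
    fix j assume "j \<in> {1..<Suc n}"
    then have "Suc (Suc n) - j = Suc (Suc (n - j))" "Suc n - j = Suc (n - j)"
      by auto
    then show "g j * free l 0 1 (Suc (Suc n) - j) = l * (g j * free l 0 1 (Suc n - j)) - g j * free l 0 1 (n - j)"
      by (simp add: free_def solution.simps(3) algebra_simps)
  qed simp
  then show ?case
    using ge2 ext f0 by simp
qed auto

lemma free_trig:
  assumes "sin t \<noteq> 0"
  shows "free (2 * cos t) 0 1 n = sin (real n * t) / sin t"
    "free (2 * cos t) 1 0 n = - (sin ((real n - 1) * t) / sin t)"
proof -
  have rec: "free l a b (Suc (Suc n)) = l * free l a b (Suc n) - free l a b n" for l a b n
    by (simp add: free_def solution.simps(3))
  have trig: "sin ((x + 2) * t) = 2 * cos t * sin ((x + 1) * t) - sin (x * t)" for x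
  proof -
    define A where "A = (x + 1) * t"
    have "(x + 2) * t = A + t" "x * t = A - t"
      by (simp_all add: A_def algebra_simps)
    then show ?thesis
      unfolding A_def[symmetric] by (simp add: sin_add sin_diff)
  qed
  have "free (2 * cos t) 0 1 n = sin (real n * t) / sin t \<and>
    free (2 * cos t) 1 0 n = - (sin ((real n - 1) * t) / sin t)"
  proof (induction n rule: induct_nat_012)
    case (ge2 n)
    have e: "real (Suc (Suc n)) = real n + 2" "real n + 2 - 1 = (real n - 1) + 2"
      "real (Suc n) = real n + 1" "real n + 1 - 1 = (real n - 1) + 1"
      by simp_all
    show ?case
      unfolding rec ge2[THEN conjunct1] ge2[THEN conjunct2] e trig
      by (simp add: diff_divide_distrib algebra_simps)
  qed (use assms in \<open>auto simp: free_def\<close>)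
  then show "free (2 * cos t) 0 1 n = sin (real n * t) / sin t"
    "free (2 * cos t) 1 0 n = - (sin ((real n - 1) * t) / sin t)"
    by auto
qed

lemma sum_triangle:
  fixes f :: "nat \<Rightarrow> nat \<Rightarrow> real"
  assumes "\<And>i j. f i j = f j i" "\<And>i. f i i = 0"
  shows "(\<Sum>j=1..N. \<Sum>i=1..N. f i j) = 2 * (\<Sum>j=1..N. \<Sum>i=1..<j. f i j)"
proof (induction N)
  case (Suc N)
  have "(\<Sum>j=1..Suc N. \<Sum>i=1..Suc N. f i j) =
      (\<Sum>j=1..N. \<Sum>i=1..N. f i j) + (\<Sum>j=1..N. f (Suc N) j) + (\<Sum>i=1..N. f i (Suc N))"
    using assms(2)[of "Suc N"] by (simp add: sum.distrib)
  also have "(\<Sum>j=1..N. f (Suc N) j) = (\<Sum>i=1..N. f i (Suc N))"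
    by (intro sum.cong refl assms(1))
  finally show ?case
    using Suc by (simp add: atLeastLessThanSuc_atLeastAtMost)
qed simp

lemma Qodd_cos_sum_zero:
  assumes "q \<in> Qodd k" "k \<ge> 1"
  shows "(\<Sum>j=1..2 * k. q (int j) * cos ((2 * real j - 1) * bragg k m)) = 0"
proof -
  define f where "f j = q (int j) * cos ((2 * real j - 1) * bragg k m)" for j
  have "(\<Sum>j=1..2 * k. f j) = (\<Sum>j=1..2 * k. f (2 * k + 1 - j))"
    by (rule sum.reindex_bij_witness[of _ "\<lambda>j. 2 * k + 1 - j" "\<lambda>j. 2 * k + 1 - j"]) auto
  also have "\<dots> = (\<Sum>j=1..2 * k. - f j)"
  proof (rule sum.cong)
    fix j assume j: "j \<in> {1..2 * k}"
    then have "q (int (2 * k + 1 - j)) = - q (int j)"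
      using Qodd_reflect[OF assms(1), of "int j"] by (simp add: of_nat_diff algebra_simps)
    moreover have "(2 * real (2 * k + 1 - j) - 1) * bragg k m = 2 * real m * pi - (2 * real j - 1) * bragg k m"
      using j bragg_period[OF assms(2), of m] by (simp add: of_nat_diff algebra_simps)
    moreover have "cos (2 * real m * pi - (2 * real j - 1) * bragg k m) = cos ((2 * real j - 1) * bragg k m)"
      unfolding cos_diff cos_2npi sin_2npi by simp
    ultimately show "f (2 * k + 1 - j) = - f j"
      by (simp add: f_def)
  qed simp
  finally show ?thesis
    by (simp add: f_def sum_negf)
qed

lemma sin_bragg_reflect:
  assumes "k \<ge> 1"
  shows "sin (2 * real k * bragg k m - x) = - ((-1) ^ m * sin x)"
  unfolding bragg_period[OF assms] by (simp add: sin_diff)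

text \<open>
  Variation of constants writes the second-order term of the trace as a sum over pairs \<open>i < j\<close>.  At the
  points \<open>2 cos (bragg k m)\<close> addition formulas collapse the coefficient of \<open>q\<^sub>i q\<^sub>j\<close> to a multiple of
  \<open>sin\<^sup>2 ((j - i) t)\<close> with \<open>t = bragg k m\<close>.  The sum over all pairs is a combination of the squares of
  the mean, of the cosine coefficient and of the sine coefficient of \<open>q\<close>; for an odd potential only
  the last one is left.
\<close>

lemma trace_second_order:
  assumes q: "q \<in> Qodd k" and m: "m \<in> {1..k}"
  defines "l \<equiv> 2 * cos (bragg k m)"
  shows "order2 l 0 1 q (2 * k + 1) + order2 l 1 0 q (2 * k) =
    (-1) ^ m * (sine_coeff k m q)\<^sup>2 / (4 * (sin (bragg k m))\<^sup>2)"
proof -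
  define N where "N = 2 * k"
  define t where "t = bragg k m"
  define S where "S = free l 0 1"
  define Th where "Th = free l 1 0"
  define r where "r j = q (int j)" for j
  have k: "k \<ge> 1" using m by auto
  have st: "sin t \<noteq> 0"
    using bragg_range(3)[OF m] by (simp add: t_def)
  have S: "S n = sin (real n * t) / sin t" and Th: "Th n = - (sin ((real n - 1) * t) / sin t)" for n
    using free_trig[OF st] by (auto simp: S_def Th_def l_def t_def)
  have o1: "order1 l a b q n = - (\<Sum>j=1..<n. r j * free l a b j * S (n - j))" for a b n
    by (simp add: order1_def duhamel S_def r_def)
  have o2: "order2 l a b q n = (\<Sum>j=1..<n. \<Sum>i=1..<j. r i * r j * free l a b i * S (j - i) * S (n - j))" for a b n
    unfolding order2_def duhamel o1 S_def[symmetric] r_def[symmetric]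
    by (simp add: sum_negf sum_distrib_left sum_distrib_right mult_ac)
  have "order2 l 0 1 q (N + 1) = (\<Sum>j=1..N. \<Sum>i=1..<j. r i * r j * S i * S (j - i) * S (N + 1 - j))"
    unfolding o2 S_def[symmetric] by (simp only: Suc_eq_plus1[symmetric] atLeastLessThanSuc_atLeastAtMost)
  moreover have "order2 l 1 0 q N = (\<Sum>j=1..N. \<Sum>i=1..<j. r i * r j * Th i * S (j - i) * S (N - j))"
  proof -
    have "{1..N} = insert N {1..<N}"
      using k by (auto simp: N_def)
    moreover have "S 0 = 0"
      by (simp add: S)
    ultimately show ?thesis
      unfolding o2 Th_def[symmetric] by simp
  qed
  ultimately have "order2 l 0 1 q (N + 1) + order2 l 1 0 q N =
    (\<Sum>j=1..N. \<Sum>i=1..<j. r i * r j * (S (j - i) * (S i * S (N + 1 - j) + Th i * S (N - j))))"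
    by (simp add: sum.distrib[symmetric] algebra_simps)
  also have "\<dots> = (\<Sum>j=1..N. \<Sum>i=1..<j. - ((-1) ^ m / (sin t)\<^sup>2) * (r i * r j * (sin ((real j - real i) * t))\<^sup>2))"
  proof (intro sum.cong refl)
    fix j i assume ij: "j \<in> {1..N}" "i \<in> {1..<j}"
    \<comment> \<open>The contribution of the pair is \<open>sin d \<cdot> sin (2 k t - d)\<close> up to a factor, and \<open>2 k t = m \<pi>\<close>.\<close>
    define a where "a = real i * t"
    define b where "b = (real N + 1 - real j) * t"
    define d where "d = (real j - real i) * t"
    have Nt: "real N * t = 2 * real k * bragg k m"
      by (simp add: N_def t_def)
    have e1: "S (j - i) = sin d / sin t"
      using ij by (simp add: S d_def of_nat_diff)
    have e2: "S i = sin a / sin t" "Th i = - (sin (a - t) / sin t)"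
      by (simp_all add: S Th a_def algebra_simps)
    have e3: "S (N + 1 - j) = sin b / sin t" "S (N - j) = sin (b - t) / sin t"
      using ij by (simp_all add: S b_def of_nat_diff algebra_simps)
    have e4: "sin a * sin b - sin (a - t) * sin (b - t) = sin t * sin (a + b - t)"
    proof -
      have "sin (a + b - t) = sin a * (cos b * cos t + sin b * sin t) + cos a * (sin b * cos t - cos b * sin t)"
        using sin_add[of a "b - t"] unfolding sin_diff[of b] cos_diff[of b] by (simp only: add_diff_eq)
      moreover have "sin (a - t) = sin a * cos t - cos a * sin t" "sin (b - t) = sin b * cos t - cos b * sin t"
        by (simp_all add: sin_diff)
      moreover have "sin t * sin t + cos t * cos t = 1"
        using sin_cos_squared_add[of t] by (simp add: power2_eq_square)
      ultimately show ?thesis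
        by algebra
    qed
    have e5: "sin (a + b - t) = - ((-1) ^ m * sin d)"
    proof -
      have "a + b - t = 2 * real k * bragg k m - d"
        unfolding Nt[symmetric] by (simp add: a_def b_def d_def algebra_simps)
      then show ?thesis
        using sin_bragg_reflect[OF k] by simp
    qed
    have "S (j - i) * (S i * S (N + 1 - j) + Th i * S (N - j))
        = sin d * (sin a * sin b - sin (a - t) * sin (b - t)) / (sin t) ^ 3"
      unfolding e1 e2 e3 by (simp add: power3_eq_cube diff_divide_distrib algebra_simps)
    also have "\<dots> = - ((-1) ^ m / (sin t)\<^sup>2) * (sin d)\<^sup>2"
      unfolding e4 e5 using st by (simp add: power2_eq_square power3_eq_cube)
    finally have "S (j - i) * (S i * S (N + 1 - j) + Th i * S (N - j)) = - ((-1) ^ m / (sin t)\<^sup>2) * (sin d)\<^sup>2" .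
    then show "r i * r j * (S (j - i) * (S i * S (N + 1 - j) + Th i * S (N - j))) =
      - ((-1) ^ m / (sin t)\<^sup>2) * (r i * r j * (sin ((real j - real i) * t))\<^sup>2)"
      by (simp add: d_def)
  qed
  also have "\<dots> = - ((-1) ^ m / (sin t)\<^sup>2) * (\<Sum>j=1..N. \<Sum>i=1..<j. r i * r j * (sin ((real j - real i) * t))\<^sup>2)"
    by (simp only: sum_distrib_left)
  also have "(\<Sum>j=1..N. \<Sum>i=1..<j. r i * r j * (sin ((real j - real i) * t))\<^sup>2) = - (sine_coeff k m q)\<^sup>2 / 4"
  proof -
    define C where "C = (\<Sum>j=1..N. r j * cos ((2 * real j - 1) * t))"
    define D where "D = (\<Sum>j=1..N. r j * sin ((2 * real j - 1) * t))"
    define R where "R = (\<Sum>j=1..N. r j)"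
    have "2 * (\<Sum>j=1..N. \<Sum>i=1..<j. r i * r j * (sin ((real j - real i) * t))\<^sup>2) =
        (\<Sum>j=1..N. \<Sum>i=1..N. r i * r j * (sin ((real j - real i) * t))\<^sup>2)"
    proof (rule sum_triangle[symmetric])
      fix i j :: nat
      have "(real i - real j) * t = - ((real j - real i) * t)"
        by (simp add: algebra_simps)
      then show "r i * r j * (sin ((real j - real i) * t))\<^sup>2 = r j * r i * (sin ((real i - real j) * t))\<^sup>2"
        by simp
    qed simp
    also have "\<dots> = (\<Sum>j=1..N. \<Sum>i=1..N. (r j * r i - (r j * cos ((2 * real j - 1) * t)) * (r i * cos ((2 * real i - 1) * t))
        - (r j * sin ((2 * real j - 1) * t)) * (r i * sin ((2 * real i - 1) * t))) / 2)"
    proof (intro sum.cong refl)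
      fix i j :: nat
      have "2 * ((real j - real i) * t) = (2 * real j - 1) * t - (2 * real i - 1) * t"
        by (simp add: algebra_simps)
      then have "1 - 2 * (sin ((real j - real i) * t))\<^sup>2 = cos ((2 * real j - 1) * t) * cos ((2 * real i - 1) * t)
          + sin ((2 * real j - 1) * t) * sin ((2 * real i - 1) * t)"
        using cos_double_sin[of "(real j - real i) * t"] by (simp add: cos_diff)
      then have "(sin ((real j - real i) * t))\<^sup>2 = (1 - cos ((2 * real j - 1) * t) * cos ((2 * real i - 1) * t)
          - sin ((2 * real j - 1) * t) * sin ((2 * real i - 1) * t)) / 2"
        by simp
      then show "r i * r j * (sin ((real j - real i) * t))\<^sup>2 =
        (r j * r i - (r j * cos ((2 * real j - 1) * t)) * (r i * cos ((2 * real i - 1) * t))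
        - (r j * sin ((2 * real j - 1) * t)) * (r i * sin ((2 * real i - 1) * t))) / 2"
        by (simp only:) (simp add: algebra_simps)
    qed
    also have "\<dots> = (R * R - C * C - D * D) / 2"
      unfolding R_def C_def D_def sum_product by (simp add: sum_subtractf flip: sum_divide_distrib)
    also have "R = 0"
      using Qodd_sum_zero[OF q k] by (simp add: R_def r_def N_def)
    also have "C = 0"
      using Qodd_cos_sum_zero[OF q k, of m] by (simp add: C_def r_def N_def t_def)
    also have "D = sine_coeff k m q"
      by (simp add: D_def sine_coeff_def r_def N_def t_def)
    finally show ?thesis
      by (simp add: power2_eq_square)
  qed
  finally show ?thesis
    by (simp add: N_def t_def)
qed

definition trace_remainder :: "nat \<Rightarrow> nat \<Rightarrow> real \<Rightarrow> (int \<Rightarrow> real) \<Rightarrow> real" where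
  "trace_remainder k m s r = remainder3 (2 * cos (bragg k m)) 0 1 s r (2 * k + 1)
     + remainder3 (2 * cos (bragg k m)) 1 0 s r (2 * k)"

text \<open>
  The zeroth order is the free trace \<open>2 cos (2 k t) = 2 (-1)\<^sup>m\<close> with \<open>t = bragg k m\<close>.  The first-order
  coefficient of each \<open>q\<^sub>j\<close> vanishes because \<open>sin (2 k t) = 0\<close>.
\<close>

lemma lyapunov_small_expansion:
  assumes q: "q \<in> Qodd k" and m: "m \<in> {1..k}"
  shows "poly (lyapunov k (\<lambda>j. s * q j)) (2 * cos (bragg k m)) =
    2 * (-1) ^ m + s\<^sup>2 * ((-1) ^ m * (sine_coeff k m q)\<^sup>2 / (4 * (sin (bragg k m))\<^sup>2)) + s ^ 3 * trace_remainder k m s q"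
proof -
  define t where "t = bragg k m"
  define l where "l = 2 * cos t"
  have k: "k \<ge> 1" using m by auto
  have st: "sin t \<noteq> 0"
    using bragg_range(3)[OF m] by (simp add: t_def)
  have kt: "real (2 * k) * t = real m * pi"
    using bragg_period[OF k, of m] by (simp add: t_def)
  have order0: "free l 0 1 (2 * k + 1) + free l 1 0 (2 * k) = 2 * (-1) ^ m"
  proof -
    have e: "real (2 * k + 1) * t = real m * pi + t" "(real (2 * k) - 1) * t = real m * pi - t"
      using kt by (simp_all add: algebra_simps)
    show ?thesis
      unfolding l_def free_trig[OF st] e using st by (simp add: sin_add sin_diff field_simps)
  qed
  have order1: "order1 l 0 1 q (2 * k + 1) + order1 l 1 0 q (2 * k) = 0"
  proof -
    define N where "N = 2 * k"
    have "free l 0 1 0 = 0"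
      by (simp add: free_def)
    moreover have "{1..N} = insert N {1..<N}"
      using k by (auto simp: N_def)
    ultimately have "order1 l 1 0 q N = - (\<Sum>j=1..N. q (int j) * free l 1 0 j * free l 0 1 (N - j))"
      by (simp add: order1_def duhamel)
    moreover have "order1 l 0 1 q (N + 1) = - (\<Sum>j=1..N. q (int j) * free l 0 1 j * free l 0 1 (N + 1 - j))"
      unfolding order1_def duhamel by (simp only: Suc_eq_plus1[symmetric] atLeastLessThanSuc_atLeastAtMost)
    ultimately have "order1 l 0 1 q (N + 1) + order1 l 1 0 q N =
        - (\<Sum>j=1..N. q (int j) * (free l 0 1 j * free l 0 1 (N + 1 - j) + free l 1 0 j * free l 0 1 (N - j)))"
      by (simp add: sum.distrib[symmetric] algebra_simps)
    also have "\<dots> = - (\<Sum>j=1..N. 0)"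
    proof (intro arg_cong[where f = uminus] sum.cong refl)
      fix j assume j: "j \<in> {1..N}"
      define a where "a = real j * t"
      have Nt: "real N * t = real m * pi"
        using kt by (simp add: N_def)
      have e: "real (N + 1 - j) * t = real m * pi - (a - t)" "real (N - j) * t = real m * pi - a" "(real j - 1) * t = a - t"
        using j Nt by (simp_all add: a_def of_nat_diff algebra_simps)
      have reflect: "sin (real m * pi - x) = - ((-1) ^ m * sin x)" for x
        using sin_bragg_reflect[OF k, of m x] unfolding bragg_period[OF k] .
      have "free l 0 1 j * free l 0 1 (N + 1 - j) + free l 1 0 j * free l 0 1 (N - j) = 0"
        unfolding l_def free_trig[OF st] e reflect a_def[symmetric] by simp
      then show "q (int j) * (free l 0 1 j * free l 0 1 (N + 1 - j) + free l 1 0 j * free l 0 1 (N - j)) = 0"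
        by simp
    qed
    finally show ?thesis
      by (simp add: N_def)
  qed
  have "poly (lyapunov k (\<lambda>j. s * q j)) l =
      (free l 0 1 (2 * k + 1) + free l 1 0 (2 * k)) + s * (order1 l 0 1 q (2 * k + 1) + order1 l 1 0 q (2 * k))
      + s\<^sup>2 * (order2 l 0 1 q (2 * k + 1) + order2 l 1 0 q (2 * k)) + s ^ 3 * trace_remainder k m s q"
    unfolding lyapunov_def poly_add solution_expansion by (simp add: trace_remainder_def l_def t_def algebra_simps)
  then show ?thesis
    unfolding order0 order1 unfolding l_def t_def trace_second_order[OF q m] by simp
qed

section \<open>Counting isospectral potentials\<close>

text \<open>
  A bound and a Lipschitz constant with the same value, which makes the induction over products simple.
\<close>

lemma polynomial_function_lipschitz:
  fixes f :: "'a::real_normed_vector \<Rightarrow> real"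
  assumes "real_polynomial_function f"
  shows "\<exists>C\<ge>0. \<forall>x\<in>cball 0 M. \<bar>f x\<bar> \<le> C \<and> (\<forall>y\<in>cball 0 M. \<bar>f x - f y\<bar> \<le> C * norm (x - y))"
  using assms
proof (induction rule: real_polynomial_function.induct)
  case (linear f)
  then obtain K where K: "K > 0" "\<And>x. norm (f x) \<le> norm x * K"
    using bounded_linear.pos_bounded by blast
  have "\<bar>f x\<bar> \<le> K * (\<bar>M\<bar> + 1)" if "x \<in> cball 0 M" for x
  proof -
    have "\<bar>f x\<bar> \<le> norm x * K"
      using K(2)[of x] by simp
    also have "\<dots> \<le> (\<bar>M\<bar> + 1) * K"
      using that K(1) by (intro mult_right_mono) auto
    finally show ?thesis
      by (simp add: mult.commute)
  qed
  moreover have "\<bar>f x - f y\<bar> \<le> K * (\<bar>M\<bar> + 1) * norm (x - y)" for x y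
  proof -
    have "\<bar>f x - f y\<bar> \<le> norm (x - y) * K"
      using K(2)[of "x - y"] linear_diff[OF bounded_linear.linear[OF linear]] by simp
    also have "\<dots> \<le> norm (x - y) * (K * (\<bar>M\<bar> + 1))"
      using K(1) by (intro mult_left_mono) (auto simp: algebra_simps)
    finally show ?thesis
      by (simp add: mult_ac)
  qed
  ultimately show ?case
    using K(1) by (intro exI[of _ "K * (\<bar>M\<bar> + 1)"]) auto
next
  case (const c)
  show ?case
    by (intro exI[of _ "\<bar>c\<bar>"]) auto
next
  case (add f g)
  then obtain C D where C: "C \<ge> 0" "\<And>x. x \<in> cball 0 M \<Longrightarrow> \<bar>f x\<bar> \<le> C" "\<And>x y. x \<in> cball 0 M \<Longrightarrow> y \<in> cball 0 M \<Longrightarrow> \<bar>f x - f y\<bar> \<le> C * norm (x - y)"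
    and D: "D \<ge> 0" "\<And>x. x \<in> cball 0 M \<Longrightarrow> \<bar>g x\<bar> \<le> D" "\<And>x y. x \<in> cball 0 M \<Longrightarrow> y \<in> cball 0 M \<Longrightarrow> \<bar>g x - g y\<bar> \<le> D * norm (x - y)"
    by blast
  have "\<bar>f x + g x\<bar> \<le> C + D" if "x \<in> cball 0 M" for x
    using C(2)[OF that] D(2)[OF that] by linarith
  moreover have "\<bar>f x + g x - (f y + g y)\<bar> \<le> (C + D) * norm (x - y)" if "x \<in> cball 0 M" "y \<in> cball 0 M" for x y
    using C(3)[OF that] D(3)[OF that] unfolding distrib_right by linarith
  ultimately show ?case
    using C(1) D(1) by (intro exI[of _ "C + D"]) simp
next
  case (mult f g)
  then obtain C D where C: "C \<ge> 0" "\<And>x. x \<in> cball 0 M \<Longrightarrow> \<bar>f x\<bar> \<le> C" "\<And>x y. x \<in> cball 0 M \<Longrightarrow> y \<in> cball 0 M \<Longrightarrow> \<bar>f x - f y\<bar> \<le> C * norm (x - y)"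
    and D: "D \<ge> 0" "\<And>x. x \<in> cball 0 M \<Longrightarrow> \<bar>g x\<bar> \<le> D" "\<And>x y. x \<in> cball 0 M \<Longrightarrow> y \<in> cball 0 M \<Longrightarrow> \<bar>g x - g y\<bar> \<le> D * norm (x - y)"
    by blast
  have "\<bar>f x * g x\<bar> \<le> 2 * (C * D)" if "x \<in> cball 0 M" for x
  proof -
    have "\<bar>f x\<bar> * \<bar>g x\<bar> \<le> C * D"
      using C(2)[OF that] D(2)[OF that] C(1) by (intro mult_mono) auto
    moreover have "0 \<le> C * D"
      using C(1) D(1) by simp
    ultimately show ?thesis
      unfolding abs_mult by linarith
  qed
  moreover have "\<bar>f x * g x - f y * g y\<bar> \<le> 2 * (C * D) * norm (x - y)" if "x \<in> cball 0 M" "y \<in> cball 0 M" for x y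
  proof -
    have "f x * g x - f y * g y = f x * (g x - g y) + g y * (f x - f y)"
      by (simp add: algebra_simps)
    then have "\<bar>f x * g x - f y * g y\<bar> \<le> \<bar>f x\<bar> * \<bar>g x - g y\<bar> + \<bar>g y\<bar> * \<bar>f x - f y\<bar>"
      using abs_triangle_ineq[of "f x * (g x - g y)" "g y * (f x - f y)"] by (simp add: abs_mult)
    also have "\<dots> \<le> C * (D * norm (x - y)) + D * (C * norm (x - y))"
      using C(2)[OF that(1)] D(2)[OF that(2)] C(3)[OF that] D(3)[OF that] C(1) D(1)
      by (intro add_mono mult_mono) auto
    finally show ?thesis
      by (simp add: algebra_simps)
  qed
  ultimately show ?case
    using C(1) D(1) by (intro exI[of _ "2 * (C * D)"]) simp
qed

lemma polynomial_function_forced: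
  assumes "\<And>j. real_polynomial_function (\<lambda>z. v z j)" "\<And>j. real_polynomial_function (\<lambda>z. g z j)"
  shows "real_polynomial_function (\<lambda>z. forced l (v z) (g z) n)"
proof (induction n rule: induct_nat_012)
  case (ge2 n)
  then show ?case
    unfolding forced.simps
    by (intro real_polynomial_function_diff real_polynomial_function.intros(2,4) assms)
qed (auto intro: real_polynomial_function.intros(2))

lemma polynomial_function_trace_remainder:
  "real_polynomial_function (\<lambda>z :: real \<times> (real ^ 'k::{finite,linorder}). trace_remainder k m (fst z) (of_coords (snd z)))"
proof -
  have q: "real_polynomial_function (\<lambda>z :: real \<times> (real, 'k) vec. of_coords (snd z) n)" for n
    using bounded_linear_compose[OF bounded_linear_of_coords bounded_linear_snd]
    by (intro real_polynomial_function.intros(1))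
  have s: "real_polynomial_function (\<lambda>z :: real \<times> (real, 'k) vec. fst z)"
    by (intro real_polynomial_function.intros(1) bounded_linear_fst)
  show ?thesis
    unfolding trace_remainder_def remainder3_def order2_def order1_def
    by (intro real_polynomial_function.intros(2-4) polynomial_function_forced q s)
qed

text \<open>
  Along a direction in the kernel of the derivative the function would change by less than any
  multiple of the step.
\<close>

lemma inj_derivative_of_lower_bound:
  fixes f :: "'a::real_normed_vector \<Rightarrow> 'b::real_normed_vector"
  assumes f': "(f has_derivative f') (at a)" and c: "c > 0"
    and lower: "\<forall>\<^sub>F z in at a. c * norm (z - a) \<le> norm (f z - f a)"
  shows "inj f'"
proof -
  have lin: "linear f'"
    using f' has_derivative_linear by blast
  have "((\<lambda>z. norm (f z - f a - f' (z - a)) / norm (z - a)) \<longlongrightarrow> 0) (at a)"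
    using f' by (auto simp: has_derivative_iff_norm)
  then have "\<forall>\<^sub>F z in at a. norm (f z - f a - f' (z - a)) / norm (z - a) < c"
    using c by (rule order_tendstoD)
  then have "\<forall>\<^sub>F z in at a. f' (z - a) \<noteq> 0"
    using lower eventually_neq_at_within[of a a UNIV]
  proof eventually_elim
    case (elim z)
    then show ?case
      by (auto simp: field_simps)
  qed
  then obtain d where d: "d > 0" "\<And>z. z \<noteq> a \<Longrightarrow> dist z a < d \<Longrightarrow> f' (z - a) \<noteq> 0"
    unfolding eventually_at by auto
  have "v = 0" if "f' v = 0" for v
  proof (rule ccontr)
    assume "v \<noteq> 0"
    define t where "t = d / (2 * norm v)"
    have t: "t > 0" "t * norm v < d"
      using d(1) \<open>v \<noteq> 0\<close> by (auto simp: t_def)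
    have "f' (a + t *\<^sub>R v - a) \<noteq> 0"
      using t \<open>v \<noteq> 0\<close> by (intro d(2)) (auto simp: dist_norm)
    then show False
      using that by (simp add: linear_scale[OF lin])
  qed
  then show ?thesis
    using linear_injective_0[OF lin] by blast
qed

text \<open>
  In rescaled sine coordinates the potentials isospectral to \<open>b\<close> are the solutions of this perturbation of
  the system \<open>y\<^sub>i\<^sup>2 = b\<^sub>i\<^sup>2\<close>.
\<close>

definition square_system_solutions :: "real \<Rightarrow> real \<Rightarrow> (real ^ 'k \<Rightarrow> real ^ 'k) \<Rightarrow> real ^ 'k \<Rightarrow> (real ^ 'k::finite) set" where
  "square_system_solutions M s R b = {y \<in> cball 0 M. \<forall>i. (y $ i)\<^sup>2 + s * R y $ i = (b $ i)\<^sup>2 + s * R b $ i}"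

locale perturbed_squares =
  fixes b :: "real ^ 'k::finite" and R :: "real ^ 'k \<Rightarrow> real ^ 'k" and C M d s :: real
  assumes d: "d > 0" "\<And>i. d \<le> \<bar>b $ i\<bar>" and M: "2 * norm b \<le> M" and C: "C \<ge> 0"
    and bound: "\<And>y i. y \<in> cball 0 M \<Longrightarrow> \<bar>R y $ i\<bar> \<le> C"
    and lipschitz: "\<And>y z i. y \<in> cball 0 M \<Longrightarrow> z \<in> cball 0 M \<Longrightarrow> \<bar>R y $ i - R z $ i\<bar> \<le> C * norm (y - z)"
    and s: "s > 0" "4 * s * C \<le> d\<^sup>2" "2 * real CARD('k) * s * C < d"
begin

lemma b_in: "b \<in> cball 0 M"
proof -
  have "norm b \<le> M"
    using M norm_ge_zero[of b] by linarith
  then show ?thesis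
    by simp
qed

lemma d_square_le: "d\<^sup>2 \<le> (b $ i)\<^sup>2"
  using d(1) d(2)[of i] by (metis abs_le_square_iff abs_of_pos)

text \<open>
  The smallness of \<open>s\<close> keeps the perturbed squares within a factor of 4 of the unperturbed ones.
\<close>

lemma rhs_bounds:
  fixes i :: 'k
  assumes "y \<in> cball 0 M"
  defines "T \<equiv> (b $ i)\<^sup>2 + s * R b $ i - s * R y $ i"
  shows "(\<bar>b $ i\<bar> / 2)\<^sup>2 \<le> T" "T \<le> (2 * \<bar>b $ i\<bar>)\<^sup>2"
proof -
  have "\<bar>s * (R b $ i - R y $ i)\<bar> \<le> s * (2 * C)"
    unfolding abs_mult using s(1) bound[OF b_in, of i] bound[OF assms(1), of i]
    by (intro mult_mono) auto
  then have "\<bar>T - (b $ i)\<^sup>2\<bar> \<le> d\<^sup>2 / 2"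
    using s(2) by (simp add: T_def algebra_simps)
  then have "\<bar>T - (b $ i)\<^sup>2\<bar> \<le> (b $ i)\<^sup>2 / 2"
    using d_square_le[of i] by linarith
  moreover have "(\<bar>b $ i\<bar> / 2)\<^sup>2 = (b $ i)\<^sup>2 / 4" "(2 * \<bar>b $ i\<bar>)\<^sup>2 = 4 * (b $ i)\<^sup>2"
    by (auto simp: power2_eq_square)
  moreover have "(b $ i)\<^sup>2 \<ge> 0" by simp
  ultimately show "(\<bar>b $ i\<bar> / 2)\<^sup>2 \<le> T" "T \<le> (2 * \<bar>b $ i\<bar>)\<^sup>2"
    by linarith+
qed

lemma solution_abs:
  assumes "y \<in> square_system_solutions M s R b"
  shows "\<bar>b $ i\<bar> / 2 \<le> \<bar>y $ i\<bar>"
proof -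
  have y: "y \<in> cball 0 M" "(y $ i)\<^sup>2 = (b $ i)\<^sup>2 + s * R b $ i - s * R y $ i"
    using assms by (auto simp: square_system_solutions_def algebra_simps)
  then have "(\<bar>b $ i\<bar> / 2)\<^sup>2 \<le> (y $ i)\<^sup>2"
    using rhs_bounds(1)[OF y(1), of i] by simp
  then show ?thesis
    by (metis abs_ge_zero abs_le_square_iff abs_of_nonneg divide_nonneg_nonneg zero_le_numeral)
qed

text \<open>
  For equal signs \<open>\<bar>y\<^sub>i + z\<^sub>i\<bar> \<ge> d\<close>, so \<open>\<bar>y\<^sub>i\<^sup>2 - z\<^sub>i\<^sup>2\<bar>\<close> controls \<open>\<bar>y\<^sub>i - z\<^sub>i\<bar>\<close>, while the Lipschitz bound makes it
  smaller than the distance of the solutions by a factor of order \<open>s\<close>.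
\<close>

lemma solution_unique:
  assumes y: "y \<in> square_system_solutions M s R b" and z: "z \<in> square_system_solutions M s R b"
    and sign: "\<And>i. y $ i > 0 \<longleftrightarrow> z $ i > 0"
  shows "y = z"
proof (rule ccontr)
  assume "y \<noteq> z"
  have in_ball: "y \<in> cball 0 M" "z \<in> cball 0 M"
    using y z by (auto simp: square_system_solutions_def)
  have "\<bar>y $ i - z $ i\<bar> * d \<le> s * C * norm (y - z)" for i
  proof -
    have "\<bar>y $ i + z $ i\<bar> = \<bar>y $ i\<bar> + \<bar>z $ i\<bar>"
      using sign[of i] by (cases "y $ i > 0") auto
    then have "d \<le> \<bar>y $ i + z $ i\<bar>"
      using solution_abs[OF y, of i] solution_abs[OF z, of i] d(2)[of i] by linarith
    then have "\<bar>y $ i - z $ i\<bar> * d \<le> \<bar>y $ i - z $ i\<bar> * \<bar>y $ i + z $ i\<bar>"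
      by (intro mult_left_mono) auto
    also have "\<dots> = \<bar>(y $ i)\<^sup>2 - (z $ i)\<^sup>2\<bar>"
      by (simp add: abs_mult[symmetric] power2_eq_square algebra_simps)
    also have "(y $ i)\<^sup>2 - (z $ i)\<^sup>2 = s * (R z $ i - R y $ i)"
    proof -
      have "(y $ i)\<^sup>2 + s * R y $ i = (z $ i)\<^sup>2 + s * R z $ i"
        using y z by (simp add: square_system_solutions_def)
      then show ?thesis
        by (simp add: algebra_simps)
    qed
    also have "\<bar>s * (R z $ i - R y $ i)\<bar> \<le> s * (C * norm (z - y))"
      unfolding abs_mult using s(1) lipschitz[OF in_ball(2,1), of i] by (simp add: mult_left_mono)
    finally show ?thesis
      by (simp add: norm_minus_commute mult.assoc)
  qed
  then have "(\<Sum>i\<in>UNIV. \<bar>y $ i - z $ i\<bar> * d) \<le> (\<Sum>i\<in>(UNIV :: 'k set). s * C * norm (y - z))"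
    by (intro sum_mono)
  then have "(\<Sum>i\<in>UNIV. \<bar>(y - z) $ i\<bar>) * d \<le> real CARD('k) * (s * C * norm (y - z))"
    by (simp add: sum_distrib_right)
  moreover have "norm (y - z) * d \<le> (\<Sum>i\<in>UNIV. \<bar>(y - z) $ i\<bar>) * d"
    using norm_le_l1_cart[of "y - z"] d(1) by (intro mult_right_mono) auto
  ultimately have "norm (y - z) * d \<le> norm (y - z) * (real CARD('k) * s * C)"
    by (simp add: mult_ac)
  then have "d \<le> real CARD('k) * s * C"
    using \<open>y \<noteq> z\<close> by simp
  moreover have "0 \<le> real CARD('k) * s * C"
    using s(1) C by simp
  ultimately show False
    using s(3) d(1) by linarith
qed

text \<open>
  Taking square roots with the prescribed signs turns the system into a fixed point equation on a box of
  absolute values, to which Brouwer's theorem applies.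
\<close>

lemma solution_exists: "\<exists>y \<in> square_system_solutions M s R b. {i. y $ i > 0} = A"
proof -
  define e :: "'k \<Rightarrow> real" where "e i = (if i \<in> A then 1 else - 1)" for i
  have e: "e i * e i = 1" "\<bar>e i\<bar> = 1" "(e i)\<^sup>2 = 1" for i
    by (auto simp: e_def)
  define E where "E w = (\<chi> i. e i * w $ i)" for w :: "(real, 'k) vec"
  define K where "K = cbox (\<chi> i. \<bar>b $ i\<bar> / 2) (\<chi> i. 2 * \<bar>b $ i\<bar>)"
  have K: "w \<in> K \<longleftrightarrow> (\<forall>i. \<bar>b $ i\<bar> / 2 \<le> w $ i \<and> w $ i \<le> 2 * \<bar>b $ i\<bar>)" for w
    by (auto simp: K_def mem_box_cart)
  have E_in: "E w \<in> cball 0 M" if "w \<in> K" for w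
  proof -
    have "norm (E w) \<le> norm (2 *\<^sub>R b)"
    proof (rule norm_le_componentwise_cart)
      fix i
      have "0 \<le> \<bar>b $ i\<bar> / 2" "\<bar>b $ i\<bar> / 2 \<le> w $ i" "w $ i \<le> 2 * \<bar>b $ i\<bar>"
        using that K by auto
      then show "norm (E w $ i) \<le> norm ((2 *\<^sub>R b) $ i)"
        by (simp add: E_def abs_mult e)
    qed
    then show ?thesis
      using M by simp
  qed
  define T where "T w = (\<chi> i. sqrt ((b $ i)\<^sup>2 + s * R b $ i - s * R (E w) $ i))" for w
  have "continuous_on K T"
  proof -
    have "continuous_on (cball 0 M) (\<lambda>y. R y $ i)" for i
    proof (rule lipschitz_on_continuous_on)
      show "C-lipschitz_on (cball 0 M) (\<lambda>y. R y $ i)"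
        using lipschitz C by (auto simp: lipschitz_on_def dist_norm)
    qed
    moreover have "continuous_on K E"
      unfolding E_def by (intro continuous_intros)
    ultimately have cont: "continuous_on K (\<lambda>w. R (E w) $ i)" for i
      using E_in by (intro continuous_on_compose2[of "cball 0 M" "\<lambda>y. R y $ i" K E]) auto
    show ?thesis
      unfolding T_def
      by (intro continuous_on_vec_lambda continuous_on_real_sqrt continuous_on_diff continuous_on_mult
          continuous_on_const cont)
  qed
  moreover have "T \<in> K \<rightarrow> K"
  proof
    fix w assume w: "w \<in> K"
    show "T w \<in> K"
      unfolding K
    proof
      fix i
      have "\<bar>b $ i\<bar> / 2 \<le> T w $ i"
        unfolding T_def vec_lambda_beta by (rule real_le_rsqrt[OF rhs_bounds(1)[OF E_in[OF w]]])
      moreover have "T w $ i \<le> 2 * \<bar>b $ i\<bar>"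
        using rhs_bounds(2)[OF E_in[OF w], of i] by (simp add: T_def real_le_lsqrt)
      ultimately show "\<bar>b $ i\<bar> / 2 \<le> T w $ i \<and> T w $ i \<le> 2 * \<bar>b $ i\<bar>" ..
    qed
  qed
  moreover have "compact K" "convex K" "K \<noteq> {}"
  proof -
    show "compact K" "convex K"
      by (auto simp: K_def)
    have "(\<chi> i. \<bar>b $ i\<bar>) \<in> K"
      by (simp add: K)
    then show "K \<noteq> {}"
      by blast
  qed
  ultimately obtain w where w: "w \<in> K" "T w = w"
    using brouwer by blast
  have "(E w $ i)\<^sup>2 + s * R (E w) $ i = (b $ i)\<^sup>2 + s * R b $ i" for i
  proof -
    have "0 \<le> (b $ i)\<^sup>2 + s * R b $ i - s * R (E w) $ i"
      using rhs_bounds(1)[OF E_in[OF w(1)], of i] by (meson order_trans zero_le_power2)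
    moreover have "w $ i = sqrt ((b $ i)\<^sup>2 + s * R b $ i - s * R (E w) $ i)"
      using arg_cong[OF w(2), of "\<lambda>v. v $ i"] by (simp add: T_def)
    ultimately have "(w $ i)\<^sup>2 = (b $ i)\<^sup>2 + s * R b $ i - s * R (E w) $ i"
      by simp
    then show ?thesis
      by (simp add: E_def power_mult_distrib e)
  qed
  then have "E w \<in> square_system_solutions M s R b"
    using E_in[OF w(1)] by (simp add: square_system_solutions_def)
  moreover have "{i. E w $ i > 0} = A"
  proof -
    have "w $ i > 0" for i
    proof -
      have "0 < \<bar>b $ i\<bar> / 2" "\<bar>b $ i\<bar> / 2 \<le> w $ i"
        using w(1) d(1) d(2)[of i] K by auto
      then show ?thesis
        by linarith
    qed
    then have "E w $ i > 0 \<longleftrightarrow> i \<in> A" for i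
      using less_asym by (auto simp: E_def e_def)
    then show ?thesis
      by blast
  qed
  ultimately show ?thesis
    by blast
qed

lemma card_solutions: "card (square_system_solutions M s R b) = 2 ^ CARD('k)"
proof -
  have "bij_betw (\<lambda>y. {i. y $ i > 0}) (square_system_solutions M s R b) (UNIV :: 'k set set)"
    unfolding bij_betw_def
  proof
    show "inj_on (\<lambda>y. {i. y $ i > 0}) (square_system_solutions M s R b)"
      by (rule inj_onI) (rule solution_unique, auto)
    show "(\<lambda>y. {i. y $ i > 0}) ` square_system_solutions M s R b = (UNIV :: 'k set set)"
    proof (intro equalityI subsetI)
      fix A :: "'k set"
      obtain y where "y \<in> square_system_solutions M s R b" "{i. y $ i > 0} = A"
        using solution_exists by blast
      then show "A \<in> (\<lambda>y. {i. y $ i > 0}) ` square_system_solutions M s R b"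
        by blast
    qed simp
  qed
  then have "card (square_system_solutions M s R b) = card (Pow (UNIV :: 'k set))"
    by (simp add: bij_betw_same_card)
  then show ?thesis
    by (simp add: card_Pow)
qed

text \<open>
  The quantitative version of local uniqueness at \<open>b\<close>; it yields the regularity of \<open>Phi\<close>.
\<close>

lemma lower_bound:
  assumes "y \<in> cball 0 M" "norm (y - b) \<le> d"
  shows "d / 2 * norm (y - b) \<le>
    (\<Sum>i\<in>UNIV. \<bar>((y $ i)\<^sup>2 + s * R y $ i) - ((b $ i)\<^sup>2 + s * R b $ i)\<bar>)"
proof -
  define g where "g i = ((y $ i)\<^sup>2 + s * R y $ i) - ((b $ i)\<^sup>2 + s * R b $ i)" for i
  have "d * \<bar>y $ i - b $ i\<bar> \<le> \<bar>g i\<bar> + s * C * norm (y - b)" for i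
  proof -
    have "\<bar>y $ i - b $ i\<bar> \<le> d"
      using component_le_norm_cart[of "y - b" i] assms(2) by simp
    then have "d \<le> \<bar>y $ i + b $ i\<bar>"
      using d(2)[of i] by linarith
    then have "d * \<bar>y $ i - b $ i\<bar> \<le> \<bar>y $ i + b $ i\<bar> * \<bar>y $ i - b $ i\<bar>"
      by (intro mult_right_mono) auto
    also have "\<dots> = \<bar>(y $ i)\<^sup>2 - (b $ i)\<^sup>2\<bar>"
      by (simp add: abs_mult[symmetric] power2_eq_square algebra_simps)
    also have "(y $ i)\<^sup>2 - (b $ i)\<^sup>2 = g i - s * (R y $ i - R b $ i)"
      by (simp add: g_def algebra_simps)
    also have "\<bar>g i - s * (R y $ i - R b $ i)\<bar> \<le> \<bar>g i\<bar> + s * \<bar>R y $ i - R b $ i\<bar>"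
      using abs_triangle_ineq4[of "g i" "s * (R y $ i - R b $ i)"] s(1) by (simp add: abs_mult)
    also have "s * \<bar>R y $ i - R b $ i\<bar> \<le> s * (C * norm (y - b))"
      using lipschitz[OF assms(1) b_in, of i] s(1) by (intro mult_left_mono) auto
    finally show ?thesis
      by (simp add: mult.assoc)
  qed
  then have "(\<Sum>i\<in>UNIV. d * \<bar>y $ i - b $ i\<bar>) \<le> (\<Sum>i\<in>UNIV. \<bar>g i\<bar> + s * C * norm (y - b))"
    by (intro sum_mono)
  then have "d * (\<Sum>i\<in>UNIV. \<bar>(y - b) $ i\<bar>) \<le> (\<Sum>i\<in>UNIV. \<bar>g i\<bar>) + real CARD('k) * (s * C * norm (y - b))"
    by (simp add: sum_distrib_left sum.distrib)
  moreover have "d * norm (y - b) \<le> d * (\<Sum>i\<in>UNIV. \<bar>(y - b) $ i\<bar>)"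
    using norm_le_l1_cart[of "y - b"] d(1) by (intro mult_left_mono) auto
  moreover have "real CARD('k) * (s * C * norm (y - b)) \<le> d / 2 * norm (y - b)"
    using s(3) mult_right_mono[of "real CARD('k) * s * C" "d / 2" "norm (y - b)"] by (simp add: mult.assoc)
  ultimately show ?thesis
    unfolding g_def[symmetric] by linarith
qed

end

lemma bragg_points_inj: "inj (\<lambda>i :: 'k::{finite,linorder}. (2 * cos (bragg CARD('k) (idx i)))\<^sup>2)"
proof (rule injI)
  define k where "k = CARD('k)"
  fix i j :: 'k
  assume eq: "(2 * cos (bragg CARD('k) (idx i)))\<^sup>2 = (2 * cos (bragg CARD('k) (idx j)))\<^sup>2"
  have range: "0 < bragg k (idx l)" "bragg k (idx l) \<le> pi / 2" for l :: 'k
    using bragg_range[of "idx l" k] idx_bounds[of l] by (auto simp: k_def)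
  have nonneg: "0 \<le> cos (bragg k (idx l))" for l :: 'k
    using range[of l] by (intro cos_ge_zero) auto
  have "cos (bragg k (idx i)) = cos (bragg k (idx j))"
    using eq nonneg by (simp add: k_def[symmetric])
  then have "bragg k (idx i) = bragg k (idx j)"
  proof (rule cos_inj_pi[rotated 4])
    show "0 \<le> bragg k (idx i)" "bragg k (idx i) \<le> pi" "0 \<le> bragg k (idx j)" "bragg k (idx j) \<le> pi"
      using range[of i] range[of j] pi_gt_zero by linarith+
  qed
  then have "idx i = idx j"
    using card_ge_1[where 'k = 'k] by (simp add: bragg_def k_def)
  then show "i = j"
    using inj_idx by (metis injD)
qed

text \<open>
  The values at the \<open>k\<close> points \<open>2 cos (bragg k m)\<close>, whose squares are distinct, determine \<open>Phi\<close>.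
\<close>

lemma Phi_eq_iff_values:
  fixes x y :: "real ^ 'k::{finite,linorder}"
  shows "Phi x = Phi y \<longleftrightarrow> (\<forall>i :: 'k. poly (lyap x) (2 * cos (bragg CARD('k) (idx i))) = poly (lyap y) (2 * cos (bragg CARD('k) (idx i))))"
proof
  assume vals: "\<forall>i :: 'k. poly (lyap x) (2 * cos (bragg CARD('k) (idx i))) = poly (lyap y) (2 * cos (bragg CARD('k) (idx i)))"
  have "Phi x - Phi y = 0"
  proof (rule vandermonde_injective[OF bragg_points_inj])
    fix j :: 'k
    have "(Phi x - Phi y) \<bullet> moments (2 * cos (bragg CARD('k) (idx j))) = 0"
      using vals[rule_format, of j] by (simp add: lyap_eq_inner inner_diff_left)
    then show "(\<Sum>i\<in>UNIV. (Phi x - Phi y) $ i * (2 * cos (bragg CARD('k) (idx j)))\<^sup>2 ^ (CARD('k) - idx i)) = 0"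
      by (simp add: inner_vec_def moments_def)
  qed
  then show "Phi x = Phi y"
    by simp
qed (simp add: lyap_eq_inner)

lemma of_coords_scale: "of_coords (s *\<^sub>R x) = (\<lambda>j. s * of_coords x j)"
proof
  show "of_coords (s *\<^sub>R x) n = s * of_coords x n" for n
    using linear_scale[OF bounded_linear.linear[OF bounded_linear_of_coords[of n]], of s x] by simp
qed

lemma of_coords_idx: "of_coords x (int (idx i)) = x $ i"
  using arg_cong[OF coords_of_coords[of x], of "\<lambda>v. v $ i"] by (simp add: coords_def)

text \<open>
  A consequence of the invariance of the sum of squares.  The crude constant is enough to keep the
  rescaled isospectral potentials in a fixed ball.
\<close>

lemma isospectral_bound:
  fixes x y :: "real ^ 'k::{finite,linorder}"
  assumes "Phi x = Phi y"
  shows "norm x \<le> real CARD('k) * sqrt (\<Sum>j=1..2 * CARD('k). (of_coords y (int j))\<^sup>2)"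
proof -
  define k where "k = CARD('k)"
  have k: "k \<ge> 1"
    using card_ge_1[where 'k = 'k] by (simp add: k_def)
  have q: "of_coords z \<in> Qodd k" for z :: "(real, 'k) vec"
    unfolding k_def by (rule of_coords_in_Qodd)
  have "lyapunov k (of_coords x) = lyapunov k (of_coords y)"
    using assms lyapunov_eq_iff_Phi_eq[OF of_coords_in_Qodd[of x] of_coords_in_Qodd[of y]] by (simp add: Phi_def k_def)
  then have sums: "(\<Sum>j=1..2 * k. (of_coords x (int j))\<^sup>2) = (\<Sum>j=1..2 * k. (of_coords y (int j))\<^sup>2)"
    using lyapunov_second_coeff[OF q[of x] k] lyapunov_second_coeff[OF q[of y] k] by simp
  have "\<bar>x $ i\<bar> \<le> sqrt (\<Sum>j=1..2 * k. (of_coords y (int j))\<^sup>2)" for i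
  proof -
    have "(x $ i)\<^sup>2 = (of_coords x (int (idx i)))\<^sup>2"
      by (simp add: of_coords_idx)
    also have "\<dots> \<le> (\<Sum>j=1..2 * k. (of_coords x (int j))\<^sup>2)"
      using idx_bounds[of i] by (intro member_le_sum[of "idx i" _ "\<lambda>j. (of_coords x (int j))\<^sup>2"]) (auto simp: k_def)
    finally show ?thesis
      using sums by (simp add: real_le_rsqrt)
  qed
  then have "(\<Sum>i\<in>UNIV. \<bar>x $ i\<bar>) \<le> (\<Sum>i\<in>(UNIV :: 'k set). sqrt (\<Sum>j=1..2 * k. (of_coords y (int j))\<^sup>2))"
    by (intro sum_mono)
  then show ?thesis
    using norm_le_l1_cart[of x] by (simp add: k_def)
qed

definition value_scale :: "nat \<Rightarrow> nat \<Rightarrow> real" where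
  "value_scale k m = (-1) ^ m / (4 * (sin (bragg k m))\<^sup>2)"

lemma scaled_values:
  fixes x :: "real ^ 'k::{finite,linorder}"
  shows "poly (lyap (s *\<^sub>R x)) (2 * cos (bragg CARD('k) (idx (i :: 'k)))) =
    2 * (-1) ^ idx i + s\<^sup>2 * (value_scale CARD('k) (idx i) *
      ((sine_transform x $ i)\<^sup>2 + s * (trace_remainder CARD('k) (idx i) s (of_coords x) / value_scale CARD('k) (idx i))))"
proof -
  define k where "k = CARD('k)"
  have m: "idx i \<in> {1..k}"
    using idx_bounds[of i] by (simp add: k_def)
  have v: "value_scale k (idx i) \<noteq> 0"
    using bragg_range(3)[OF m] by (simp add: value_scale_def)
  have "poly (lyap (s *\<^sub>R x)) (2 * cos (bragg k (idx i))) = 2 * (-1) ^ idx i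
      + s\<^sup>2 * ((-1) ^ idx i * (sine_coeff k (idx i) (of_coords x))\<^sup>2 / (4 * (sin (bragg k (idx i)))\<^sup>2))
      + s ^ 3 * trace_remainder k (idx i) s (of_coords x)"
    unfolding lyap_def of_coords_scale k_def
    by (rule lyapunov_small_expansion[OF of_coords_in_Qodd]) (use m in \<open>simp add: k_def\<close>)
  also have "(-1) ^ idx i * (sine_coeff k (idx i) (of_coords x))\<^sup>2 / (4 * (sin (bragg k (idx i)))\<^sup>2) =
      value_scale k (idx i) * (sine_transform x $ i)\<^sup>2"
    by (simp add: value_scale_def sine_transform_def k_def)
  also have "2 * (-1) ^ idx i + s\<^sup>2 * (value_scale k (idx i) * (sine_transform x $ i)\<^sup>2)
      + s ^ 3 * trace_remainder k (idx i) s (of_coords x) =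
    2 * (-1) ^ idx i + s\<^sup>2 * (value_scale k (idx i) *
      ((sine_transform x $ i)\<^sup>2 + s * (trace_remainder k (idx i) s (of_coords x) / value_scale k (idx i))))"
    using v by (simp add: field_simps power2_eq_square power3_eq_cube)
  finally show ?thesis
    by (simp add: k_def)
qed

lemma value_scale_nonzero: "value_scale CARD('k) (idx (i :: 'k::{finite,linorder})) \<noteq> 0"
  using bragg_range(3)[of "idx i" "CARD('k)"] idx_bounds[of i] by (simp add: value_scale_def)

text \<open>
  With \<open>y\<close> the sine transform of \<open>x\<close>, the potentials \<open>s x\<close> and \<open>s x0\<close> have the same \<open>Phi\<close> iff \<open>y\<close> solves the perturbed
  square system with data \<open>b\<close>, the sine transform of \<open>x0\<close>.  The perturbation is a polynomial in \<open>s\<close> and \<open>y\<close>,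
  so its bounds on a ball are uniform for \<open>0 < s < 1\<close>, and the ball contains all solutions because the
  sum of squares is invariant.
\<close>

lemma small_potentials:
  fixes x0 :: "real ^ 'k::{finite,linorder}"
  assumes nz: "\<And>i. sine_transform x0 $ i \<noteq> 0"
  shows "\<exists>\<tau>>0. \<forall>s. 0 < s \<and> s < \<tau> \<longrightarrow>
    of_coords (s *\<^sub>R x0) \<notin> singular_set TYPE('k) \<and> card {x. Phi x = Phi (s *\<^sub>R x0)} = 2 ^ CARD('k)"
proof -
  define D where "D = (sine_transform :: (real, 'k) vec \<Rightarrow> (real, 'k) vec)"
  have linD: "linear D"
    unfolding D_def by (rule linear_sine_transform)
  have "inj D"
    unfolding D_def by (rule inj_sine_transform)
  then obtain E where linE: "linear E" and ED: "\<And>x. E (D x) = x" and DE: "\<And>y. D (E y) = y"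
    using linear_injective_isomorphism[OF linD] by blast
  obtain BD where BD: "BD > 0" "\<And>x. norm (D x) \<le> BD * norm x"
    using linear_bounded_pos[OF linD] by blast
  obtain BE where BE: "BE > 0" "\<And>x. norm (E x) \<le> BE * norm x"
    using linear_bounded_pos[OF linE] by blast
  define b where "b = D x0"
  define d where "d = Min (range (\<lambda>i. \<bar>b $ i\<bar>))"
  have d: "d > 0" "d \<le> \<bar>b $ i\<bar>" for i
    using nz by (auto simp: d_def b_def D_def)
  define Q where "Q = (\<Sum>j=1..2 * CARD('k). (of_coords x0 (int j))\<^sup>2)"
  define M where "M = max (2 * norm b) (BD * (real CARD('k) * sqrt Q))"
  define \<alpha> where "\<alpha> i = value_scale CARD('k) (idx i)" for i :: 'k
  have \<alpha>: "\<alpha> i \<noteq> 0" for i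
    unfolding \<alpha>_def by (rule value_scale_nonzero)
  define R where "R s y = (\<chi> i. trace_remainder CARD('k) (idx i) s (of_coords (E y)) / \<alpha> i)" for s y
  define g where "g s y i = (y $ i)\<^sup>2 + s * R s y $ i" for s y and i :: 'k
  define pt where "pt i = 2 * cos (bragg CARD('k) (idx i))" for i :: 'k
  have vals: "poly (lyap (s *\<^sub>R E y)) (pt i) = 2 * (-1) ^ idx i + s\<^sup>2 * (\<alpha> i * g s y i)" for s y i
    using scaled_values[of s "E y" i] DE[of y] by (simp add: pt_def \<alpha>_def g_def R_def D_def)
  have E_b: "E b = x0"
    by (simp add: b_def ED)
  have "\<forall>i :: 'k. \<exists>C\<ge>0. \<forall>z\<in>cball 0 (1 + BE * M). \<bar>trace_remainder CARD('k) (idx i) (fst z) (of_coords (snd z :: (real, 'k) vec))\<bar> \<le> C \<and>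
      (\<forall>w\<in>cball 0 (1 + BE * M). \<bar>trace_remainder CARD('k) (idx i) (fst z) (of_coords (snd z :: (real, 'k) vec))
        - trace_remainder CARD('k) (idx i) (fst w) (of_coords (snd w :: (real, 'k) vec))\<bar> \<le> C * norm (z - w))"
    by (intro allI polynomial_function_lipschitz polynomial_function_trace_remainder)
  then obtain K where K: "\<And>i. K i \<ge> 0"
    "\<And>i z. z \<in> cball 0 (1 + BE * M) \<Longrightarrow> \<bar>trace_remainder CARD('k) (idx (i :: 'k)) (fst z) (of_coords (snd z :: (real, 'k) vec))\<bar> \<le> K i"
    "\<And>i z w. z \<in> cball 0 (1 + BE * M) \<Longrightarrow> w \<in> cball 0 (1 + BE * M) \<Longrightarrow>
      \<bar>trace_remainder CARD('k) (idx (i :: 'k)) (fst z) (of_coords (snd z :: (real, 'k) vec))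
        - trace_remainder CARD('k) (idx i) (fst w) (of_coords (snd w :: (real, 'k) vec))\<bar> \<le> K i * norm (z - w)"
    by metis
  define C where "C = (\<Sum>i\<in>UNIV. K i / \<bar>\<alpha> i\<bar>) * (1 + BE)"
  have K_le: "K i / \<bar>\<alpha> i\<bar> \<le> (\<Sum>i\<in>UNIV. K i / \<bar>\<alpha> i\<bar>)" for i
    using K(1) by (intro member_le_sum) auto
  have K_sum_nonneg: "0 \<le> (\<Sum>i\<in>UNIV. K i / \<bar>\<alpha> i\<bar>)"
    using K(1) by (intro sum_nonneg) auto
  then have C: "C \<ge> 0"
    using BE(1) by (simp add: C_def)
  have in_ball: "(s, E y) \<in> cball 0 (1 + BE * M)" if "0 < s" "s < 1" "y \<in> cball 0 M" for s :: real and y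
  proof -
    have "norm (s, E y) \<le> norm s + norm (E y)"
      by (rule norm_Pair_le)
    also have "\<dots> \<le> 1 + BE * norm y"
      using BE(2)[of y] that by simp
    also have "\<dots> \<le> 1 + BE * M"
      using BE(1) that by simp
    finally show ?thesis
      by simp
  qed
  have bound: "\<bar>R s y $ i\<bar> \<le> C" if s: "0 < s" "s < 1" and y: "y \<in> cball 0 M" for s y i
  proof -
    have "\<bar>R s y $ i\<bar> \<le> K i / \<bar>\<alpha> i\<bar>"
      using K(2)[OF in_ball[OF s y], of i] by (simp add: R_def abs_divide divide_right_mono)
    also have "\<dots> \<le> (\<Sum>i\<in>UNIV. K i / \<bar>\<alpha> i\<bar>) * 1"
      using K_le by simp
    also have "\<dots> \<le> C"
      unfolding C_def using K_sum_nonneg BE(1) by (intro mult_left_mono) auto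
    finally show ?thesis .
  qed
  have lipschitz: "\<bar>R s y $ i - R s z $ i\<bar> \<le> C * norm (y - z)"
    if s: "0 < s" "s < 1" and y: "y \<in> cball 0 M" and z: "z \<in> cball 0 M" for s y z i
  proof -
    have "norm ((s, E y) - (s, E z)) = norm (E (y - z))"
      by (simp add: norm_Pair linear_diff[OF linE])
    then have "norm ((s, E y) - (s, E z)) \<le> BE * norm (y - z)"
      using BE(2)[of "y - z"] by simp
    then have "K i * norm ((s, E y) - (s, E z)) \<le> K i * ((1 + BE) * norm (y - z))"
      using K(1)[of i] by (intro mult_left_mono) (auto simp: distrib_right intro: order_trans)
    then have "\<bar>trace_remainder CARD('k) (idx i) s (of_coords (E y)) - trace_remainder CARD('k) (idx i) s (of_coords (E z))\<bar>
        \<le> K i * ((1 + BE) * norm (y - z))"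
      using K(3)[OF in_ball[OF s y] in_ball[OF s z], of i] by simp
    then have "\<bar>R s y $ i - R s z $ i\<bar> \<le> K i * ((1 + BE) * norm (y - z)) / \<bar>\<alpha> i\<bar>"
      by (simp add: R_def diff_divide_distrib[symmetric] abs_divide divide_right_mono)
    also have "\<dots> = (K i / \<bar>\<alpha> i\<bar>) * ((1 + BE) * norm (y - z))"
      by simp
    also have "\<dots> \<le> (\<Sum>i\<in>UNIV. K i / \<bar>\<alpha> i\<bar>) * ((1 + BE) * norm (y - z))"
      using K_le[of i] BE(1) by (intro mult_right_mono) auto
    finally show ?thesis
      by (simp add: C_def mult.assoc)
  qed
  \<comment> \<open>The last two bounds are the smallness conditions of the perturbed system, with \<open>C + 1\<close>
    in place of \<open>C\<close> to divide by a positive number.\<close>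
  define \<tau> where "\<tau> = min 1 (min (d\<^sup>2 / (4 * (C + 1))) (d / (2 * real CARD('k) * (C + 1))))"
  have card_pos: "real CARD('k) > 0"
    by simp
  have "\<tau> > 0"
    using d(1) C by (simp add: \<tau>_def)
  moreover have "of_coords (s *\<^sub>R x0) \<notin> singular_set TYPE('k) \<and> card {x. Phi x = Phi (s *\<^sub>R x0)} = 2 ^ CARD('k)"
    if s: "0 < s" "s < \<tau>" for s
  proof -
    have s1: "s < 1" "s < d\<^sup>2 / (4 * (C + 1))" "s < d / (2 * real CARD('k) * (C + 1))"
      using s by (auto simp: \<tau>_def)
    interpret perturbed_squares b "R s" C M d s
    proof
      show "4 * s * C \<le> d\<^sup>2"
        using s1(2) s(1) C by (simp add: field_simps)
      show "2 * real CARD('k) * s * C < d"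
      proof -
        have "s * (2 * real CARD('k) * (C + 1)) < d"
          using s1(3) C by (simp add: pos_less_divide_eq)
        moreover have "0 < s * (2 * real CARD('k))"
          using s(1) by simp
        ultimately show ?thesis
          by (simp add: algebra_simps)
      qed
      show "2 * norm b \<le> M"
        by (simp add: M_def)
      show "\<bar>R s y $ i\<bar> \<le> C" if "y \<in> cball 0 M" for y i
        using bound s(1) s1(1) that by blast
      show "\<bar>R s y $ i - R s z $ i\<bar> \<le> C * norm (y - z)" if "y \<in> cball 0 M" "z \<in> cball 0 M" for y z i
        using lipschitz s(1) s1(1) that by blast
    qed (fact d C s(1))+
    have Phi_iff: "Phi (s *\<^sub>R E y) = Phi (s *\<^sub>R x0) \<longleftrightarrow> (\<forall>i. g s y i = g s b i)" for y
      using vals[of s y] vals[of s b] \<alpha> s(1) unfolding Phi_eq_iff_values pt_def[symmetric] E_b by simp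
    have "{x. Phi x = Phi (s *\<^sub>R x0)} = (\<lambda>y. s *\<^sub>R E y) ` square_system_solutions M s (R s) b"
    proof (intro equalityI subsetI)
      fix x assume "x \<in> {x. Phi x = Phi (s *\<^sub>R x0)}"
      then have x: "Phi x = Phi (s *\<^sub>R x0)"
        by simp
      define y where "y = D ((1 / s) *\<^sub>R x)"
      have xy: "x = s *\<^sub>R E y"
        using s(1) by (simp add: y_def ED)
      have "sqrt (\<Sum>j=1..2 * CARD('k). (of_coords (s *\<^sub>R x0) (int j))\<^sup>2) = s * sqrt Q"
        using s(1) by (simp add: of_coords_scale power_mult_distrib Q_def real_sqrt_mult flip: sum_distrib_left)
      then have "norm x \<le> real CARD('k) * (s * sqrt Q)"
        using isospectral_bound[OF x] by simp
      then have "norm ((1 / s) *\<^sub>R x) \<le> real CARD('k) * sqrt Q"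
        using s(1) by (simp add: field_simps)
      then have "BD * norm ((1 / s) *\<^sub>R x) \<le> BD * (real CARD('k) * sqrt Q)"
        using BD(1) by (intro mult_left_mono) auto
      then have "norm y \<le> M"
        using BD(2)[of "(1 / s) *\<^sub>R x"] by (simp add: y_def M_def)
      moreover have "\<forall>i. g s y i = g s b i"
        using Phi_iff[of y] x xy by simp
      ultimately have "y \<in> square_system_solutions M s (R s) b"
        by (simp add: square_system_solutions_def g_def)
      then show "x \<in> (\<lambda>y. s *\<^sub>R E y) ` square_system_solutions M s (R s) b"
        using xy by blast
    next
      fix x assume "x \<in> (\<lambda>y. s *\<^sub>R E y) ` square_system_solutions M s (R s) b"
      then obtain y where "y \<in> square_system_solutions M s (R s) b" "x = s *\<^sub>R E y"
        by blast
      then show "x \<in> {x. Phi x = Phi (s *\<^sub>R x0)}"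
        using Phi_iff[of y] by (simp add: square_system_solutions_def g_def)
    qed
    moreover have "inj_on (\<lambda>y. s *\<^sub>R E y) (square_system_solutions M s (R s) b)"
    proof (rule inj_onI)
      fix y z assume "s *\<^sub>R E y = s *\<^sub>R E z"
      then have "E y = E z"
        using s(1) by simp
      then show "y = z"
        by (metis DE)
    qed
    ultimately have count: "card {x. Phi x = Phi (s *\<^sub>R x0)} = 2 ^ CARD('k)"
      using card_solutions by (simp add: card_image)
    define a where "a = s *\<^sub>R x0"
    define L where "L = (\<Sum>i\<in>(UNIV :: 'k set). norm (moments (pt i) :: (real, 'k) vec) / (s\<^sup>2 * \<bar>\<alpha> i\<bar>))"
    have L: "L \<ge> 0"
      unfolding L_def by (intro sum_nonneg) auto
    define c where "c = d / 2 / (s * BE) / (L + 1)"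
    have c: "c > 0"
      using d(1) s(1) BE(1) L by (simp add: c_def)
    \<comment> \<open>The lower bound for the perturbed squares, transported from the values at the points \<open>pt i\<close> to \<open>Phi\<close>.\<close>
    have lower: "c * norm (z - a) \<le> norm (Phi z - Phi a)" if z: "norm (z - a) \<le> s * d / BD" for z
    proof -
      define y where "y = D ((1 / s) *\<^sub>R z)"
      have z_y: "z = s *\<^sub>R E y"
        using s(1) by (simp add: y_def ED)
      have "y - b = D ((1 / s) *\<^sub>R (z - a))"
        using s(1) by (simp add: y_def b_def a_def linear_diff[OF linD] scaleR_diff_right)
      then have yb: "norm (y - b) \<le> BD * (norm (z - a) / s)" "E (y - b) = (1 / s) *\<^sub>R (z - a)"
        using BD(2)[of "(1 / s) *\<^sub>R (z - a)"] s(1) ED by (auto simp: divide_inverse mult.commute)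
      have "BD * (norm (z - a) / s) \<le> d"
        using z s(1) BD(1) by (simp add: field_simps)
      then have y_near: "norm (y - b) \<le> d"
        using yb(1) by linarith
      have "d \<le> norm b"
        using d(2) component_le_norm_cart by (metis order_trans)
      then have "norm y \<le> 2 * norm b"
        using y_near norm_triangle_sub[of y b] by linarith
      then have y_in: "y \<in> cball 0 M"
        by (simp add: M_def)
      have "norm (z - a) / s \<le> BE * norm (y - b)"
        using BE(2)[of "y - b"] yb(2) s(1) by (simp add: divide_inverse mult.commute)
      then have "norm (z - a) / (s * BE) \<le> norm (y - b)"
        using BE(1) s(1) by (simp add: field_simps)
      then have "d / 2 * (norm (z - a) / (s * BE)) \<le> d / 2 * norm (y - b)"
        using d(1) by (intro mult_left_mono) auto
      also have "\<dots> \<le> (\<Sum>i\<in>UNIV. \<bar>g s y i - g s b i\<bar>)"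
        unfolding g_def by (rule lower_bound[OF y_in y_near])
      also have "\<dots> \<le> (\<Sum>i\<in>UNIV. norm (Phi z - Phi a) * (norm (moments (pt i) :: (real, 'k) vec) / (s\<^sup>2 * \<bar>\<alpha> i\<bar>)))"
      proof (rule sum_mono)
        fix i
        have "s\<^sup>2 * \<alpha> i * (g s y i - g s b i) = poly (lyap z) (pt i) - poly (lyap a) (pt i)"
          using vals[of s y i] vals[of s b i] by (simp add: z_y a_def E_b algebra_simps)
        also have "\<dots> = (Phi z - Phi a) \<bullet> moments (pt i)"
          by (simp add: lyap_eq_inner inner_diff_left)
        finally have "s\<^sup>2 * \<bar>\<alpha> i\<bar> * \<bar>g s y i - g s b i\<bar> = \<bar>(Phi z - Phi a) \<bullet> moments (pt i)\<bar>"
          by (metis abs_mult abs_power2)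
        also have "\<dots> \<le> norm (Phi z - Phi a) * norm (moments (pt i) :: (real, 'k) vec)"
          by (rule Cauchy_Schwarz_ineq2)
        finally show "\<bar>g s y i - g s b i\<bar> \<le> norm (Phi z - Phi a) * (norm (moments (pt i) :: (real, 'k) vec) / (s\<^sup>2 * \<bar>\<alpha> i\<bar>))"
          using s(1) \<alpha>[of i] by (simp add: pos_le_divide_eq mult.commute)
      qed
      also have "\<dots> = norm (Phi z - Phi a) * L"
        by (simp add: L_def sum_distrib_left)
      also have "\<dots> \<le> norm (Phi z - Phi a) * (L + 1)"
        by (intro mult_left_mono) auto
      finally have "d / 2 * (norm (z - a) / (s * BE)) / (L + 1) \<le> norm (Phi z - Phi a)"
        using L by (subst pos_divide_le_eq) auto
      then show ?thesis
        by (simp add: c_def)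
    qed
    obtain Phi' where Phi': "(Phi has_derivative Phi') (at a)"
      using Phi_has_derivative[of a] unfolding Phi_def[abs_def] by blast
    have "\<forall>\<^sub>F z in at a. c * norm (z - a) \<le> norm (Phi z - Phi a)"
      unfolding eventually_at using lower s(1) d(1) BD(1)
      by (intro exI[of _ "s * d / BD"]) (auto simp: dist_norm)
    then have "inj Phi'"
      by (rule inj_derivative_of_lower_bound[OF Phi' c])
    then show ?thesis
      using singular_iff[OF Phi'] count by (simp add: a_def)
  qed
  ultimately show ?thesis
    by blast
qed

text \<open>
  The spectrum and the Lyapunov polynomial determine each other.
\<close>

lemma Iso_eq_image:
  fixes x :: "real ^ 'k::{finite,linorder}"
  shows "Iso CARD('k) (of_coords x) = of_coords ` {y :: (real, 'k) vec. Phi y = Phi x}"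
proof (intro equalityI subsetI)
  fix p assume "p \<in> Iso CARD('k) (of_coords x)"
  then have p: "p \<in> Qodd CARD('k)" "spec p = spec (of_coords x)"
    by (auto simp: Iso_def)
  define y where "y = (coords p :: (real, 'k) vec)"
  have "of_coords y = p"
    unfolding y_def by (rule of_coords_coords[OF p(1)])
  moreover have "Phi y = Phi x"
    using p(2) spec_eq_iff[OF of_coords_in_Qodd[of y] of_coords_in_Qodd[of x] card_ge_1]
      lyapunov_eq_iff_Phi_eq[OF of_coords_in_Qodd[of y] of_coords_in_Qodd[of x]] \<open>of_coords y = p\<close>
    by (simp add: Phi_def)
  ultimately show "p \<in> of_coords ` {y. Phi y = Phi x}"
    by blast
next
  fix p assume "p \<in> of_coords ` {y. Phi y = Phi x}"
  then obtain y where y: "p = of_coords y" "Phi y = Phi x"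
    by blast
  then have "spec p = spec (of_coords x)"
    using spec_eq_iff[OF of_coords_in_Qodd[of y] of_coords_in_Qodd[of x] card_ge_1]
      lyapunov_eq_iff_Phi_eq[OF of_coords_in_Qodd[of y] of_coords_in_Qodd[of x]]
    by (simp add: Phi_def)
  then show "p \<in> Iso CARD('k) (of_coords x)"
    using y of_coords_in_Qodd by (simp add: Iso_def)
qed

section \<open>Regular points of the gap heights and small isospectral sets\<close>

theorem theorem1p2:
  fixes q :: "int \<Rightarrow> real" and k :: nat
  assumes "k = CARD('k::{finite,linorder})"
    and "q \<in> Qodd k"
  shows
    "((q_differentiable (h_map :: _ \<Rightarrow> real ^ 'k::{finite,linorder}) q \<and>
       det (q_jacobian (h_map :: _ \<Rightarrow> real ^ 'k::{finite,linorder}) q) \<noteq> 0)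
        \<longleftrightarrow> q \<notin> singular_set TYPE('k)) \<and>
     (q \<notin> singular_set TYPE('k) \<longrightarrow>
        (\<forall>n\<in>{1..k}. gap_height k q n > 0) \<and>
        (\<forall>n\<in>{1..2 * k - 1}. lambda_minus k q n < lambda_plus k q n)) \<and>
     ((\<forall>m\<in>{1..k}. q_hat k q m \<noteq> 0) \<longrightarrow>
        (\<exists>\<tau>>0. \<forall>s. 0 < s \<and> s < \<tau> \<longrightarrow>
           (\<lambda>n. s * q n) \<notin> singular_set TYPE('k) \<and>
           card (Iso k (\<lambda>n. s * q n)) = 2 ^ k))"
proof -
  define x where "x = (coords q :: (real, 'k) vec)"
  have q: "q = of_coords x" and qodd: "q \<in> Qodd CARD('k)"
    using of_coords_coords[of q, where 'k = 'k] assms by (auto simp: x_def)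
  have regular: "(q_differentiable (h_map :: _ \<Rightarrow> (real, 'k) vec) q \<and>
       det (q_jacobian (h_map :: _ \<Rightarrow> (real, 'k) vec) q) \<noteq> 0) \<longleftrightarrow> q \<notin> singular_set TYPE('k)"
    unfolding q by (rule regular_heights_iff)
  have open_gaps: "(\<forall>n\<in>{1..k}. gap_height k q n > 0) \<and> (\<forall>n\<in>{1..2 * k - 1}. lambda_minus k q n < lambda_plus k q n)"
    if "q \<notin> singular_set TYPE('k)"
    using regular_open_gaps[of x] that unfolding q assms(1) by auto
  have small: "\<exists>\<tau>>0. \<forall>s. 0 < s \<and> s < \<tau> \<longrightarrow>
      (\<lambda>n. s * q n) \<notin> singular_set TYPE('k) \<and> card (Iso k (\<lambda>n. s * q n)) = 2 ^ k"
    if hat: "\<forall>m\<in>{1..k}. q_hat k q m \<noteq> 0"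
  proof -
    have "sine_transform x $ i \<noteq> 0" for i
    proof -
      have m: "idx i \<in> {1..CARD('k)}"
        using idx_bounds[of i] by simp
      then have "q_hat CARD('k) q (idx i) \<noteq> 0"
        using hat assms(1) by blast
      then show ?thesis
        using q_hat_eq[OF qodd m] sine_norm_pos[OF card_ge_1[where 'k = 'k], of "idx i"]
        by (simp add: sine_transform_def q)
    qed
    then obtain \<tau> where \<tau>: "\<tau> > 0" "\<And>s. 0 < s \<Longrightarrow> s < \<tau> \<Longrightarrow>
        of_coords (s *\<^sub>R x) \<notin> singular_set TYPE('k) \<and> card {y. Phi y = Phi (s *\<^sub>R x)} = 2 ^ CARD('k)"
      using small_potentials by blast
    have "inj_on of_coords A" for A :: "(real, 'k) vec set"
      by (rule inj_onI) (metis coords_of_coords)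
    then have "card (Iso k (\<lambda>n. s * q n)) = card {y. Phi y = Phi (s *\<^sub>R x)}" for s
      using Iso_eq_image[of "s *\<^sub>R x"] by (simp add: card_image of_coords_scale q assms(1))
    then show ?thesis
      using \<tau> by (intro exI[of _ \<tau>]) (simp add: of_coords_scale q assms(1))
  qed
  show ?thesis
    using regular open_gaps small by blast
qed

end
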